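(* Let $A,B\in\mathbb{Z}$ satisfy $-1\leq A\leq B$, $B\geq 2$ and $2A<B+3$, and let $T$ be the tile defined below. Then: (1) if $A\in\{-1,0,1\}$ and $B\geq 2$, or if $A=2$ and $B=2$, then $T$ is disk-like; (2) if $A\geq 2$ and $B\geq 3$, then $T$ is not disk-like.
   Context: Let $a(x,y)=(x+1,y)$ and $c(x,y)=(-x,-y)$. Let $g(\mathbf{x})=\begin{pmatrix}0&-B\\1&-A\end{pmatrix}\mathbf{x}+\left(\frac{B-1}{2},0\right)^T$, $\mathcal{D}=\{id,a,\dots,a^{B-2},c\}$ if $B\geq3$ and $\mathcal{D}=\{id,c\}$ if $B=2$, and let $T$ be the unique nonempty compact set with $g(T)=\bigcup_{\delta\in\mathcal{D}}\delta(T)$. Disk-like means homeomorphic to a closed disk. *)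

theory Defs
  imports "HOL-Analysis.Analysis"
begin

text \<open>Points of the plane are pairs of reals; the Euclidean norm on real \<times> real
  makes cball 0 1 the closed unit disk.\<close>

definition tr_a :: "real \<times> real \<Rightarrow> real \<times> real" where
  "tr_a p = (fst p + 1, snd p)"

definition rot_c :: "real \<times> real \<Rightarrow> real \<times> real" where
  "rot_c p = (- fst p, - snd p)"

text \<open>g(x) = M x + ((B-1)/2, 0) with M = [[0,-B],[1,-A]].\<close>
definition gmap :: "int \<Rightarrow> int \<Rightarrow> real \<times> real \<Rightarrow> real \<times> real" where
  "gmap A B p = (- of_int B * snd p + (of_int B - 1) / 2, fst p - of_int A * snd p)"

definition digits :: "int \<Rightarrow> (real \<times> real \<Rightarrow> real \<times> real) set" where
  "digits B = (if B \<ge> 3 then {tr_a ^^ k | k. k \<le> nat (B - 2)} \<union> {rot_c}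
               else {id, rot_c})"

definition tile :: "int \<Rightarrow> int \<Rightarrow> (real \<times> real) set" where
  "tile A B = (THE T. compact T \<and> T \<noteq> {} \<and>
                  gmap A B ` T = (\<Union>\<delta>\<in>digits B. \<delta> ` T))"

definition disk_like :: "(real \<times> real) set \<Rightarrow> bool" where
  "disk_like S \<longleftrightarrow> S homeomorphic cball (0 :: real \<times> real) 1"

end

theory Submission
  imports Defs "HOL-Complex_Analysis.Complex_Analysis"
begin

text \<open>
  The set \<open>S = T \<union> - T\<close> is a self-affine tile for the lattice \<open>\<int>\<^sup>2\<close>. A bound on integer recurrences determines which
  translates of \<open>S\<close> meet \<open>S\<close>, and from this all intersections among the lattice translates of \<open>T\<close> and \<open>- T\<close> can be
  computed through the map \<open>g\<close>.

  If \<open>A \<ge> 2\<close> and \<open>B \<ge> 3\<close>, then \<open>T \<inter> ((1, 0) - T)\<close> falls into two separated pieces. Were \<open>T\<close> a disk, the complement of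
  \<open>T \<union> ((1, 0) - T)\<close> would be connected, because the remaining tiles are disks linked to one another outside these two;
  by Janiszewski's theorem the intersection would then be connected.

  In the disk-like cases the intersections with neighbouring tiles, and \<open>T \<inter> - T\<close> itself, are chains of contracted
  copies of one another, hence arcs. They close up to a Jordan curve \<open>J \<subseteq> T\<close> with \<open>T - J\<close> open, so \<open>T\<close> is \<open>J\<close> together
  with its inside. That such a set is a closed disk is the theorem of Schoenflies, obtained here from the Riemann
  mapping theorem by extending the Riemann map to the boundary.
\<close>

section \<open>Zeros of holomorphic functions by the two-constants principle\<close>

definition two_constants_domain ::
    "(complex \<Rightarrow> complex) \<Rightarrow> complex \<Rightarrow> complex \<Rightarrow> real \<Rightarrow> real \<Rightarrow> real \<Rightarrow> real \<Rightarrow> complex set \<Rightarrow> bool" where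
  "two_constants_domain h w p M \<rho> \<epsilon> \<delta> U \<longleftrightarrow>
    open U \<and> bounded U \<and> w \<in> U \<and> p \<notin> closure U \<and> h holomorphic_on U \<and> continuous_on (closure U) h \<and>
    (\<forall>z\<in>frontier U. norm (h z) \<le> M \<and> \<rho> \<le> norm (z - p) \<or> norm (h z) \<le> \<epsilon> \<and> \<delta> \<le> norm (z - p))"

lemma norm_le_two_constants:
  assumes dom: "two_constants_domain h w p M \<rho> \<epsilon> \<delta> U"
    and pos: "0 < \<rho>" "0 < \<delta>" "0 \<le> M" "0 \<le> \<epsilon>" and near: "norm (w - p) \<le> \<sigma>"
  shows "norm (h w) \<le> (\<sigma> / \<rho>) ^ n * M + (\<sigma> / \<delta>) ^ n * \<epsilon>"
proof -
  have U: "open U" "bounded U" "w \<in> U" "p \<notin> closure U" and h: "h holomorphic_on U" "continuous_on (closure U) h"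
    using dom unfolding two_constants_domain_def by blast+
  have frontier: "norm (h z) \<le> M \<and> \<rho> \<le> norm (z - p) \<or> norm (h z) \<le> \<epsilon> \<and> \<delta> \<le> norm (z - p)"
      if "z \<in> frontier U" for z
    using dom that unfolding two_constants_domain_def by blast+
  define k where "k z = h z / (z - p) ^ n" for z
  have off_pole: "z - p \<noteq> 0" if "z \<in> closure U" for z using that U(4) by auto
  then have wp: "0 < norm (w - p)" using U(3) closure_subset by force
  have "norm (k w) \<le> M / \<rho> ^ n + \<epsilon> / \<delta> ^ n"
  proof (rule maximum_modulus_frontier[OF _ _ U(2) _ U(3)])
    show "k holomorphic_on interior U" unfolding k_def interior_open[OF U(1)]
      using off_pole closure_subset by (intro holomorphic_intros h) auto
    show "continuous_on (closure U) k" unfolding k_def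
      using off_pole by (intro continuous_intros h) auto
    fix z assume "z \<in> frontier U"
    from frontier[OF this] show "norm (k z) \<le> M / \<rho> ^ n + \<epsilon> / \<delta> ^ n"
    proof (elim disjE conjE)
      assume "norm (h z) \<le> M" "\<rho> \<le> norm (z - p)"
      then have "norm (k z) \<le> M / \<rho> ^ n" unfolding k_def norm_divide norm_power
        using pos by (intro frac_le power_mono) auto
      then show ?thesis using pos by (simp add: add_increasing2)
    next
      assume "norm (h z) \<le> \<epsilon>" "\<delta> \<le> norm (z - p)"
      then have "norm (k z) \<le> \<epsilon> / \<delta> ^ n" unfolding k_def norm_divide norm_power
        using pos by (intro frac_le power_mono) auto
      then show ?thesis using pos by (simp add: add_increasing)
    qed
  qed
  moreover have "norm (h w) = norm (k w) * norm (w - p) ^ n"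
    using wp by (simp add: k_def norm_divide norm_power)
  ultimately have "norm (h w) \<le> (M / \<rho> ^ n + \<epsilon> / \<delta> ^ n) * \<sigma> ^ n"
    using near pos by (auto intro!: mult_mono power_mono)
  then show ?thesis by (simp add: power_divide algebra_simps)
qed

lemma zero_if_two_constants:
  fixes h :: "complex \<Rightarrow> complex"
  assumes pos: "0 < \<delta>" "0 \<le> M" and near: "norm (w - p) \<le> \<sigma>" "\<sigma> < \<rho>"
    and domains: "\<And>\<epsilon>. 0 < \<epsilon> \<Longrightarrow> \<exists>U. two_constants_domain h w p M \<rho> \<epsilon> \<delta> U"
  shows "h w = 0"
proof -
  have \<sigma>: "0 \<le> \<sigma>" using near(1) norm_ge_zero order_trans by blast
  have "norm (h w) \<le> (\<sigma> / \<rho>) ^ n * M" for n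
  proof (rule field_le_epsilon)
    fix e :: real assume "0 < e"
    define q where "q = (\<sigma> / \<delta>) ^ n"
    define \<epsilon> where "\<epsilon> = e / (q + 1)"
    have "0 \<le> q" using \<sigma> pos by (simp add: q_def)
    then have "0 < \<epsilon>" "q * \<epsilon> \<le> e" using \<open>0 < e\<close> by (auto simp: \<epsilon>_def field_simps)
    from domains[OF \<open>0 < \<epsilon>\<close>] obtain U where "two_constants_domain h w p M \<rho> \<epsilon> \<delta> U" by blast
    then have "norm (h w) \<le> (\<sigma> / \<rho>) ^ n * M + q * \<epsilon>"
      unfolding q_def using pos \<sigma> near \<open>0 < \<epsilon>\<close> by (intro norm_le_two_constants) auto
    with \<open>q * \<epsilon> \<le> e\<close> show "norm (h w) \<le> (\<sigma> / \<rho>) ^ n * M + e" by linarith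
  qed
  moreover have "(\<lambda>n. (\<sigma> / \<rho>) ^ n * M) \<longlonglongrightarrow> 0 * M"
    using \<sigma> near(2) by (intro tendsto_mult LIMSEQ_realpow_zero tendsto_const) auto
  ultimately have "norm (h w) \<le> 0 * M" by (meson LIMSEQ_le_const)
  then show ?thesis by simp
qed

lemma fashoda_complex:
  fixes f g :: "real \<Rightarrow> complex"
  assumes "path f" "path g"
    and box: "\<And>z. z \<in> path_image f \<union> path_image g \<Longrightarrow> x0 \<le> Re z \<and> Re z \<le> x1 \<and> y0 \<le> Im z \<and> Im z \<le> y1"
    and "Re (pathstart f) = x0" "Re (pathfinish f) = x1"
    and "Im (pathstart g) = y0" "Im (pathfinish g) = y1"
  shows "path_image f \<inter> path_image g \<noteq> {}"
proof -
  define V :: "complex \<Rightarrow> real^2" where "V z = vector [Re z, Im z]" for z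
  have V_1: "V z $ 1 = Re z" and V_2: "V z $ 2 = Im z" for z by (simp_all add: V_def)
  have inj: "V z = V z' \<Longrightarrow> z = z'" for z z' by (metis V_1 V_2 complex_eqI)
  have "continuous_on UNIV (\<lambda>z. V z $ i)" for i
    using exhaust_2[of i] by (auto simp: V_1 V_2 intro!: linear_continuous_on bounded_linear_Re bounded_linear_Im)
  then have "continuous_on UNIV (\<lambda>z. \<chi> i. V z $ i)" by (rule continuous_on_vec_lambda)
  then have cont: "continuous_on A V" for A using continuous_on_subset[of UNIV V A] by simp
  obtain z where z: "z \<in> path_image (V \<circ> f)" "z \<in> path_image (V \<circ> g)"
  proof (rule fashoda[of "V \<circ> f" "V \<circ> g" "vector [x0,y0]" "vector [x1,y1]"])
    show "path (V \<circ> f)" "path (V \<circ> g)" using assms cont by (auto intro: path_continuous_image)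
    show "path_image (V \<circ> f) \<subseteq> cbox (vector [x0,y0]) (vector [x1,y1])"
         "path_image (V \<circ> g) \<subseteq> cbox (vector [x0,y0]) (vector [x1,y1])"
      using box by (auto simp: path_image_compose mem_box_cart forall_2 V_1 V_2)
  qed (use assms in \<open>auto simp: pathstart_def pathfinish_def V_1 V_2\<close>)
  then show ?thesis by (auto simp: path_image_compose dest!: inj)
qed

definition small_crossing :: "(complex \<Rightarrow> complex) \<Rightarrow> real \<Rightarrow> real \<Rightarrow> (real \<Rightarrow> complex) \<Rightarrow> bool" where
  "small_crossing h c \<epsilon> \<gamma> \<longleftrightarrow> path \<gamma> \<and> path_image \<gamma> \<subseteq> ball 0 1 - cball 0 (1 - \<epsilon>) \<and>
    Im (pathstart \<gamma>) = - c \<and> Im (pathfinish \<gamma>) = c \<and>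
    (\<forall>z\<in>path_image \<gamma>. \<bar>Im z\<bar> \<le> c \<and> 0 < Re z \<and> norm (h z) \<le> \<epsilon>)"

lemma small_crossing_mono: "small_crossing h c \<epsilon> \<gamma> \<Longrightarrow> \<epsilon> \<le> \<epsilon>' \<Longrightarrow> small_crossing h c \<epsilon>' \<gamma>"
  unfolding small_crossing_def by fastforce

locale disc_crossing =
  fixes h :: "complex \<Rightarrow> complex" and c \<epsilon> :: real and \<gamma> :: "real \<Rightarrow> complex"
  assumes c: "0 < c" "c < 1" and \<epsilon>: "0 < \<epsilon>" "\<epsilon> \<le> c * (1 - c)" "\<epsilon> < c/4"
    and crossing: "small_crossing h c \<epsilon> \<gamma>"
begin

definition lens :: "complex set" where "lens = ball 1 c \<inter> ball 0 1"

definition base :: complex where "base = of_real (1 - c/4)"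

definition behind :: "complex set" where
  "behind = connected_component_set (lens - path_image \<gamma>) base"

lemma path: "path \<gamma>" and crossing_ends: "Im (pathstart \<gamma>) = - c" "Im (pathfinish \<gamma>) = c"
  using crossing by (auto simp: small_crossing_def)

lemma on_crossing:
  assumes "z \<in> path_image \<gamma>"
  shows "1 - \<epsilon> < norm z" "norm z < 1" "\<bar>Im z\<bar> \<le> c" "0 < Re z" "norm (h z) \<le> \<epsilon>"
  using crossing assms by (auto simp: small_crossing_def)

lemma Re_crossing:
  assumes z: "z \<in> path_image \<gamma>"
  shows "1 - c \<le> Re z"
proof (rule ccontr)
  assume "\<not> 1 - c \<le> Re z"
  then have "(Re z)\<^sup>2 \<le> (1 - c)\<^sup>2" using on_crossing[OF z] by (intro power_mono) auto
  moreover have "(Im z)\<^sup>2 \<le> c\<^sup>2" using on_crossing[OF z] abs_le_square_iff[of "Im z" c] c by simp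
  ultimately have "(norm z)\<^sup>2 \<le> (1 - c)\<^sup>2 + c\<^sup>2" by (simp add: cmod_power2)
  also have "\<dots> = 1 - 2 * (c * (1 - c))" by (simp add: power2_eq_square algebra_simps)
  also have "\<dots> \<le> 1 - 2 * \<epsilon>" using \<epsilon> by simp
  also have "\<dots> \<le> (1 - \<epsilon>)\<^sup>2" using zero_le_power2[of \<epsilon>] by (simp add: power2_eq_square algebra_simps)
  finally have "norm z \<le> 1 - \<epsilon>" using \<epsilon> c by (intro power2_le_imp_le[of "norm z" "1 - \<epsilon>"]) auto
  then show False using on_crossing[OF z] by simp
qed

lemma lens_bounds:
  assumes "z \<in> lens"
  shows "1 - c \<le> Re z" "Re z \<le> 1" "- c \<le> Im z" "Im z \<le> c"
proof -
  have "norm (1 - z) < c" "norm z < 1" using assms by (auto simp: lens_def dist_norm)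
  then show "1 - c \<le> Re z" "Re z \<le> 1" "- c \<le> Im z" "Im z \<le> c"
    using abs_Re_le_cmod[of "1 - z"] abs_Im_le_cmod[of "1 - z"] complex_Re_le_cmod[of z] by auto
qed

lemma norm_base: "norm base = 1 - c/4"
  using c by (simp only: base_def norm_of_real; simp)

lemma base_mem: "base \<in> lens - path_image \<gamma>"
proof -
  have "1 - base = of_real (c/4)" by (simp add: base_def)
  then have "norm (1 - base) = c/4" using c by (simp only: norm_of_real; simp)
  then show ?thesis using norm_base on_crossing(1)[of base] c \<epsilon> by (auto simp: lens_def dist_norm)
qed

lemma open_behind: "open behind"
  unfolding behind_def lens_def using closed_path_image[OF path]
  by (intro open_connected_component open_Diff open_Int) auto

lemma behind_subset: "behind \<subseteq> lens - path_image \<gamma>"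
  unfolding behind_def by (rule connected_component_subset)

lemma base_behind: "base \<in> behind"
  unfolding behind_def using base_mem by simp

lemma extended_path_meets_crossing:
  assumes "path \<sigma>" "path_image \<sigma> \<subseteq> lens" "pathstart \<sigma> = base" and y: "pathfinish \<sigma> = y"
  shows "(closed_segment (of_real (1 - c)) base \<union> path_image \<sigma> \<union> closed_segment y (Complex 1 (Im y)))
    \<inter> path_image \<gamma> \<noteq> {}"
proof -
  define extension where
    "extension = linepath (of_real (1 - c)) base +++ \<sigma> +++ linepath y (Complex 1 (Im y))"
  have image: "path_image extension =
      closed_segment (of_real (1 - c)) base \<union> path_image \<sigma> \<union> closed_segment y (Complex 1 (Im y))"
    using assms by (simp add: extension_def path_image_join Un_assoc)
  have "y \<in> lens" using pathfinish_in_path_image[of \<sigma>] assms by auto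
  note yb = lens_bounds[OF this]
  have "path_image extension \<inter> path_image \<gamma> \<noteq> {}"
  proof (rule fashoda_complex[where ?x0.0="1 - c" and ?x1.0=1 and ?y0.0="- c" and ?y1.0=c])
    show "path extension" using assms by (simp add: extension_def)
    show "Re (pathstart extension) = 1 - c" "Re (pathfinish extension) = 1" by (simp_all add: extension_def)
    fix z assume "z \<in> path_image extension \<union> path_image \<gamma>"
    then consider "z \<in> closed_segment (of_real (1 - c)) base" | "z \<in> lens"
      | "z \<in> closed_segment y (Complex 1 (Im y))" | "z \<in> path_image \<gamma>"
      using image assms by auto
    then show "1 - c \<le> Re z \<and> Re z \<le> 1 \<and> - c \<le> Im z \<and> Im z \<le> c"
    proof cases
      assume "z \<in> closed_segment (of_real (1 - c)) base"
      then show ?thesis using c by (simp add: base_def closed_segment_same_Im closed_segment_eq_real_ivl)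
    next
      assume "z \<in> closed_segment y (Complex 1 (Im y))"
      then show ?thesis using yb by (simp add: closed_segment_same_Im closed_segment_eq_real_ivl)
    next
      assume z: "z \<in> path_image \<gamma>"
      show ?thesis using Re_crossing[OF z] on_crossing[OF z] complex_Re_le_cmod[of z] by auto
    qed (use lens_bounds in auto)
  qed (use path crossing_ends in auto)
  then show ?thesis unfolding image .
qed

lemma behind_meets_crossing:
  assumes y: "y \<in> behind"
  obtains z where "z \<in> path_image \<gamma>" "norm y \<le> norm z"
proof -
  have "path_component behind base y"
    using base_behind open_behind connected_open_path_connected y
    by (metis behind_def connected_connected_component path_connected_component)
  then obtain \<sigma> where \<sigma>: "path \<sigma>" "path_image \<sigma> \<subseteq> behind" "pathstart \<sigma> = base" "pathfinish \<sigma> = y"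
    by (auto simp: path_component_def)
  then obtain z where z: "z \<in> path_image \<gamma>"
    "z \<in> closed_segment (of_real (1 - c)) base \<union> closed_segment y (Complex 1 (Im y))"
    using extended_path_meets_crossing[of \<sigma> y] behind_subset by blast
  have "z \<notin> closed_segment (of_real (1 - c)) base"
  proof
    assume "z \<in> closed_segment (of_real (1 - c)) base"
    then have "Im z = 0" "0 \<le> Re z" "Re z \<le> 1 - c/4"
      using c by (auto simp: base_def closed_segment_same_Im closed_segment_eq_real_ivl)
    then show False using on_crossing(1)[OF z(1)] \<epsilon> by (simp add: cmod_def)
  qed
  then have zy: "z \<in> closed_segment y (Complex 1 (Im y))" using z(2) by blast
  have "1 - c \<le> Re y" "Re y \<le> 1" using lens_bounds y behind_subset by auto
  then have "Im z = Im y" "0 \<le> Re y" "Re y \<le> Re z"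
    using zy c by (auto simp: closed_segment_same_Im closed_segment_eq_real_ivl)
  then have "norm y \<le> norm z" by (simp add: cmod_def power_mono)
  with z(1) show thesis by (rule that)
qed

lemma norm_behind:
  obtains R where "R < 1" "behind \<subseteq> cball 0 R"
proof -
  have "compact (norm ` path_image \<gamma>)"
    using path by (intro compact_continuous_image compact_path_image continuous_intros)
  moreover have "norm ` path_image \<gamma> \<noteq> {}" by simp
  ultimately obtain R where R: "R \<in> norm ` path_image \<gamma>" "\<And>z. z \<in> path_image \<gamma> \<Longrightarrow> norm z \<le> R"
    using compact_attains_sup by (metis imageI)
  show thesis
  proof (rule that)
    show "R < 1" using R(1) on_crossing(2) by auto
    show "behind \<subseteq> cball 0 R"
    proof
      fix y assume "y \<in> behind"
      then obtain z where "z \<in> path_image \<gamma>" "norm y \<le> norm z" by (rule behind_meets_crossing)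
      then show "y \<in> cball 0 R" using R(2)[of z] by simp
    qed
  qed
qed

lemma closure_behind: "closure behind \<subseteq> ball 0 1"
proof -
  obtain R where "R < 1" "behind \<subseteq> cball 0 R" by (rule norm_behind)
  then have "closure behind \<subseteq> cball 0 R" by (simp add: closure_minimal)
  with \<open>R < 1\<close> show ?thesis by auto
qed

lemma frontier_behind:
  assumes z: "z \<in> frontier behind"
  shows "z \<in> path_image \<gamma> \<or> dist 1 z = c"
proof -
  have "open (lens - path_image \<gamma>)"
    unfolding lens_def using closed_path_image[OF path] by (intro open_Diff open_Int) auto
  moreover have "z \<in> frontier (lens - path_image \<gamma>)"
    using z frontier_of_connected_component_subset unfolding behind_def by blast
  ultimately have "z \<notin> lens - path_image \<gamma>" by (simp add: frontier_def interior_open)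
  moreover have "z \<in> ball 0 1" using z closure_behind by (auto simp: frontier_def)
  moreover have "closure behind \<subseteq> cball 1 c"
    using behind_subset by (intro closure_minimal) (auto simp: lens_def)
  then have "dist 1 z \<le> c" using z by (auto simp: frontier_def)
  ultimately show ?thesis by (auto simp: lens_def)
qed

text \<open>The pole \<open>1 + c/4\<close> has distance \<open>c/2\<close> to \<open>base\<close>, at least \<open>c/4\<close> to the crossing and at least \<open>3c/4\<close> to
  the circle bounding the lens.\<close>

lemma behind_two_constants_domain:
  assumes hol: "h holomorphic_on ball 0 1" and M: "\<And>z. z \<in> ball 0 1 \<Longrightarrow> norm (h z) \<le> M" and e: "\<epsilon> \<le> e"
  shows "two_constants_domain h base (of_real (1 + c/4)) M (3 * c/4) e (c/4) behind"
proof -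
  define p :: complex where "p = of_real (1 + c/4)"
  have norm_p: "norm p = 1 + c/4" using c by (simp only: p_def norm_of_real; simp)
  have "norm (h z) \<le> M \<and> 3 * c/4 \<le> norm (z - p) \<or> norm (h z) \<le> e \<and> c/4 \<le> norm (z - p)"
    if z: "z \<in> frontier behind" for z
  proof (cases "z \<in> path_image \<gamma>")
    case True
    have "c/4 \<le> norm (z - p)"
      using on_crossing(2)[OF True] norm_triangle_ineq2[of p z] norm_p by (simp add: norm_minus_commute)
    then show ?thesis using on_crossing(5)[OF True] e by simp
  next
    case False
    then have "norm (z - 1) = c" using frontier_behind[OF z] by (simp add: dist_norm norm_minus_commute)
    moreover have "norm (p - 1) = c/4" using c by (simp add: p_def)
    ultimately have "3 * c/4 \<le> norm (z - p)" using norm_triangle_ineq2[of "z - 1" "p - 1"] by simp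
    then show ?thesis using M[of z] z closure_behind by (auto simp: frontier_def)
  qed
  moreover have "bounded behind" using closure_behind closure_subset bounded_ball bounded_subset by metis
  moreover have "p \<notin> closure behind" using closure_behind norm_p c by auto
  moreover have "h holomorphic_on behind" "continuous_on (closure behind) h"
    using hol holomorphic_on_imp_continuous_on[OF hol] closure_behind closure_subset
    by (meson holomorphic_on_subset continuous_on_subset subset_trans)+
  ultimately show ?thesis
    unfolding two_constants_domain_def p_def[symmetric] using open_behind base_behind by blast
qed

end

lemma holomorphic_zero_behind_crossings:
  fixes h :: "complex \<Rightarrow> complex"
  assumes hol: "h holomorphic_on ball 0 1" and M: "\<And>z. z \<in> ball 0 1 \<Longrightarrow> norm (h z) \<le> M"
    and c: "0 < c" "c < 1" and cross: "\<And>\<epsilon>. 0 < \<epsilon> \<Longrightarrow> \<exists>\<gamma>. small_crossing h c \<epsilon> \<gamma>"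
  shows "h (of_real (1 - c/4)) = 0"
proof (rule zero_if_two_constants[of "c/4" M "of_real (1 - c/4)" "of_real (1 + c/4)" "c/2" "3 * c/4" h])
  show "0 < c/4" "c/2 < 3 * c/4" using c by auto
  show "0 \<le> M" using M[of 0] norm_ge_zero order_trans by (metis centre_in_ball zero_less_one)
  have "of_real (1 - c/4) - of_real (1 + c/4) = (of_real (- (c/2)) :: complex)" by simp
  then show "norm (of_real (1 - c/4) - of_real (1 + c/4) :: complex) \<le> c/2"
    using c by (simp only: norm_of_real; simp)
  fix e :: real assume "0 < e"
  define \<epsilon> where "\<epsilon> = min e (min (c * (1 - c)) (c/8))"
  have \<epsilon>: "0 < \<epsilon>" "\<epsilon> \<le> c * (1 - c)" "\<epsilon> < c/4" and "\<epsilon> \<le> e"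
    using c \<open>0 < e\<close> by (auto simp: \<epsilon>_def min_less_iff_disj)
  obtain \<gamma> where "small_crossing h c \<epsilon> \<gamma>" using cross[OF \<epsilon>(1)] by blast
  then interpret disc_crossing h c \<epsilon> \<gamma> using c \<epsilon> by unfold_locales
  show "\<exists>U. two_constants_domain h (of_real (1 - c/4)) (of_real (1 + c/4)) M (3 * c/4) e (c/4) U"
    using behind_two_constants_domain[OF hol M \<open>\<epsilon> \<le> e\<close>] unfolding base_def by blast
qed

section \<open>Boundary extension of the Riemann map\<close>

lemma connected_subset_left:
  assumes "connected C" "open U" "open V" "U \<inter> V = {}" "C \<subseteq> U \<union> V" "C \<inter> U \<noteq> {}"
  shows "C \<subseteq> U"
  using connectedD[OF assms(1-3)] assms(4-6) by blast

lemma closed_path_split_at_point: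
  fixes c :: "real \<Rightarrow> 'a::metric_space"
  assumes c: "simple_path c" "pathfinish c = pathstart c" and w: "w \<in> path_image c" and e: "0 < e"
  obtains K where "compact K" "connected K" "K \<subseteq> path_image c" "w \<notin> K" "path_image c - K \<subseteq> ball w e"
proof -
  obtain t where t: "t \<in> {0..1}" "w = c t" using w by (auto simp: path_image_def)
  define k where "k = shiftpath t c"
  have k: "simple_path k" "path_image k = path_image c" "k 0 = w" "k 1 = w"
    using t c simple_path_shiftpath[of c t] path_image_shiftpath[of t c]
    by (simp_all add: k_def) (auto simp: shiftpath_def pathstart_def pathfinish_def)
  have cont: "continuous_on {0..1} k" using k(1) by (simp add: simple_path_def path_def)
  then have "uniformly_continuous_on {0..1} k" by (intro compact_uniformly_continuous) auto
  then obtain d where d: "0 < d" "\<And>s t. s \<in> {0..1} \<Longrightarrow> t \<in> {0..1} \<Longrightarrow> dist s t < d \<Longrightarrow> dist (k s) (k t) < e"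
    using e unfolding uniformly_continuous_on_def by metis
  define \<eta> where "\<eta> = min (1/4) d"
  have \<eta>: "0 < \<eta>" "\<eta> \<le> 1/4" "\<eta> \<le> d" using d by (auto simp: \<eta>_def)
  show thesis
  proof (rule that)
    have "continuous_on {\<eta>..1-\<eta>} k" using cont by (rule continuous_on_subset) (use \<eta> in auto)
    then show "compact (k ` {\<eta>..1-\<eta>})" "connected (k ` {\<eta>..1-\<eta>})"
      by (auto intro: compact_continuous_image connected_continuous_image)
    show "k ` {\<eta>..1-\<eta>} \<subseteq> path_image c" using \<eta> k(2) unfolding path_image_def by fastforce
    show "w \<notin> k ` {\<eta>..1-\<eta>}" using k(1,3) \<eta> by (force simp: simple_path_def loop_free_def)
    show "path_image c - k ` {\<eta>..1-\<eta>} \<subseteq> ball w e"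
    proof
      fix x assume "x \<in> path_image c - k ` {\<eta>..1-\<eta>}"
      then obtain s where s: "s \<in> {0..1}" "x = k s" "s \<notin> {\<eta>..1-\<eta>}"
        using k(2) unfolding path_image_def by blast
      then have "dist 0 s < d \<or> dist 1 s < d" using \<eta> by (auto simp: dist_real_def)
      then show "x \<in> ball w e" using d(2)[of 0 s] d(2)[of 1 s] s k(3,4) by auto
    qed
  qed
qed

text \<open>Janiszewski's theorem for the curve \<open>J\<close> and the union of \<open>K\<close> with the circle of radius \<open>e\<close>, which meet in
  the connected set \<open>K\<close>.\<close>

lemma connected_component_Jordan_inside_ball:
  fixes c :: "real \<Rightarrow> complex" and w :: complex
  defines "J \<equiv> path_image c"
  assumes c: "simple_path c" "pathfinish c = pathstart c"
    and K: "compact K" "connected K" "K \<subseteq> J" "J - K \<subseteq> ball w e"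
    and d: "ball w d \<inter> K = {}" "d \<le> e" and z: "z \<in> inside J \<inter> ball w d" "z' \<in> inside J \<inter> ball w d"
  shows "connected_component (inside J \<inter> ball w e) z z'"
proof -
  note inside_outside = Jordan_inside_outside[OF c, folded J_def]
  define Y where "Y = sphere w e \<union> K"
  have "connected_component (- (J \<union> Y)) z z'"
  proof (rule Janiszewski)
    show "compact J" unfolding J_def using c(1) by (simp add: compact_path_image simple_path_imp_path)
    show "closed Y" unfolding Y_def by (intro closed_Un closed_sphere compact_imp_closed K)
    have "J \<inter> Y = K" using K(3,4) by (auto simp: Y_def)
    then show "connected (J \<inter> Y)" using K(2) by simp
    have "inside J \<subseteq> - J" by (auto simp: inside_def)
    then show "connected_component (- J) z z'" unfolding connected_component_def
      using inside_outside z by (intro exI[of _ "inside J"]) simp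
    have "ball w d \<subseteq> - Y" using d by (auto simp: Y_def)
    then show "connected_component (- Y) z z'" unfolding connected_component_def
      using z by (intro exI[of _ "ball w d"]) auto
  qed
  then obtain C where C: "connected C" "C \<subseteq> - (J \<union> Y)" "z \<in> C" "z' \<in> C"
    by (auto simp: connected_component_def)
  have "C \<subseteq> inside J"
    by (rule connected_subset_left[OF C(1), of _ "outside J"]) (use C inside_outside z in auto)
  moreover have "C \<subseteq> ball w e"
    by (rule connected_subset_left[OF C(1), of _ "- cball w e"]) (use C z d in \<open>auto simp: Y_def\<close>)
  ultimately show ?thesis unfolding connected_component_def using C by auto
qed

lemma Jordan_inside_locally_connected:
  fixes c :: "real \<Rightarrow> complex"
  assumes c: "simple_path c" "pathfinish c = pathstart c" and w: "w \<in> path_image c" and e: "0 < e"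
  obtains d where "0 < d"
    "\<And>z z'. z \<in> inside (path_image c) \<inter> ball w d \<Longrightarrow> z' \<in> inside (path_image c) \<inter> ball w d
       \<Longrightarrow> connected_component (inside (path_image c) \<inter> ball w e) z z'"
proof -
  obtain K where K: "compact K" "connected K" "K \<subseteq> path_image c" "path_image c - K \<subseteq> ball w e" "w \<notin> K"
    using closed_path_split_at_point[OF c w e] by metis
  have "open (- K)" using K(1) by (simp add: compact_imp_closed open_Compl)
  then obtain d where d: "0 < d" "ball w d \<subseteq> - K" using K(5) by (meson ComplI openE)
  then have "0 < min d e" "ball w (min d e) \<inter> K = {}" "min d e \<le> e" using e by auto
  then show thesis using that connected_component_Jordan_inside_ball[OF c K(1-4)] by meson
qed

lemma continuous_crossing_interval:
  fixes u :: "real \<Rightarrow> real"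
  assumes u: "continuous_on {0..1} u" and c: "0 < c" and ends: "u 0 < - c" "c < u 1"
  obtains s t where "0 \<le> s" "s \<le> t" "t \<le> 1" "u s = - c" "u t = c" "\<And>x. s \<le> x \<Longrightarrow> x \<le> t \<Longrightarrow> \<bar>u x\<bar> \<le> c"
proof -
  have cont_u: "continuous_on {a..b} u" if "0 \<le> a" "b \<le> 1" for a b
    using u by (rule continuous_on_subset) (use that in auto)
  have compact_level: "compact {x \<in> {0..b}. u x = y}" if "b \<le> 1" for b y
    using continuous_closed_preimage_constant[OF cont_u[of 0 b], of y] that
    by (auto simp: compact_eq_bounded_closed intro: bounded_subset[of "{0..1::real}"])
  have "{x \<in> {0..1}. u x = c} \<noteq> {}" using IVT'[of u 0 c 1] ends c u by auto
  then obtain t where t: "0 \<le> t" "t \<le> 1" "u t = c" and t_first: "\<And>x. 0 \<le> x \<Longrightarrow> x \<le> 1 \<Longrightarrow> u x = c \<Longrightarrow> t \<le> x"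
    using compact_attains_inf[OF compact_level[of 1 c]] by auto
  have "{x \<in> {0..t}. u x = - c} \<noteq> {}" using IVT'[of u 0 "- c" t] ends c cont_u[of 0 t] t by auto
  then obtain s where s: "0 \<le> s" "s \<le> t" "u s = - c" and s_last: "\<And>x. 0 \<le> x \<Longrightarrow> x \<le> t \<Longrightarrow> u x = - c \<Longrightarrow> x \<le> s"
    using compact_attains_sup[OF compact_level[of t "- c"]] t by auto
  have upper: "u x \<le> c" if x: "s \<le> x" "x \<le> t" for x
  proof (rule ccontr)
    assume above: "\<not> u x \<le> c"
    then have "\<exists>y\<ge>0. y \<le> x \<and> u y = c" using ends c x s t by (intro IVT' cont_u) auto
    then obtain y where "0 \<le> y" "y \<le> x" "u y = c" by auto
    then have "x = t" using t_first[of y] x t by auto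
    then show False using above t by auto
  qed
  have lower: "- c \<le> u x" if x: "s \<le> x" "x \<le> t" for x
  proof (rule ccontr)
    assume below: "\<not> - c \<le> u x"
    then have "\<exists>y\<ge>x. y \<le> t \<and> u y = - c" using c x s t by (intro IVT' cont_u) auto
    then obtain y where "x \<le> y" "y \<le> t" "u y = - c" by auto
    then have "x = s" using s_last[of y] x s by auto
    then show False using below s by auto
  qed
  show thesis using that[of s t] s t upper lower by (force simp: abs_le_iff)
qed

lemma crossing_subpath:
  fixes \<sigma> :: "real \<Rightarrow> complex"
  assumes \<sigma>: "path \<sigma>" and c: "0 < c" and ends: "Im (pathstart \<sigma>) < - c" "c < Im (pathfinish \<sigma>)"
  obtains \<gamma> where "path \<gamma>" "path_image \<gamma> \<subseteq> path_image \<sigma>" "Im (pathstart \<gamma>) = - c" "Im (pathfinish \<gamma>) = c"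
    "\<And>z. z \<in> path_image \<gamma> \<Longrightarrow> \<bar>Im z\<bar> \<le> c"
proof -
  have "continuous_on {0..1} (\<lambda>t. Im (\<sigma> t))" using \<sigma> by (auto simp: path_def intro!: continuous_intros)
  moreover have "Im (\<sigma> 0) < - c" "c < Im (\<sigma> 1)" using ends by (simp_all add: pathstart_def pathfinish_def)
  ultimately obtain s t where st: "0 \<le> s" "s \<le> t" "t \<le> 1" "Im (\<sigma> s) = - c" "Im (\<sigma> t) = c"
    "\<And>x. s \<le> x \<Longrightarrow> x \<le> t \<Longrightarrow> \<bar>Im (\<sigma> x)\<bar> \<le> c"
    using continuous_crossing_interval[OF _ c] by blast
  show thesis
  proof (rule that)
    show "path (subpath s t \<sigma>)" using \<sigma> st by (intro path_subpath) auto
    show "path_image (subpath s t \<sigma>) \<subseteq> path_image \<sigma>" using st by (intro path_image_subpath_subset) auto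
    show "Im (pathstart (subpath s t \<sigma>)) = - c" "Im (pathfinish (subpath s t \<sigma>)) = c" using st by auto
    show "\<bar>Im z\<bar> \<le> c" if "z \<in> path_image (subpath s t \<sigma>)" for z
      using that st by (auto simp: path_image_subpath)
  qed
qed

lemma connected_sign:
  fixes u :: "'a::topological_space \<Rightarrow> real"
  assumes "connected C" "continuous_on C u" "\<And>z. z \<in> C \<Longrightarrow> u z \<noteq> 0"
  shows "(\<forall>z\<in>C. 0 < u z) \<or> (\<forall>z\<in>C. u z < 0)"
proof (rule ccontr)
  assume "\<not> ?thesis"
  then obtain a b where "a \<in> C" "u a < 0" "b \<in> C" "0 < u b" using assms(3) by (meson linorder_neqE_linordered_idom)
  moreover have "connected (u ` C)" using assms by (intro connected_continuous_image)
  ultimately have "0 \<in> u ` C" by (meson connectedD_interval imageI less_imp_le)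
  then show False using assms(3) by auto
qed

lemma unit_complex_vertical_chord:
  fixes \<zeta> \<zeta>' :: complex
  assumes "norm \<zeta> = 1" "norm \<zeta>' = 1" "\<zeta> \<noteq> \<zeta>'"
  obtains \<rho> where "norm \<rho> = 1" "Im (\<rho> * \<zeta>) = - (norm (\<zeta>' - \<zeta>) / 2)" "Im (\<rho> * \<zeta>') = norm (\<zeta>' - \<zeta>) / 2"
proof -
  define d where "d = norm (\<zeta>' - \<zeta>)"
  have d: "0 < d" using assms by (simp add: d_def)
  define \<rho> where "\<rho> = \<i> * cnj (\<zeta>' - \<zeta>) / d"
  have \<rho>: "norm \<rho> = 1" using d by (simp add: \<rho>_def norm_mult norm_divide d_def del: complex_cnj_diff)
  have "cnj (\<zeta>' - \<zeta>) * (\<zeta>' - \<zeta>) = of_real (d\<^sup>2)"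
    unfolding d_def by (metis complex_norm_square mult.commute of_real_power)
  then have "\<rho> * (\<zeta>' - \<zeta>) = \<i> * of_real (d\<^sup>2) / d"
    unfolding \<rho>_def by (simp only: times_divide_eq_left mult.assoc)
  also have "\<dots> = \<i> * d" using d by (simp add: power2_eq_square)
  finally have chord: "Re (\<rho> * \<zeta>') = Re (\<rho> * \<zeta>)" "Im (\<rho> * \<zeta>') = Im (\<rho> * \<zeta>) + d"
    by (auto simp: algebra_simps complex_eq_iff)
  have "(Re (\<rho> * \<zeta>))\<^sup>2 + (Im (\<rho> * \<zeta>))\<^sup>2 = 1" "(Re (\<rho> * \<zeta>'))\<^sup>2 + (Im (\<rho> * \<zeta>'))\<^sup>2 = 1"
    using assms \<rho> by (simp_all add: norm_mult del: times_complex.simps flip: cmod_power2)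
  then have "(Im (\<rho> * \<zeta>))\<^sup>2 = (Im (\<rho> * \<zeta>) + d)\<^sup>2" using chord by simp
  then have "d * (2 * Im (\<rho> * \<zeta>) + d) = 0" by (simp add: power2_eq_square algebra_simps)
  then show thesis using that[OF \<rho>] d chord by (auto simp flip: d_def)
qed

lemma convergent_Times_subsequence:
  fixes x :: "nat \<Rightarrow> 'a::metric_space" and y y' :: "nat \<Rightarrow> 'b::metric_space"
  assumes "compact X" "compact Y" "\<And>n. x n \<in> X" "\<And>n. y n \<in> Y" "\<And>n. y' n \<in> Y"
  obtains r a b b' where "strict_mono (r :: nat \<Rightarrow> nat)" "a \<in> X"
    "(x \<circ> r) \<longlonglongrightarrow> a" "(y \<circ> r) \<longlonglongrightarrow> b" "(y' \<circ> r) \<longlonglongrightarrow> b'"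
proof -
  have "compact (X \<times> (Y \<times> Y))" using assms by (intro compact_Times)
  moreover have "\<forall>n. (x n, y n, y' n) \<in> X \<times> (Y \<times> Y)" using assms by simp
  ultimately obtain l r where r: "strict_mono r" "l \<in> X \<times> (Y \<times> Y)" "((\<lambda>n. (x n, y n, y' n)) \<circ> r) \<longlonglongrightarrow> l"
    unfolding compact_def by meson
  obtain a b b' where l: "l = (a, b, b')" by (metis prod.exhaust)
  show thesis
    using that[of r a b b'] r tendsto_fst[OF r(3)] tendsto_fst[OF tendsto_snd[OF r(3)]]
      tendsto_snd[OF tendsto_snd[OF r(3)]] by (auto simp: l o_def)
qed

lemma uniformly_continuous_on_if_unique_limits:
  fixes f :: "'a::real_normed_vector \<Rightarrow> 'b::metric_space"
  assumes X: "compact (closure X)" and Y: "compact Y" "f ` X \<subseteq> Y"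
    and unique: "\<And>x x' w \<zeta> \<zeta>'. \<lbrakk>\<And>n::nat. x n \<in> X; \<And>n. x' n \<in> X; w \<in> closure X; x \<longlonglongrightarrow> w; x' \<longlonglongrightarrow> w;
      (\<lambda>n. f (x n)) \<longlonglongrightarrow> \<zeta>; (\<lambda>n. f (x' n)) \<longlonglongrightarrow> \<zeta>'\<rbrakk> \<Longrightarrow> \<zeta> = \<zeta>'"
  shows "uniformly_continuous_on X f"
proof (rule ccontr)
  assume "\<not> uniformly_continuous_on X f"
  then obtain e where e: "0 < e" "\<forall>d>0. \<exists>x\<in>X. \<exists>x'\<in>X. dist x' x < d \<and> \<not> dist (f x') (f x) < e"
    unfolding uniformly_continuous_on_def by blast
  have "\<forall>n. \<exists>x x'. x \<in> X \<and> x' \<in> X \<and> dist x' x < inverse (real (Suc n)) \<and> \<not> dist (f x') (f x) < e"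
  proof
    show "\<exists>x x'. x \<in> X \<and> x' \<in> X \<and> dist x' x < inverse (real (Suc n)) \<and> \<not> dist (f x') (f x) < e" for n
      using e(2)[rule_format, of "inverse (real (Suc n))"] by auto
  qed
  then obtain x x' where x: "\<And>n. x n \<in> X" "\<And>n. x' n \<in> X" "\<And>n::nat. dist (x' n) (x n) < inverse (real (Suc n))"
    "\<And>n. \<not> dist (f (x' n)) (f (x n)) < e" by metis
  have mem: "x n \<in> closure X" "f (x n) \<in> Y" "f (x' n) \<in> Y" for n
    using x(1,2) Y(2) closure_subset by blast+
  obtain r w \<zeta> \<zeta>' where r: "strict_mono (r :: nat \<Rightarrow> nat)" "w \<in> closure X" "(x \<circ> r) \<longlonglongrightarrow> w"
    "((\<lambda>n. f (x n)) \<circ> r) \<longlonglongrightarrow> \<zeta>" "((\<lambda>n. f (x' n)) \<circ> r) \<longlonglongrightarrow> \<zeta>'"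
    by (rule convergent_Times_subsequence[OF X Y(1) mem])
  have "(\<lambda>n. dist (x' n) (x n)) \<longlonglongrightarrow> 0"
    by (rule Lim_null_comparison[OF _ LIMSEQ_inverse_real_of_nat])
      (use x(3) in \<open>auto intro!: always_eventually less_imp_le\<close>)
  from LIMSEQ_subseq_LIMSEQ[OF this r(1)] have "(\<lambda>n. x' (r n) - x (r n)) \<longlonglongrightarrow> 0"
    by (simp add: o_def dist_norm tendsto_norm_zero_iff)
  from tendsto_add[OF this r(3)[unfolded o_def]] have "(x' \<circ> r) \<longlonglongrightarrow> w" by (simp add: o_def)
  then have "\<zeta> = \<zeta>'" using unique[of "x \<circ> r" "x' \<circ> r" w \<zeta> \<zeta>'] x r by (simp add: o_def)
  moreover have "e \<le> dist \<zeta>' \<zeta>"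
    by (rule LIMSEQ_le_const[OF tendsto_dist[OF r(5,4)]]) (use x(4) in \<open>auto simp: not_less\<close>)
  ultimately show False using e(1) by simp
qed

lemma arcs_meet_at_ends:
  assumes "arc u" "pathstart u = w" "pathfinish u = w'" and "arc d" "pathstart d = w'" "pathfinish d = w"
    and meet: "path_image u \<inter> path_image d = {w, w'}" and xy: "u x = d y" "x \<in> {0..1}" "y \<in> {0..1}"
  shows "x = 0 \<and> y = 1 \<or> x = 1 \<and> y = 0"
proof -
  have "u x \<in> {w, w'}" using xy meet unfolding path_image_def by blast
  moreover have "inj_on u {0..1}" "inj_on d {0..1}" "u 0 = w" "u 1 = w'" "d 0 = w'" "d 1 = w"
    using assms by (auto simp: arc_def pathstart_def pathfinish_def)
  ultimately show ?thesis
    using xy inj_onD[of u "{0..1}" x 0] inj_onD[of u "{0..1}" x 1]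
      inj_onD[of d "{0..1}" y 0] inj_onD[of d "{0..1}" y 1]
    by auto
qed

lemma cut_double_arc_disjoint:
  fixes u d :: "real \<Rightarrow> 'a::t2_space"
  assumes u: "arc u" "pathstart u = w" "pathfinish u = w'" and d: "arc d" "pathstart d = w'" "pathfinish d = w"
    and meet: "path_image u \<inter> path_image d = {w, w'}" and s: "0 < s" "s < 1" and t: "0 < t" "t < 1"
  shows "(u ` {0..s} \<union> d ` {t..1}) \<inter> (u ` {s..1} \<union> d ` {0..t}) \<subseteq> {u s, d t}"
proof
  fix x assume "x \<in> (u ` {0..s} \<union> d ` {t..1}) \<inter> (u ` {s..1} \<union> d ` {0..t})"
  then consider a b where "x = u a" "x = u b" "a \<in> {0..s}" "b \<in> {s..1}"
    | a b where "x = u a" "x = d b" "a \<in> {0..s} \<and> b \<in> {0..t} \<or> a \<in> {s..1} \<and> b \<in> {t..1}"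
    | a b where "x = d a" "x = d b" "a \<in> {t..1}" "b \<in> {0..t}" by blast
  then show "x \<in> {u s, d t}"
  proof cases
    case (1 a b)
    then have "a = b" using inj_onD[of u "{0..1}" a b] u(1) s by (auto simp: arc_def)
    then have "a = s" using 1 by simp
    then show ?thesis using 1 by simp
  next
    case (2 a b)
    then have "a \<in> {0..1}" "b \<in> {0..1}" using s t by auto
    then have "a = 0 \<and> b = 1 \<or> a = 1 \<and> b = 0" using arcs_meet_at_ends[OF u d meet] 2(1,2) by simp
    then show ?thesis using 2(3) s t by auto
  next
    case (3 a b)
    then have "a = b" using inj_onD[of d "{0..1}" a b] d(1) t by (auto simp: arc_def)
    then have "a = t" using 3 by simp
    then show ?thesis using 3 by simp
  qed
qed

lemma connected_double_arc:
  fixes u d :: "real \<Rightarrow> 'a::t2_space"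
  assumes u: "arc u" "pathstart u = w" "pathfinish u = w'" and d: "arc d" "pathstart d = w'" "pathfinish d = w"
    and meet: "path_image u \<inter> path_image d = {w, w'}"
    and Z: "connected Z" "Z \<subseteq> path_image u \<union> path_image d" "w \<in> Z" "w' \<in> Z"
  shows "path_image u \<subseteq> Z \<or> path_image d \<subseteq> Z"
proof (rule ccontr)
  assume "\<not> ?thesis"
  then obtain s t where s: "s \<in> {0..1}" "u s \<notin> Z" and t: "t \<in> {0..1}" "d t \<notin> Z"
    unfolding path_image_def by blast
  have ends: "u 0 = w" "u 1 = w'" "d 0 = w'" "d 1 = w" using u d by (auto simp: pathstart_def pathfinish_def)
  have u_inner: "0 < s" "s < 1" and d_inner: "0 < t" "t < 1"
    using s t Z(3,4) ends by (metis atLeastAtMost_iff less_eq_real_def)+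
  have image_closed: "closed (u ` {a..b})" "closed (d ` {a..b})" if "0 \<le> a" "b \<le> 1" for a b
  proof -
    have "continuous_on {a..b} u" "continuous_on {a..b} d"
      using u(1) d(1) that by (auto simp: arc_def path_def elim!: continuous_on_subset)
    then show "closed (u ` {a..b})" "closed (d ` {a..b})"
      by (auto intro!: compact_imp_closed compact_continuous_image)
  qed
  define E E' where "E = u ` {0..s} \<union> d ` {t..1}" and "E' = u ` {s..1} \<union> d ` {0..t}"
  have "closed E" "closed E'" unfolding E_def E'_def using u_inner d_inner by (auto intro!: image_closed)
  moreover have "Z \<subseteq> E \<union> E'"
  proof -
    have "{0..1} = {0..s} \<union> {s..1}" "{0..1} = {t..1} \<union> {0..t}" using u_inner d_inner by auto
    then have "path_image u = u ` {0..s} \<union> u ` {s..1}" "path_image d = d ` {t..1} \<union> d ` {0..t}"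
      unfolding path_image_def by (metis image_Un)+
    then show ?thesis using Z(2) unfolding E_def E'_def by auto
  qed
  moreover have "E \<inter> E' \<subseteq> {u s, d t}"
    unfolding E_def E'_def by (rule cut_double_arc_disjoint[OF u d meet u_inner d_inner])
  then have "E \<inter> E' \<inter> Z = {}" using s(2) t(2) by auto
  moreover have "w \<in> E" "w' \<in> E'" using ends u_inner unfolding E_def E'_def by force+
  ultimately show False using Z connected_closedD[of Z E E'] by blast
qed

locale Jordan_domain_map =
  fixes c :: "real \<Rightarrow> complex" and \<Omega> J :: "complex set" and f \<phi> :: "complex \<Rightarrow> complex"
  assumes c: "simple_path c" "pathfinish c = pathstart c"
    and J: "J = path_image c" and \<Omega>: "\<Omega> = inside J"
    and hol_f: "f holomorphic_on \<Omega>" and hol_\<phi>: "\<phi> holomorphic_on ball 0 1"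
    and f_\<phi>: "\<And>z. z \<in> \<Omega> \<Longrightarrow> f z \<in> ball 0 1 \<and> \<phi> (f z) = z"
    and \<phi>_f: "\<And>z. z \<in> ball 0 1 \<Longrightarrow> \<phi> z \<in> \<Omega> \<and> f (\<phi> z) = z"
begin

lemma open_\<Omega>: "open \<Omega>" and bounded_\<Omega>: "bounded \<Omega>"
  and closure_\<Omega>: "closure \<Omega> = \<Omega> \<union> J" and \<Omega>_Int_J: "\<Omega> \<inter> J = {}"
  using Jordan_inside_outside[OF c] closure_Un_frontier[of \<Omega>] inside_no_overlap[of J] by (auto simp: J \<Omega>)

lemma compact_closure_\<Omega>: "compact (closure \<Omega>)"
  using bounded_\<Omega> by (simp add: compact_closure)

lemma cont_f: "continuous_on \<Omega> f" and cont_\<phi>: "continuous_on (ball 0 1) \<phi>"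
  using hol_f hol_\<phi> holomorphic_on_imp_continuous_on by auto

lemma norm_f_near_boundary:
  assumes w: "w \<in> J" and \<epsilon>: "0 < \<epsilon>"
  obtains \<delta> where "0 < \<delta>" "\<And>x. x \<in> \<Omega> \<Longrightarrow> dist x w < \<delta> \<Longrightarrow> 1 - \<epsilon> < norm (f x)"
proof -
  have "cball 0 (1 - \<epsilon>) \<subseteq> ball (0 :: complex) 1" using \<epsilon> by auto
  then have "compact (\<phi> ` cball 0 (1 - \<epsilon>))" and "\<phi> ` cball 0 (1 - \<epsilon>) \<subseteq> \<Omega>"
    using \<phi>_f by (auto intro!: compact_continuous_image intro: continuous_on_subset[OF cont_\<phi>])
  moreover from this have "w \<in> - \<phi> ` cball 0 (1 - \<epsilon>)" using w \<Omega>_Int_J by blast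
  ultimately obtain \<delta> where \<delta>: "0 < \<delta>" "ball w \<delta> \<subseteq> - \<phi> ` cball 0 (1 - \<epsilon>)"
    by (meson compact_imp_closed openE open_Compl)
  show thesis
  proof (rule that[OF \<delta>(1)])
    fix x assume x: "x \<in> \<Omega>" "dist x w < \<delta>"
    show "1 - \<epsilon> < norm (f x)"
    proof (rule ccontr)
      assume "\<not> 1 - \<epsilon> < norm (f x)"
      then have "x \<in> \<phi> ` cball 0 (1 - \<epsilon>)" using f_\<phi>[OF x(1)] by (intro image_eqI[of _ _ "f x"]) auto
      then show False using \<delta>(2) x(2) by (auto simp: dist_commute)
    qed
  qed
qed

lemma norm_boundary_limit:
  assumes z: "\<And>n::nat. z n \<in> \<Omega>" and w: "z \<longlonglongrightarrow> w" "w \<in> J" and lim: "(\<lambda>n. f (z n)) \<longlonglongrightarrow> \<zeta>"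
  shows "norm \<zeta> = 1"
proof (rule antisym)
  show "norm \<zeta> \<le> 1"
    by (rule LIMSEQ_le_const2[OF tendsto_norm[OF lim]]) (use f_\<phi> z in \<open>auto intro: less_imp_le\<close>)
  show "1 \<le> norm \<zeta>"
  proof (rule field_le_epsilon)
    fix \<epsilon> :: real assume "0 < \<epsilon>"
    then obtain \<delta> where \<delta>: "0 < \<delta>" "\<And>x. x \<in> \<Omega> \<Longrightarrow> dist x w < \<delta> \<Longrightarrow> 1 - \<epsilon> < norm (f x)"
      using norm_f_near_boundary[OF w(2)] by blast
    have "\<forall>\<^sub>F n in sequentially. 1 - \<epsilon> \<le> norm (f (z n))"
      using tendstoD[OF w(1) \<delta>(1)] by (rule eventually_mono) (use \<delta>(2) z in \<open>auto intro: less_imp_le\<close>)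
    then have "1 - \<epsilon> \<le> norm \<zeta>" by (intro tendsto_lowerbound[OF tendsto_norm[OF lim]]) auto
    then show "1 \<le> norm \<zeta> + \<epsilon>" by simp
  qed
qed

lemma eventually_path_near_boundary_point:
  assumes z: "\<And>n::nat. z n \<in> \<Omega>" "\<And>n. z' n \<in> \<Omega>" and w: "z \<longlonglongrightarrow> w" "z' \<longlonglongrightarrow> w" "w \<in> J" and \<delta>: "0 < \<delta>"
  shows "\<forall>\<^sub>F n in sequentially. path_component (\<Omega> \<inter> ball w \<delta>) (z n) (z' n)"
proof -
  obtain \<eta> where \<eta>: "0 < \<eta>" "\<And>x y. x \<in> \<Omega> \<inter> ball w \<eta> \<Longrightarrow> y \<in> \<Omega> \<inter> ball w \<eta> \<Longrightarrow>
      connected_component (\<Omega> \<inter> ball w \<delta>) x y"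
    using Jordan_inside_locally_connected[OF c _ \<delta>] w(3) unfolding \<Omega> J by metis
  have "\<forall>\<^sub>F n in sequentially. dist (z n) w < \<eta> \<and> dist (z' n) w < \<eta>"
    using tendstoD[OF w(1) \<eta>(1)] tendstoD[OF w(2) \<eta>(1)] by (rule eventually_conj)
  then show ?thesis
  proof (rule eventually_mono)
    fix n assume "dist (z n) w < \<eta> \<and> dist (z' n) w < \<eta>"
    then have "connected_component (\<Omega> \<inter> ball w \<delta>) (z n) (z' n)" using \<eta>(2) z by (auto simp: dist_commute)
    then show "path_component (\<Omega> \<inter> ball w \<delta>) (z n) (z' n)"
      using open_path_connected_component[OF open_Int[OF open_\<Omega> open_ball]] by simp
  qed
qed

lemma crosscut_near_boundary:
  assumes z: "\<And>n::nat. z n \<in> \<Omega>" "\<And>n. z' n \<in> \<Omega>" and w: "z \<longlonglongrightarrow> w" "z' \<longlonglongrightarrow> w" "w \<in> J"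
    and lim: "(\<lambda>n. f (z n)) \<longlonglongrightarrow> \<zeta>" "(\<lambda>n. f (z' n)) \<longlonglongrightarrow> \<zeta>'"
    and \<rho>: "norm \<rho> = 1" and k: "0 < k" "Im (\<rho> * \<zeta>) < - k" "k < Im (\<rho> * \<zeta>')" and \<epsilon>: "0 < \<epsilon>"
  obtains \<gamma> where "path \<gamma>" "Im (pathstart \<gamma>) = - k" "Im (pathfinish \<gamma>) = k"
    "\<And>y. y \<in> path_image \<gamma> \<Longrightarrow> \<bar>Im y\<bar> \<le> k \<and> 1 - \<epsilon> < norm y \<and> norm y < 1 \<and> norm (\<phi> (y / \<rho>) - w) \<le> \<epsilon>"
proof -
  obtain \<delta>0 where \<delta>0: "0 < \<delta>0" "\<And>x. x \<in> \<Omega> \<Longrightarrow> dist x w < \<delta>0 \<Longrightarrow> 1 - \<epsilon> < norm (f x)"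
    using norm_f_near_boundary[OF w(3) \<epsilon>] by blast
  define \<delta> where "\<delta> = min \<delta>0 \<epsilon>"
  have "0 < \<delta>" using \<delta>0 \<epsilon> by (simp add: \<delta>_def)
  have "(\<lambda>n. Im (\<rho> * f (z n))) \<longlonglongrightarrow> Im (\<rho> * \<zeta>)" "(\<lambda>n. Im (\<rho> * f (z' n))) \<longlonglongrightarrow> Im (\<rho> * \<zeta>')"
    by (intro tendsto_Im tendsto_mult tendsto_const lim)+
  then have "\<forall>\<^sub>F n in sequentially. Im (\<rho> * f (z n)) < - k" "\<forall>\<^sub>F n in sequentially. k < Im (\<rho> * f (z' n))"
    using k by (auto intro: order_tendstoD)
  with eventually_path_near_boundary_point[OF z w \<open>0 < \<delta>\<close>]
  have "\<forall>\<^sub>F n in sequentially. path_component (\<Omega> \<inter> ball w \<delta>) (z n) (z' n) \<and>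
      Im (\<rho> * f (z n)) < - k \<and> k < Im (\<rho> * f (z' n))" by (intro eventually_conj)
  then obtain n where n: "path_component (\<Omega> \<inter> ball w \<delta>) (z n) (z' n)" "Im (\<rho> * f (z n)) < - k" "k < Im (\<rho> * f (z' n))"
    using eventually_happens'[OF sequentially_bot] by blast
  then obtain p where p: "path p" "path_image p \<subseteq> \<Omega> \<inter> ball w \<delta>" "pathstart p = z n" "pathfinish p = z' n"
    by (auto simp: path_component_def)
  define \<sigma> where "\<sigma> = (\<lambda>x. \<rho> * f x) \<circ> p"
  have "path \<sigma>" unfolding \<sigma>_def
    using p by (intro path_continuous_image continuous_intros continuous_on_subset[OF cont_f]) auto
  moreover have "Im (pathstart \<sigma>) < - k" "k < Im (pathfinish \<sigma>)"
    using n p by (auto simp: \<sigma>_def pathstart_def pathfinish_def)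
  ultimately obtain \<gamma> where \<gamma>: "path \<gamma>" "path_image \<gamma> \<subseteq> path_image \<sigma>" "Im (pathstart \<gamma>) = - k" "Im (pathfinish \<gamma>) = k"
    "\<And>z. z \<in> path_image \<gamma> \<Longrightarrow> \<bar>Im z\<bar> \<le> k" by (rule crossing_subpath[OF _ k(1)]) blast
  have "1 - \<epsilon> < norm y \<and> norm y < 1 \<and> norm (\<phi> (y / \<rho>) - w) \<le> \<epsilon>" if "y \<in> path_image \<gamma>" for y
  proof -
    have "y \<in> (\<lambda>x. \<rho> * f x) ` path_image p" using that \<gamma>(2) by (auto simp: \<sigma>_def path_image_compose)
    then obtain x where "x \<in> path_image p" and y: "y = \<rho> * f x" by blast
    then have x: "x \<in> \<Omega>" "dist x w < \<delta>" using p(2) by (auto simp: dist_commute)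
    have "norm y = norm (f x)" "y / \<rho> = f x" using \<rho> y by (auto simp: norm_mult)
    then show ?thesis using f_\<phi>[OF x(1)] \<delta>0(2)[OF x(1)] x(2) by (auto simp: \<delta>_def dist_norm)
  qed
  then show thesis using that[of \<gamma>] \<gamma> by blast
qed

text \<open>A crosscut that stays off the imaginary axis lies on one side of it; a half turn moves it to the right.\<close>

lemma small_crossing_near_boundary:
  assumes z: "\<And>n::nat. z n \<in> \<Omega>" "\<And>n. z' n \<in> \<Omega>" and w: "z \<longlonglongrightarrow> w" "z' \<longlonglongrightarrow> w" "w \<in> J"
    and lim: "(\<lambda>n. f (z n)) \<longlonglongrightarrow> \<zeta>" "(\<lambda>n. f (z' n)) \<longlonglongrightarrow> \<zeta>'"
    and \<rho>: "norm \<rho> = 1" and k: "0 < k" "Im (\<rho> * \<zeta>) < - k" "k < Im (\<rho> * \<zeta>')" and \<epsilon>: "0 < \<epsilon>" "\<epsilon> < 1 - k"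
  shows "\<exists>s\<in>{1, -1}. \<exists>\<gamma>. small_crossing (\<lambda>y. \<phi> (y / (s * \<rho>)) - w) k \<epsilon> \<gamma>"
proof -
  obtain \<gamma> where \<gamma>: "path \<gamma>" "Im (pathstart \<gamma>) = - k" "Im (pathfinish \<gamma>) = k"
    "\<And>y. y \<in> path_image \<gamma> \<Longrightarrow> \<bar>Im y\<bar> \<le> k \<and> 1 - \<epsilon> < norm y \<and> norm y < 1 \<and> norm (\<phi> (y / \<rho>) - w) \<le> \<epsilon>"
    using crosscut_near_boundary[OF z w lim \<rho> k \<epsilon>(1)] by metis
  have "Re y \<noteq> 0" if "y \<in> path_image \<gamma>" for y
  proof
    assume "Re y = 0"
    then have "norm y = \<bar>Im y\<bar>" by (simp add: cmod_def)
    then show False using \<gamma>(4)[OF that] \<epsilon> by auto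
  qed
  then have "(\<forall>y\<in>path_image \<gamma>. 0 < Re y) \<or> (\<forall>y\<in>path_image \<gamma>. Re y < 0)"
    using \<gamma>(1) by (intro connected_sign connected_path_image linear_continuous_on bounded_linear_Re)
  then show ?thesis
  proof
    assume "\<forall>y\<in>path_image \<gamma>. 0 < Re y"
    then have "small_crossing (\<lambda>y. \<phi> (y / (1 * \<rho>)) - w) k \<epsilon> \<gamma>" unfolding small_crossing_def using \<gamma> by fastforce
    then show ?thesis by blast
  next
    assume left: "\<forall>y\<in>path_image \<gamma>. Re y < 0"
    define \<gamma>' where "\<gamma>' = reversepath (uminus \<circ> \<gamma>)"
    have image: "path_image \<gamma>' = uminus ` path_image \<gamma>" by (simp add: \<gamma>'_def path_image_compose)
    have "path \<gamma>'" unfolding \<gamma>'_def using \<gamma>(1)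
      by (simp only: path_reversepath, intro path_continuous_image continuous_intros)
    moreover have "Im (pathstart \<gamma>') = - k" "Im (pathfinish \<gamma>') = k"
      using \<gamma> by (auto simp: \<gamma>'_def pathstart_def pathfinish_def reversepath_def)
    ultimately have "small_crossing (\<lambda>y. \<phi> (y / (- 1 * \<rho>)) - w) k \<epsilon> \<gamma>'"
      unfolding small_crossing_def image using \<gamma>(4) left by fastforce
    then show ?thesis by blast
  qed
qed

lemma rotated_\<phi>_avoids_boundary:
  assumes \<rho>: "norm \<rho> = 1" and w: "w \<in> J" and k: "0 < k" "k < 1"
    and cross: "\<And>\<epsilon>. 0 < \<epsilon> \<Longrightarrow> \<exists>\<gamma>. small_crossing (\<lambda>y. \<phi> (y / \<rho>) - w) k \<epsilon> \<gamma>"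
  shows False
proof -
  have rotate: "y / \<rho> \<in> ball 0 1" if "y \<in> ball 0 1" for y using that \<rho> by (simp add: norm_divide)
  obtain M where M: "\<And>x. x \<in> \<Omega> \<Longrightarrow> norm x \<le> M" using bounded_\<Omega> by (auto simp: bounded_iff)
  have "\<phi> (of_real (1 - k/4) / \<rho>) - w = 0"
  proof (rule holomorphic_zero_behind_crossings[of "\<lambda>y. \<phi> (y / \<rho>) - w" "M + norm w", OF _ _ k cross])
    have "(\<lambda>y. y / \<rho>) holomorphic_on ball 0 1" using \<rho> by (intro holomorphic_intros) auto
    then have "(\<lambda>y. \<phi> (y / \<rho>)) holomorphic_on ball 0 1"
      using holomorphic_on_compose_gen[OF _ hol_\<phi>, of "\<lambda>y. y / \<rho>" "ball 0 1"] rotate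
      by (simp add: o_def image_subset_iff)
    then show "(\<lambda>y. \<phi> (y / \<rho>) - w) holomorphic_on ball 0 1" by (intro holomorphic_intros)
    fix y :: complex assume "y \<in> ball 0 1"
    then have "norm (\<phi> (y / \<rho>)) \<le> M" using M \<phi>_f rotate by blast
    then show "norm (\<phi> (y / \<rho>) - w) \<le> M + norm w" using norm_triangle_ineq4[of "\<phi> (y / \<rho>)" w] by linarith
  qed
  moreover have "(of_real (1 - k/4) :: complex) \<in> ball 0 1" using k by (simp add: norm_of_real del: of_real_diff)
  ultimately show False using rotate \<phi>_f w \<Omega>_Int_J by (metis IntI empty_iff eq_iff_diff_eq_0)
qed

lemma boundary_limit_unique:
  assumes z: "\<And>n::nat. z n \<in> \<Omega>" "\<And>n. z' n \<in> \<Omega>" and w: "z \<longlonglongrightarrow> w" "z' \<longlonglongrightarrow> w" "w \<in> J"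
    and lim: "(\<lambda>n. f (z n)) \<longlonglongrightarrow> \<zeta>" "(\<lambda>n. f (z' n)) \<longlonglongrightarrow> \<zeta>'"
  shows "\<zeta> = \<zeta>'"
proof (rule ccontr)
  assume ne: "\<zeta> \<noteq> \<zeta>'"
  have unit: "norm \<zeta> = 1" "norm \<zeta>' = 1"
    using norm_boundary_limit z w lim by blast+
  define k where "k = norm (\<zeta>' - \<zeta>) / 4"
  have k: "0 < k" "k < 1" using ne unit norm_triangle_ineq4[of \<zeta>' \<zeta>] by (auto simp: k_def)
  obtain \<rho> where \<rho>: "norm \<rho> = 1" and chord: "Im (\<rho> * \<zeta>) = - (norm (\<zeta>' - \<zeta>) / 2)" "Im (\<rho> * \<zeta>') = norm (\<zeta>' - \<zeta>) / 2"
    by (rule unit_complex_vertical_chord[OF unit ne])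
  then have beyond: "Im (\<rho> * \<zeta>) < - k" "k < Im (\<rho> * \<zeta>')" using k(1) unfolding chord k_def by linarith+
  have "\<exists>s\<in>{1, -1}. \<forall>\<epsilon>>0. \<exists>\<gamma>. small_crossing (\<lambda>y. \<phi> (y / (s * \<rho>)) - w) k \<epsilon> \<gamma>"
  proof (rule ccontr)
    assume "\<not> ?thesis"
    then obtain e e' where e: "0 < e" "0 < e'" "\<nexists>\<gamma>. small_crossing (\<lambda>y. \<phi> (y / (1 * \<rho>)) - w) k e \<gamma>"
      "\<nexists>\<gamma>. small_crossing (\<lambda>y. \<phi> (y / (- 1 * \<rho>)) - w) k e' \<gamma>" by blast
    define \<epsilon> where "\<epsilon> = min (min e e') ((1 - k) / 2)"
    have "0 < \<epsilon>" "\<epsilon> < 1 - k" "\<epsilon> \<le> e" "\<epsilon> \<le> e'" using e k by (auto simp: \<epsilon>_def min_less_iff_disj)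
    then show False
      using small_crossing_near_boundary[OF z w lim \<rho> k(1) beyond] small_crossing_mono e(3,4) by blast
  qed
  then obtain s :: complex where s: "s \<in> {1, -1}"
    "\<And>\<epsilon>. 0 < \<epsilon> \<Longrightarrow> \<exists>\<gamma>. small_crossing (\<lambda>y. \<phi> (y / (s * \<rho>)) - w) k \<epsilon> \<gamma>" by blast
  then have "norm (s * \<rho>) = 1" using \<rho> by (auto simp: norm_mult)
  then show False by (rule rotated_\<phi>_avoids_boundary[OF _ w(3) k s(2)])
qed

lemma f_uniformly_continuous: "uniformly_continuous_on \<Omega> f"
proof (rule uniformly_continuous_on_if_unique_limits[OF compact_closure_\<Omega> compact_cball[of 0 1]])
  show "f ` \<Omega> \<subseteq> cball 0 1" using f_\<phi> by (auto simp: less_imp_le)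
  fix z z' w \<zeta> \<zeta>'
  assume z: "\<And>n::nat. z n \<in> \<Omega>" "\<And>n. z' n \<in> \<Omega>" and w: "w \<in> closure \<Omega>" "z \<longlonglongrightarrow> w" "z' \<longlonglongrightarrow> w"
    and lim: "(\<lambda>n. f (z n)) \<longlonglongrightarrow> \<zeta>" "(\<lambda>n. f (z' n)) \<longlonglongrightarrow> \<zeta>'"
  from w(1) have "w \<in> \<Omega> \<or> w \<in> J" by (simp add: closure_\<Omega>)
  then show "\<zeta> = \<zeta>'"
  proof
    assume "w \<in> \<Omega>"
    then have "(\<lambda>n. f (z n)) \<longlonglongrightarrow> f w" "(\<lambda>n. f (z' n)) \<longlonglongrightarrow> f w"
      using continuous_on_tendsto_compose[OF cont_f w(2)] continuous_on_tendsto_compose[OF cont_f w(3)] z by auto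
    then show ?thesis using lim LIMSEQ_unique by metis
  qed (rule boundary_limit_unique[OF z w(2,3) _ lim])
qed

context
  fixes F
  assumes F: "continuous_on (closure \<Omega>) F" and F_f: "\<And>z. z \<in> \<Omega> \<Longrightarrow> F z = f z"
begin

lemma norm_F_le: "z \<in> closure \<Omega> \<Longrightarrow> norm (F z) \<le> 1"
proof -
  have "F ` \<Omega> \<subseteq> cball 0 1" using f_\<phi> F_f by (auto simp: less_imp_le)
  from image_closure_subset[OF F closed_cball this] show "z \<in> closure \<Omega> \<Longrightarrow> norm (F z) \<le> 1" by auto
qed

lemma norm_F_boundary:
  assumes "w \<in> J" shows "norm (F w) = 1"
proof -
  have w: "w \<in> closure \<Omega>" using assms closure_\<Omega> by blast
  then obtain z where z: "\<And>n. z n \<in> \<Omega>" "z \<longlonglongrightarrow> w" by (auto simp: closure_sequential)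
  have "(\<lambda>n. F (z n)) \<longlonglongrightarrow> F w"
    using continuous_on_tendsto_compose[OF F z(2) w] z(1) closure_subset by (auto intro!: always_eventually)
  then show ?thesis using norm_boundary_limit[OF z assms] F_f z(1) by simp
qed

lemma norm_F_inside: "w \<in> \<Omega> \<Longrightarrow> norm (F w) < 1"
  using f_\<phi> F_f by simp

lemma approach_from_inside:
  assumes "x \<in> closure \<Omega>" "open V" "x \<in> V" "0 < \<tau>"
  obtains z where "z \<in> \<Omega>" "z \<in> V" "dist (F z) (F x) < \<tau>"
proof -
  obtain d where d: "0 < d" "\<And>z. z \<in> closure \<Omega> \<Longrightarrow> dist z x < d \<Longrightarrow> dist (F z) (F x) < \<tau>"
    using F assms(1,4) unfolding continuous_on_iff by metis
  obtain d' where d': "0 < d'" "ball x d' \<subseteq> V" using assms(2,3) by (meson openE)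
  obtain z where "z \<in> \<Omega>" "dist z x < min d d'"
    using assms(1) d(1) d'(1) closure_approachable[of x \<Omega>] by (metis min_less_iff_conj)
  then show thesis using that[of z] d(2)[of z] d' closure_subset by (force simp: dist_commute)
qed

text \<open>Otherwise two points of \<open>\<Omega>\<close> close to different parts of the fibre would be joined by the preimage of a short
  segment near \<open>\<zeta>\<close>.\<close>

lemma connected_boundary_fibre: "connected {x \<in> closure \<Omega>. F x = \<zeta>}"
proof (rule ccontr)
  define Z where "Z = {x \<in> closure \<Omega>. F x = \<zeta>}"
  assume "\<not> connected {x \<in> closure \<Omega>. F x = \<zeta>}"
  then obtain E E' where E: "closed E" "closed E'" "Z \<subseteq> E \<union> E'" "E \<inter> E' \<inter> Z = {}" "E \<inter> Z \<noteq> {}" "E' \<inter> Z \<noteq> {}"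
    unfolding connected_closed Z_def[symmetric] by blast
  have "closed Z" unfolding Z_def using continuous_closed_preimage_constant[OF F closed_closure] .
  then have "closed (E \<inter> Z)" "closed (E' \<inter> Z)" "(E \<inter> Z) \<inter> (E' \<inter> Z) = {}" using E by auto
  then obtain V V' where V: "open V" "open V'" "E \<inter> Z \<subseteq> V" "E' \<inter> Z \<subseteq> V'" "V \<inter> V' = {}"
    by (rule separation_normal)
  define L where "L = closure \<Omega> - (V \<union> V')"
  have "compact L" unfolding L_def using compact_closure_\<Omega> V by (intro compact_diff) auto
  then have "compact (F ` L)" by (intro compact_continuous_image continuous_on_subset[OF F]) (auto simp: L_def)
  moreover have "\<zeta> \<notin> F ` L" using E(3) V(3,4) by (auto simp: L_def Z_def)
  ultimately obtain \<tau> where \<tau>: "0 < \<tau>" "\<And>x. x \<in> L \<Longrightarrow> \<tau> \<le> dist \<zeta> (F x)"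
    using separate_point_closed[of "F ` L" \<zeta>] compact_imp_closed by blast
  obtain a a' where a: "a \<in> E \<inter> Z" "a' \<in> E' \<inter> Z" using E by blast
  obtain z where z: "z \<in> \<Omega>" "z \<in> V" "dist (F z) \<zeta> < \<tau>"
    using approach_from_inside[of a V \<tau>] a V \<tau>(1) by (auto simp: Z_def)
  obtain z' where z': "z' \<in> \<Omega>" "z' \<in> V'" "dist (F z') \<zeta> < \<tau>"
    using approach_from_inside[of a' V' \<tau>] a V \<tau>(1) by (auto simp: Z_def)
  define C where "C = \<phi> ` closed_segment (f z) (f z')"
  have segment: "closed_segment (f z) (f z') \<subseteq> ball 0 1 \<inter> ball \<zeta> \<tau>"
    using z z' f_\<phi> F_f by (intro closed_segment_subset convex_Int convex_ball) (auto simp: dist_commute)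
  have "connected C" unfolding C_def
    using segment by (intro connected_continuous_image continuous_on_subset[OF cont_\<phi>]) auto
  moreover have "z \<in> C" "z' \<in> C" unfolding C_def using f_\<phi> z(1) z'(1) by (metis ends_in_segment image_eqI)+
  moreover have "C \<subseteq> V \<union> V'"
  proof
    fix x assume "x \<in> C"
    then obtain y where "x = \<phi> y" "y \<in> ball 0 1 \<inter> ball \<zeta> \<tau>" using segment unfolding C_def by blast
    then have "x \<in> \<Omega>" "dist \<zeta> (F x) < \<tau>" using \<phi>_f F_f by auto
    then show "x \<in> V \<union> V'" using \<tau>(2)[of x] closure_subset by (auto simp: L_def)
  qed
  ultimately show False using connected_subset_left[of C V V'] V z(2) z'(2) by blast
qed

lemma two_constants_domain_near_constant:
  assumes r: "0 < r" and const: "\<And>z. z \<in> J \<Longrightarrow> dist w z \<le> r \<Longrightarrow> F z = \<zeta>" and \<zeta>: "norm \<zeta> = 1" and \<epsilon>: "0 \<le> \<epsilon>"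
    and w': "w' \<in> \<Omega>" "dist w' w < r/4" and p: "p \<notin> closure \<Omega>" "dist p w < r/4"
    and \<delta>: "\<And>z. z \<in> closure \<Omega> \<Longrightarrow> \<delta> \<le> norm (z - p)"
  shows "two_constants_domain (\<lambda>z. F z - \<zeta>) w' p 2 (3 * r/4) \<epsilon> \<delta> (\<Omega> \<inter> ball w r)"
proof -
  define U where "U = \<Omega> \<inter> ball w r"
  have "open U" using open_\<Omega> by (simp add: U_def open_Int)
  have U: "closure U \<subseteq> closure \<Omega>" "closure U \<subseteq> cball w r"
  proof -
    show "closure U \<subseteq> closure \<Omega>" by (rule closure_mono) (simp add: U_def)
    show "closure U \<subseteq> cball w r" by (rule closure_minimal) (auto simp: U_def)
  qed
  have "norm (F z - \<zeta>) \<le> 2 \<and> 3 * r/4 \<le> norm (z - p) \<or> norm (F z - \<zeta>) \<le> \<epsilon> \<and> \<delta> \<le> norm (z - p)"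
    if z: "z \<in> frontier U" for z
  proof (cases "z \<in> J")
    case True
    then have "F z = \<zeta>" using const z U(2) by (auto simp: frontier_def)
    then show ?thesis using \<delta> z U(1) \<epsilon> by (auto simp: frontier_def)
  next
    case False
    moreover have zU: "z \<in> closure U" "z \<notin> U" using z \<open>open U\<close> by (auto simp: frontier_def interior_open)
    ultimately have "z \<in> \<Omega>" "dist w z \<le> r" using U closure_\<Omega> by auto
    then have "dist w z = r" using zU(2) by (auto simp: U_def)
    then have "3 * r/4 \<le> norm (z - p)"
      using p(2) dist_triangle[of w z p] by (simp add: dist_norm norm_minus_commute)
    moreover have "norm (F z) \<le> 1" using norm_F_le z U(1) by (auto simp: frontier_def)
    ultimately show ?thesis using \<zeta> norm_triangle_ineq4[of "F z" \<zeta>] by simp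
  qed
  moreover have "F holomorphic_on U"
    by (rule holomorphic_transform[of f]) (use hol_f F_f in \<open>auto simp: U_def intro: holomorphic_on_subset\<close>)
  then have "(\<lambda>z. F z - \<zeta>) holomorphic_on U" by (intro holomorphic_intros)
  moreover have "continuous_on (closure U) (\<lambda>z. F z - \<zeta>)"
    by (intro continuous_intros continuous_on_subset[OF F U(1)])
  moreover have "w' \<in> U" "bounded U" "p \<notin> closure U"
    using w' r p(1) U(1) by (auto simp: U_def dist_commute bounded_Int)
  ultimately show ?thesis unfolding two_constants_domain_def U_def[symmetric] using \<open>open U\<close> by blast
qed

lemma F_not_locally_constant:
  assumes w: "w \<in> J" and r: "0 < r" and const: "\<And>z. z \<in> J \<Longrightarrow> dist w z \<le> r \<Longrightarrow> F z = \<zeta>"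
  shows False
proof -
  have \<zeta>: "norm \<zeta> = 1" using norm_F_boundary[OF w] const[OF w] r by simp
  have "w \<in> closure \<Omega>" using w closure_\<Omega> by blast
  then obtain w' where w': "w' \<in> \<Omega>" "dist w' w < r/4"
    using r by (metis closure_approachable divide_pos_pos zero_less_numeral)
  have "w \<in> closure (outside J)" using w Jordan_inside_outside[OF c] by (auto simp: J frontier_def)
  then obtain p where p: "p \<in> outside J" "dist p w < r/4"
    using r by (metis closure_approachable divide_pos_pos zero_less_numeral)
  have "p \<notin> J" "p \<notin> inside J" using p(1) by (auto simp: inside_def outside_def)
  then have p_off: "p \<notin> closure \<Omega>" using closure_\<Omega> \<Omega> by simp
  then obtain \<delta> where \<delta>: "0 < \<delta>" "\<And>z. z \<in> closure \<Omega> \<Longrightarrow> \<delta> \<le> norm (z - p)"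
    using separate_point_closed[OF closed_closure, of p \<Omega>] by (auto simp: dist_norm norm_minus_commute)
  have "f w' - \<zeta> = 0"
  proof (rule zero_if_two_constants[of \<delta> 2 w' p "r/2" "3 * r/4" "\<lambda>z. F z - \<zeta>", unfolded F_f[OF w'(1)]])
    show "norm (w' - p) \<le> r/2" using w' p dist_triangle_half_l[of w' w "r/2" p] by (auto simp: dist_norm)
    show "\<exists>U. two_constants_domain (\<lambda>z. F z - \<zeta>) w' p 2 (3 * r/4) \<epsilon> \<delta> U" if "0 < \<epsilon>" for \<epsilon>
      using two_constants_domain_near_constant[OF r const \<zeta> _ w' p_off p(2) \<delta>(2)] that by (meson less_imp_le)
  qed (use \<delta> r in auto)
  then show False using f_\<phi>[OF w'(1)] \<zeta> by auto
qed

lemma F_not_constant_on_arc: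
  assumes p: "arc p" and q: "arc q" and pq: "path_image p \<inter> path_image q = {pathstart p, pathfinish p}"
      "path_image p \<union> path_image q = J"
    and const: "\<And>x. x \<in> path_image p \<Longrightarrow> F x = \<zeta>"
  shows False
proof -
  have "p (1/2) \<noteq> p 0" "p (1/2) \<noteq> p 1"
    using p inj_onD[of p "{0..1}" "1/2" 0] inj_onD[of p "{0..1}" "1/2" 1] by (auto simp: arc_def)
  moreover have mid: "p (1/2) \<in> path_image p" by (auto simp: path_image_def)
  ultimately have "p (1/2) \<in> - path_image q" using pq(1) by (auto simp: pathstart_def pathfinish_def)
  moreover have "open (- path_image q)" using q by (simp add: closed_arc_image open_Compl)
  ultimately obtain r where r: "0 < r" "cball (p (1/2)) r \<subseteq> - path_image q"
    using open_contains_cball by metis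
  show False
    by (rule F_not_locally_constant[of "p (1/2)" r \<zeta>]) (use mid pq(2) r const in auto)
qed

lemma inj_on_F: "inj_on F (closure \<Omega>)"
proof (rule inj_onI)
  fix w w' assume w: "w \<in> closure \<Omega>" "w' \<in> closure \<Omega>" "F w = F w'"
  show "w = w'"
  proof (cases "w \<in> J \<and> w' \<in> J")
    case False
    then have "w \<in> \<Omega> \<and> w' \<in> \<Omega>" using w norm_F_boundary norm_F_inside closure_\<Omega> by fastforce
    then show ?thesis using w(3) f_\<phi> F_f by metis
  next
    case True
    show ?thesis
    proof (rule ccontr)
      assume "w \<noteq> w'"
      then obtain u d where ud: "arc u" "arc d"
          "pathstart u = w" "pathfinish u = w'" "pathstart d = w'" "pathfinish d = w"
          "path_image u \<inter> path_image d = {w, w'}" "path_image u \<union> path_image d = J"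
        using exists_double_arc[OF c, of w w'] True unfolding J by metis
      define Z where "Z = {x \<in> closure \<Omega>. F x = F w}"
      have "Z \<subseteq> J" using norm_F_inside norm_F_boundary True closure_\<Omega> by (force simp: Z_def)
      then have "path_image u \<subseteq> Z \<or> path_image d \<subseteq> Z"
        using connected_double_arc[OF ud(1,3,4,2,5,6,7), of Z] connected_boundary_fibre[of "F w"] ud(8) w
        unfolding Z_def by auto
      then show False
        using F_not_constant_on_arc[of u d "F w"] F_not_constant_on_arc[of d u "F w"] ud by (auto simp: Z_def)
    qed
  qed
qed

lemma F_image: "F ` closure \<Omega> = cball 0 1"
proof
  show "F ` closure \<Omega> \<subseteq> cball 0 1" using norm_F_le by auto
  have "ball 0 1 \<subseteq> F ` closure \<Omega>"
  proof
    fix z :: complex assume "z \<in> ball 0 1"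
    then have "\<phi> z \<in> closure \<Omega>" "F (\<phi> z) = z" using \<phi>_f[of z] F_f closure_subset by auto
    then show "z \<in> F ` closure \<Omega>" by (metis image_eqI)
  qed
  moreover have "closed (F ` closure \<Omega>)"
    by (intro compact_imp_closed compact_continuous_image F compact_closure_\<Omega>)
  ultimately have "closure (ball 0 1) \<subseteq> F ` closure \<Omega>" by (rule closure_minimal)
  then show "cball 0 1 \<subseteq> F ` closure \<Omega>" by simp
qed

end

lemma closed_Jordan_domain_homeomorphic: "closure \<Omega> homeomorphic cball (0::complex) 1"
proof -
  obtain F where F: "uniformly_continuous_on (closure \<Omega>) F" and f_F: "\<And>x. x \<in> \<Omega> \<Longrightarrow> f x = F x"
    using uniformly_continuous_on_extension_on_closure[OF f_uniformly_continuous] by metis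
  have cont: "continuous_on (closure \<Omega>) F" using F by (rule uniformly_continuous_imp_continuous)
  note F_f = f_F[symmetric]
  show ?thesis
    using homeomorphic_compact[OF compact_closure_\<Omega> cont F_image[OF cont F_f] inj_on_F[OF cont F_f]] .
qed

end

theorem Jordan_curve_closed_disk:
  fixes c :: "real \<Rightarrow> complex"
  assumes c: "simple_path c" "pathfinish c = pathstart c"
  shows "(path_image c \<union> inside (path_image c)) homeomorphic cball (0::complex) 1"
proof -
  define \<Omega> where "\<Omega> = inside (path_image c)"
  have "open \<Omega>" "simply_connected \<Omega>" "\<Omega> \<noteq> {}" "\<Omega> \<noteq> UNIV"
    using Jordan_inside_outside[OF c] simply_connected_inside_simple_path[OF c(1)] not_bounded_UNIV
    by (auto simp: \<Omega>_def)
  then obtain f g where fg: "f holomorphic_on \<Omega>" "g holomorphic_on ball 0 1"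
      "\<And>z. z \<in> \<Omega> \<Longrightarrow> f z \<in> ball 0 1 \<and> g (f z) = z" "\<And>z. z \<in> ball 0 1 \<Longrightarrow> g z \<in> \<Omega> \<and> f (g z) = z"
    using Riemann_mapping_theorem[of \<Omega>] by blast
  interpret Jordan_domain_map c \<Omega> "path_image c" f g
    by unfold_locales (use c fg in \<open>auto simp: \<Omega>_def\<close>)
  have "closure \<Omega> = path_image c \<union> inside (path_image c)" unfolding closure_\<Omega> unfolding \<Omega>_def by (rule Un_commute)
  then show ?thesis using closed_Jordan_domain_homeomorphic by (simp only:)
qed

section \<open>Attractors of finitely many contractions\<close>

text \<open>The maps of interest contract some norm equivalent to the Euclidean one, but not the Euclidean norm itself.\<close>

locale gauge =
  fixes N :: "'a::euclidean_space \<Rightarrow> real" and lam c0 c1 :: real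
  assumes lam: "0 \<le> lam" "lam < 1" and c01: "0 < c0" "0 < c1"
    and N_lower: "\<And>v. c0 * norm v \<le> N v" and N_upper: "\<And>v. N v \<le> c1 * norm v"
    and N_add: "\<And>v w. N (v + w) \<le> N v + N w" and N_minus: "\<And>v. N (- v) = N v"
begin

definition contraction :: "('a \<Rightarrow> 'a) \<Rightarrow> bool" where
  "contraction f \<longleftrightarrow> (\<forall>p q. N (f p - f q) \<le> lam * N (p - q))"

lemma contractionD: "contraction f \<Longrightarrow> N (f p - f q) \<le> lam * N (p - q)"
  by (simp add: contraction_def)

lemma N_zero: "N 0 = 0" using N_lower[of 0] N_upper[of 0] by simp

lemma N_nonneg: "0 \<le> N v"
  using N_lower[of v] c01 by (meson mult_nonneg_nonneg norm_ge_zero order_less_imp_le order_trans)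

lemma N_continuous: "continuous_on A N"
proof -
  have "\<bar>N v - N w\<bar> \<le> N (v - w)" for v w
    using N_add[of "v - w" w] N_add[of "w - v" v] N_minus[of "v - w"] by simp
  then have "c1-lipschitz_on UNIV N"
    using c01 N_upper by (intro lipschitz_onI) (auto simp: dist_norm intro: order_trans)
  then show ?thesis using lipschitz_on_continuous_on continuous_on_subset by blast
qed

lemma contraction_continuous:
  assumes "contraction f" shows "continuous_on A f"
proof -
  have "norm (f p - f q) \<le> (lam * c1 / c0) * norm (p - q)" for p q
  proof -
    have "c0 * norm (f p - f q) \<le> lam * N (p - q)" using N_lower contractionD[OF assms] order_trans by blast
    also have "\<dots> \<le> lam * (c1 * norm (p - q))" using N_upper lam by (intro mult_left_mono) auto
    finally show ?thesis using c01 by (simp add: field_simps)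
  qed
  then have "(lam * c1 / c0)-lipschitz_on UNIV f" using lam c01 by (intro lipschitz_onI) (auto simp: dist_norm)
  then show ?thesis using lipschitz_on_continuous_on continuous_on_subset by blast
qed

lemma contraction_comp:
  assumes f: "contraction f" and q: "\<And>p q. N (k p - k q) \<le> N (p - q)"
  shows "contraction (\<lambda>p. f (k p))"
  unfolding contraction_def
proof (intro allI)
  fix p q
  have "N (f (k p) - f (k q)) \<le> lam * N (k p - k q)" by (rule contractionD[OF f])
  also have "\<dots> \<le> lam * N (p - q)" using assms(2) lam(1) by (rule mult_left_mono)
  finally show "N (f (k p) - f (k q)) \<le> lam * N (p - q)" .
qed

lemma contraction_nonexpansive: "contraction f \<Longrightarrow> N (f p - f q) \<le> N (p - q)"
  using contractionD[of f p q] mult_right_mono[of lam 1 "N (p - q)"] lam N_nonneg[of "p - q"] by simp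

lemma bounded_differences:
  assumes "bounded X" "bounded Y"
  obtains E where "\<And>x y. x \<in> X \<Longrightarrow> y \<in> Y \<Longrightarrow> N (x - y) \<le> E"
proof -
  obtain a b where ab: "\<And>x. x \<in> X \<Longrightarrow> norm x \<le> a" "\<And>y. y \<in> Y \<Longrightarrow> norm y \<le> b"
    using assms by (auto simp: bounded_iff)
  show thesis
  proof (rule that)
    fix x y assume "x \<in> X" "y \<in> Y"
    then have "norm (x - y) \<le> a + b" using ab norm_triangle_ineq4[of x y] by (meson add_mono order_trans)
    then have "c1 * norm (x - y) \<le> c1 * (a + b)" using c01 by (intro mult_left_mono) auto
    then show "N (x - y) \<le> c1 * (a + b)" using N_upper[of "x - y"] by linarith
  qed
qed

lemma tendsto_gauge_error: "(\<lambda>n. lam ^ n * E) \<longlonglongrightarrow> 0"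
  using tendsto_mult[OF LIMSEQ_realpow_zero[OF lam] tendsto_const[of E]] by simp

lemma mem_closure_if_gauge_small:
  assumes "\<And>n::nat. \<exists>w\<in>W. N (y - w) \<le> lam ^ n * E"
  shows "y \<in> closure W"
  unfolding closure_approachable
proof (intro allI impI)
  fix e :: real assume e: "0 < e"
  have "\<forall>\<^sub>F n in sequentially. lam ^ n * E < c0 * e"
    using e c01 by (intro order_tendstoD[OF tendsto_gauge_error]) auto
  then obtain n where "lam ^ n * E < c0 * e" by (auto simp: eventually_sequentially)
  moreover obtain w where w: "w \<in> W" "N (y - w) \<le> lam ^ n * E" using assms by blast
  ultimately have "c0 * norm (y - w) < c0 * e" using N_lower[of "y - w"] by linarith
  then show "\<exists>w\<in>W. dist w y < e" using c01 w(1) by (auto simp: dist_norm norm_minus_commute)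
qed

lemma mem_closure_if_pullback:
  assumes base: "\<And>y. y \<in> X \<Longrightarrow> \<exists>w\<in>W. N (y - w) \<le> E"
    and step: "\<And>y. y \<in> X \<Longrightarrow> y \<in> W \<or> (\<exists>f. contraction f \<and> f ` W \<subseteq> W \<and> y \<in> f ` X)"
    and x: "x \<in> X"
  shows "x \<in> closure W"
proof -
  have E: "0 \<le> E" using base[OF x] N_nonneg order_trans by blast
  have "\<exists>w\<in>W. N (y - w) \<le> lam ^ n * E" if "y \<in> X" for n y using that
  proof (induction n arbitrary: y)
    case 0 then show ?case using base by simp
  next
    case (Suc n)
    from step[OF Suc.prems] show ?case
    proof (elim disjE exE conjE)
      assume "y \<in> W"
      then show ?thesis using E lam by (intro bexI[of _ y]) (simp_all add: N_zero)
    next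
      fix f assume f: "contraction f" "f ` W \<subseteq> W" "y \<in> f ` X"
      then obtain y' where y': "y' \<in> X" "y = f y'" by blast
      then obtain w where w: "w \<in> W" "N (y' - w) \<le> lam ^ n * E" using Suc.IH by blast
      have "N (y - f w) \<le> lam * N (y' - w)" using contractionD[OF f(1)] y'(2) by simp
      also have "\<dots> \<le> lam * (lam ^ n * E)" using w(2) lam(1) by (rule mult_left_mono)
      finally show ?thesis using f(2) w(1) by (intro bexI[of _ "f w"]) (auto simp: mult.assoc)
    qed
  qed
  then show ?thesis using mem_closure_if_gauge_small x by blast
qed

lemma subset_if_pullback:
  assumes X: "bounded X" and Y: "compact Y" "Y \<noteq> {}"
    and step: "\<And>y. y \<in> X \<Longrightarrow> y \<in> Y \<or> (\<exists>f. contraction f \<and> f ` Y \<subseteq> Y \<and> y \<in> f ` X)"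
  shows "X \<subseteq> Y"
proof
  fix x assume "x \<in> X"
  obtain E where "\<And>x y. x \<in> X \<Longrightarrow> y \<in> Y \<Longrightarrow> N (x - y) \<le> E"
    using bounded_differences[OF X compact_imp_bounded[OF Y(1)]] by metis
  then have "x \<in> closure Y" using mem_closure_if_pullback[of X Y E x, OF _ step \<open>x \<in> X\<close>] Y(2) by blast
  then show "x \<in> Y" using Y(1) by (simp add: compact_imp_closed)
qed

definition hutchinson :: "('a \<Rightarrow> 'a) set \<Rightarrow> 'a set \<Rightarrow> 'a set" where
  "hutchinson fs X = (\<Union>f\<in>fs. f ` X)"

lemma hutchinson_mono: "X \<subseteq> Y \<Longrightarrow> hutchinson fs X \<subseteq> hutchinson fs Y"
  by (auto simp: hutchinson_def)

context
  fixes fs :: "('a \<Rightarrow> 'a) set"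
  assumes contr: "\<And>f. f \<in> fs \<Longrightarrow> contraction f"
begin

lemma attractor_subset:
  assumes X: "bounded X" "X = hutchinson fs X" and Y: "compact Y" "Y \<noteq> {}" "Y = hutchinson fs Y"
  shows "X \<subseteq> Y"
proof (rule subset_if_pullback[OF X(1) Y(1,2)])
  fix y assume "y \<in> X"
  then have "y \<in> hutchinson fs X" using X(2) by blast
  then obtain f where "f \<in> fs" "y \<in> f ` X" by (auto simp: hutchinson_def)
  moreover from this have "f ` Y \<subseteq> hutchinson fs Y" by (auto simp: hutchinson_def)
  ultimately show "y \<in> Y \<or> (\<exists>f. contraction f \<and> f ` Y \<subseteq> Y \<and> y \<in> f ` X)"
    using contr Y(3) by blast
qed

lemma attractor_unique:
  assumes "compact X" "X \<noteq> {}" "X = hutchinson fs X" "compact Y" "Y \<noteq> {}" "Y = hutchinson fs Y"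
  shows "X = Y"
  by (rule equalityI; rule attractor_subset) (use assms compact_imp_bounded in auto)

context
  assumes fs: "finite fs" "fs \<noteq> {}"
begin

lemma compact_hutchinson: "compact X \<Longrightarrow> compact (hutchinson fs X)"
  unfolding hutchinson_def using fs(1) contr
  by (intro compact_UN) (auto intro!: compact_continuous_image contraction_continuous)

lemma hutchinson_INT:
  fixes K :: "nat \<Rightarrow> 'a set"
  assumes K: "\<And>n. compact (K n)" and decreasing: "\<And>n k. n \<le> k \<Longrightarrow> K k \<subseteq> K n"
  shows "hutchinson fs (\<Inter>n. K n) = (\<Inter>n. hutchinson fs (K n))"
proof
  show "(\<Inter>n. hutchinson fs (K n)) \<subseteq> hutchinson fs (\<Inter>n. K n)"
  proof
    fix x assume x: "x \<in> (\<Inter>n. hutchinson fs (K n))"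
    have "\<forall>n. \<exists>f\<in>fs. x \<in> f ` K n" using x unfolding hutchinson_def by blast
    then obtain F where F: "\<And>n. F n \<in> fs" "\<And>n. x \<in> F n ` K n" by metis
    have "finite (range F)" using F(1) fs(1) by (meson finite_subset image_subsetI)
    then obtain f where f: "infinite {n. F n = f}" using inf_img_fin_dom[of F UNIV] by (auto simp: vimage_def)
    then have "f \<in> fs" using F(1) by (metis (mono_tags, lifting) Collect_empty_eq finite.emptyI)
    define L where "L n = {p \<in> K n. f p = x}" for n
    have "compact (L n)" for n
      using continuous_closed_preimage_constant
          [OF contraction_continuous[OF contr[OF \<open>f \<in> fs\<close>]] compact_imp_closed[OF K]]
        compact_Int_closed[OF K] by (metis (mono_tags, lifting) L_def inf.absorb_iff2 mem_Collect_eq subsetI)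
    moreover have "L n \<noteq> {}" for n
    proof -
      obtain k where "n \<le> k" "F k = f"
        using f by (metis (mono_tags, lifting) finite_nat_set_iff_bounded_le mem_Collect_eq nat_le_linear)
      then show ?thesis using F(2)[of k] decreasing[of n k] by (auto simp: L_def)
    qed
    moreover have "n \<le> k \<Longrightarrow> L k \<subseteq> L n" for n k using decreasing by (auto simp: L_def)
    ultimately have "(\<Inter>n. L n) \<noteq> {}" by (intro compact_nest) auto
    then show "x \<in> hutchinson fs (\<Inter>n. K n)" using \<open>f \<in> fs\<close> by (auto simp: L_def hutchinson_def)
  qed
qed (auto simp: hutchinson_def)

lemma compact_gauge_ball: "compact {p. N p \<le> R}"
proof -
  have "closed {p. N p \<le> R}" by (intro closed_Collect_le N_continuous continuous_on_const)
  moreover have "norm p \<le> R / c0" if "N p \<le> R" for p using that N_lower[of p] c01 by (simp add: field_simps)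
  then have "bounded {p. N p \<le> R}" by (auto simp: bounded_iff)
  ultimately show ?thesis by (simp add: compact_eq_bounded_closed)
qed

lemma hutchinson_gauge_ball:
  obtains R where "0 \<le> R" "hutchinson fs {p. N p \<le> R} \<subseteq> {p. N p \<le> R}"
proof -
  define R where "R = Max ((\<lambda>f. N (f 0)) ` fs) / (1 - lam)"
  have R: "N (f 0) \<le> (1 - lam) * R" if "f \<in> fs" for f
    using that fs lam by (simp add: R_def)
  obtain f where "f \<in> fs" using fs by blast
  then have "0 \<le> (1 - lam) * R" using R[of f] N_nonneg[of "f 0"] by linarith
  then have "0 \<le> R" using lam by (simp add: zero_le_mult_iff)
  moreover have "N (f p) \<le> R" if "f \<in> fs" "N p \<le> R" for f p
  proof -
    have "N (f p) \<le> N (f p - f 0) + N (f 0)" using N_add[of "f p - f 0" "f 0"] by simp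
    also have "\<dots> \<le> lam * N p + (1 - lam) * R" using contractionD[OF contr[OF that(1)], of p 0] R[OF that(1)] by simp
    also have "\<dots> \<le> lam * R + (1 - lam) * R" using that(2) lam by (intro add_mono mult_left_mono) auto
    finally show ?thesis by (simp add: algebra_simps)
  qed
  ultimately show thesis using that[of R] by (auto simp: hutchinson_def)
qed

lemma attractor_exists: "\<exists>X. compact X \<and> X \<noteq> {} \<and> X = hutchinson fs X"
proof -
  obtain R where R: "0 \<le> R" "hutchinson fs {p. N p \<le> R} \<subseteq> {p. N p \<le> R}" by (rule hutchinson_gauge_ball)
  define K where "K n = (hutchinson fs ^^ n) {p. N p \<le> R}" for n
  have K_Suc: "K (Suc n) = hutchinson fs (K n)" for n by (simp add: K_def)
  have "K (Suc n) \<subseteq> K n" for n by (induction n) (auto simp: K_def hutchinson_mono R(2))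
  then have decreasing: "n \<le> k \<Longrightarrow> K k \<subseteq> K n" for n k by (rule lift_Suc_antimono_le)
  have compact: "compact (K n)" for n
    by (induction n) (auto simp: K_def compact_gauge_ball compact_hutchinson)
  have "0 \<in> K 0" using R(1) by (simp add: K_def N_zero)
  then have nonempty: "K n \<noteq> {}" for n by (induction n) (use fs in \<open>auto simp: K_Suc hutchinson_def\<close>)
  have "hutchinson fs (\<Inter>n. K n) = (\<Inter>n. K (Suc n))" unfolding K_Suc by (rule hutchinson_INT[OF compact decreasing])
  also have "\<dots> = (\<Inter>n. K n)" using decreasing[of _ "Suc _"] by (auto simp: le_Suc_eq)
  finally have "(\<Inter>n. K n) = hutchinson fs (\<Inter>n. K n)" ..
  moreover have "compact (\<Inter>n. K n)" using compact by (intro compact_Inter) auto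
  moreover have "(\<Inter>n. K n) \<noteq> {}" by (rule compact_nest) (use compact nonempty decreasing in auto)
  ultimately show ?thesis by blast
qed

end

end

end

section \<open>Arcs from chains of contractions\<close>

definition arc_between :: "'a::topological_space set \<Rightarrow> 'a \<Rightarrow> 'a \<Rightarrow> bool" where
  "arc_between X a b \<longleftrightarrow> (\<exists>p. arc p \<and> path_image p = X \<and> pathstart p = a \<and> pathfinish p = b)"

lemma arc_betweenE:
  assumes "arc_between X a b"
  obtains p where "arc p" "path_image p = X" "pathstart p = a" "pathfinish p = b"
  using assms unfolding arc_between_def by blast

lemma arc_between_ends:
  assumes "arc_between X a b" shows "a \<in> X" "b \<in> X" "a \<noteq> b"
  using assms arc_distinct_ends
  unfolding arc_between_def by (metis pathstart_in_path_image pathfinish_in_path_image)+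

lemma arc_between_reverse:
  assumes "arc_between X a b" shows "arc_between X b a"
  using assms unfolding arc_between_def
  by (metis arc_reversepath path_image_reversepath pathfinish_reversepath pathstart_reversepath)

lemma arc_between_join:
  assumes "arc_between X a b" "arc_between Y b c" "X \<inter> Y \<subseteq> {b}"
  shows "arc_between (X \<union> Y) a c"
proof -
  obtain p where p: "arc p" "path_image p = X" "pathstart p = a" "pathfinish p = b"
    by (rule arc_betweenE[OF assms(1)])
  obtain q where q: "arc q" "path_image q = Y" "pathstart q = b" "pathfinish q = c"
    by (rule arc_betweenE[OF assms(2)])
  have "arc (p +++ q)" using p q assms(3) by (intro arc_join) simp_all
  moreover have "path_image (p +++ q) = X \<union> Y" using p q by (subst path_image_join) simp_all
  ultimately show ?thesis unfolding arc_between_def using p(3) q(4) by (intro exI[of _ "p +++ q"]) simp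
qed

lemma arc_between_image:
  assumes "arc_between X a b" "continuous_on X h" "inj_on h X"
  shows "arc_between (h ` X) (h a) (h b)"
proof -
  obtain p where p: "arc p" "path_image p = X" "pathstart p = a" "pathfinish p = b"
    by (rule arc_betweenE[OF assms(1)])
  have "path (h \<circ> p)" using p assms(2) by (intro path_continuous_image) (auto simp: arc_def)
  moreover have "inj_on (h \<circ> p) {0..1}" using p assms(3) by (intro comp_inj_on) (auto simp: arc_def path_image_def)
  ultimately show ?thesis unfolding arc_between_def using p
    by (intro exI[of _ "h \<circ> p"]) (auto simp: arc_def path_image_compose pathstart_compose pathfinish_compose)
qed

lemma arc_between_segment:
  fixes a b :: "'a::real_normed_vector"
  assumes "a \<noteq> b" shows "arc_between (closed_segment a b) a b"
  unfolding arc_between_def using assms arc_linepath by (intro exI[of _ "linepath a b"]) simp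

text \<open>The set \<open>K\<close> is a chain of \<open>m\<close> links \<open>P i\<close> joining \<open>x i\<close> to \<open>x (i + 1)\<close>. A link with index in \<open>I\<close> is a
  contracted copy of \<open>K\<close>, any other one is an arc given in advance.\<close>

locale arc_chain = gauge N lam c0 c1 for N :: "'a::euclidean_space \<Rightarrow> real" and lam c0 c1 +
  fixes K :: "'a set" and P :: "nat \<Rightarrow> 'a set" and x :: "nat \<Rightarrow> 'a" and h :: "nat \<Rightarrow> 'a \<Rightarrow> 'a"
    and I :: "nat set" and m :: nat
  assumes m: "3 \<le> m" and K: "compact K" "K \<noteq> {}" "K = (\<Union>i<m. P i)"
    and copy: "\<And>i. i < m \<Longrightarrow> i \<in> I \<Longrightarrow>
      P i = h i ` K \<and> h i (x 0) = x i \<and> h i (x m) = x (Suc i) \<and> inj (h i) \<and> contraction (h i)"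
    and given: "\<And>i. i < m \<Longrightarrow> i \<notin> I \<Longrightarrow>
      arc_between (P i) (x i) (x (Suc i))"
    and disj: "\<And>i j. i < m \<Longrightarrow> j < m \<Longrightarrow> Suc i < j \<Longrightarrow> P i \<inter> P j = {}"
    and adj: "\<And>i. Suc i < m \<Longrightarrow> P i \<inter> P (Suc i) \<subseteq> {x (Suc i)}"
begin

definition \<gamma> :: "nat \<Rightarrow> real \<Rightarrow> 'a" where
  "\<gamma> i = (SOME p. arc p \<and> path_image p = P i \<and> pathstart p = x i \<and> pathfinish p = x (Suc i))"

lemma \<gamma>_arc:
  assumes "i < m" "i \<notin> I"
  shows "arc (\<gamma> i) \<and> path_image (\<gamma> i) = P i \<and> \<gamma> i 0 = x i \<and> \<gamma> i 1 = x (Suc i)"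
  using someI_ex[OF given[OF assms, unfolded arc_between_def]] by (simp add: \<gamma>_def pathstart_def pathfinish_def)

definition link :: "nat \<Rightarrow> (real \<Rightarrow> 'a) \<Rightarrow> real \<Rightarrow> 'a" where
  "link i q s = (if i \<in> I then h i (q s) else \<gamma> i s)"

definition index :: "real \<Rightarrow> nat" where
  "index t = min (m - 1) (nat \<lfloor>real m * t\<rfloor>)"

definition refine :: "(real \<Rightarrow> 'a) \<Rightarrow> real \<Rightarrow> 'a" where
  "refine q t = link (index t) q (real m * t - real (index t))"

definition admissible :: "(real \<Rightarrow> 'a) \<Rightarrow> bool" where
  "admissible q \<longleftrightarrow> continuous_on {0..1} q \<and> q 0 = x 0 \<and> q 1 = x m"

lemma m_pos: "0 < real m" using m by simp

lemma index_less: "index t < m"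
  using m by (simp add: index_def)

lemma index_offset:
  assumes t: "t \<in> {0..1}"
  shows "real m * t - real (index t) \<in> {0..1}"
proof -
  have mt: "0 \<le> real m * t" "real m * t \<le> real m" using t m_pos by (auto simp: mult_left_le)
  show ?thesis
  proof (cases "nat \<lfloor>real m * t\<rfloor> \<le> m - 1")
    case True
    then have "real (index t) = of_int \<lfloor>real m * t\<rfloor>" using mt(1) by (simp add: index_def)
    then show ?thesis by (auto simp: less_imp_le) linarith
  next
    case False
    then have "index t = m - 1" "int m \<le> \<lfloor>real m * t\<rfloor>" by (auto simp: index_def)
    then have "real m * t = real m" using mt by linarith
    then show ?thesis using \<open>index t = m - 1\<close> m by (simp add: of_nat_diff)
  qed
qed

lemma unit_interval_split:
  assumes "t \<in> {0..1}"
  obtains i s where "i < m" "s \<in> {0..1}" "t = (real i + s) / m"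
  using that[of "index t" "real m * t - real (index t)"] index_less index_offset[OF assms] m_pos by simp

lemma link_mem_unit: "i < m \<Longrightarrow> s \<in> {0..1} \<Longrightarrow> (real i + s) / m \<in> {0..1}"
  using m_pos by (auto simp: field_simps)

lemma link_ends:
  assumes "q 0 = x 0" "q 1 = x m" "i < m"
  shows "link i q 0 = x i" "link i q 1 = x (Suc i)"
  using assms copy[of i] \<gamma>_arc[of i] by (auto simp: link_def)

lemma refine_link:
  assumes q: "q 0 = x 0" "q 1 = x m" and i: "i < m" and s: "s \<in> {0..1}"
  shows "refine q ((real i + s) / m) = link i q s"
proof -
  define t where "t = (real i + s) / m"
  have mt: "real m * t = real i + s" using m_pos by (simp add: t_def)
  have "refine q t = link i q s"
  proof (cases "s < 1 \<or> Suc i = m")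
    case True
    have "index t = i"
    proof (cases "s < 1")
      case True
      then have "\<lfloor>real m * t\<rfloor> = int i" using s unfolding mt by (simp add: floor_eq_iff)
      then show ?thesis using i by (simp add: index_def)
    next
      case False
      then have "\<lfloor>real m * t\<rfloor> = int i + 1" using s unfolding mt by (simp add: floor_eq_iff)
      then show ?thesis using True False by (simp add: index_def)
    qed
    then show ?thesis using mt by (simp add: refine_def)
  next
    case False
    then have "s = 1" "Suc i < m" using s i by auto
    then have "\<lfloor>real m * t\<rfloor> = int i + 1" unfolding mt by (simp add: floor_eq_iff)
    then have "index t = Suc i" using \<open>Suc i < m\<close> by (simp add: index_def nat_add_distrib)
    then show ?thesis using mt \<open>s = 1\<close> link_ends[OF q] i \<open>Suc i < m\<close> by (simp add: refine_def)
  qed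
  then show ?thesis by (simp add: t_def)
qed

lemma link_continuous:
  assumes "continuous_on {0..1} q" "i < m" shows "continuous_on {0..1} (link i q)"
proof (cases "i \<in> I")
  case True
  then have "continuous_on UNIV (h i)" using copy[OF assms(2)] contraction_continuous by blast
  then have "continuous_on {0..1} (\<lambda>s. h i (q s))" by (rule continuous_on_compose2) (use assms in auto)
  then show ?thesis using True by (simp add: link_def[abs_def])
next
  case False
  then show ?thesis using \<gamma>_arc[OF assms(2)] by (simp add: link_def[abs_def] arc_def path_def)
qed

lemma refine_admissible:
  assumes "admissible q" shows "admissible (refine q)"
proof -
  have q: "q 0 = x 0" "q 1 = x m" "continuous_on {0..1} q" using assms by (auto simp: admissible_def)
  have "continuous_on (\<Union>i<m. (\<lambda>s. (real i + s) / m) ` {0..1}) (refine q)"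
  proof (rule continuous_on_closed_Union)
    fix i assume "i \<in> {..<m}"
    then have i: "i < m" by simp
    show "closed ((\<lambda>s. (real i + s) / m) ` {0..1})"
      using m_pos by (intro compact_imp_closed compact_continuous_image continuous_intros) auto
    have "continuous_on ((\<lambda>s. (real i + s) / m) ` {0..1}) (\<lambda>t. link i q (real m * t - real i))"
      by (rule continuous_on_compose2[OF link_continuous[OF q(3) i]]) (use m_pos in \<open>auto intro!: continuous_intros\<close>)
    then show "continuous_on ((\<lambda>s. (real i + s) / m) ` {0..1}) (refine q)"
      by (rule continuous_on_eq) (use refine_link[OF q(1,2) i] m_pos in auto)
  qed auto
  moreover have "(\<Union>i<m. (\<lambda>s. (real i + s) / m) ` {0..1}) = {0..1}"
  proof (intro equalityI subsetI)
    fix t :: real assume "t \<in> {0..1}"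
    then obtain i s where "i < m" "s \<in> {0..1}" "t = (real i + s) / m" by (rule unit_interval_split)
    then show "t \<in> (\<Union>i<m. (\<lambda>s. (real i + s) / m) ` {0..1})" by blast
  qed (use link_mem_unit in blast)
  moreover have "refine q 0 = x 0" using refine_link[OF q(1,2), of 0 0] link_ends[OF q(1,2), of 0] m by simp
  moreover have "refine q 1 = x m"
    using refine_link[OF q(1,2), of "m - 1" 1] link_ends[OF q(1,2), of "m - 1"] m by (simp add: of_nat_diff)
  ultimately show ?thesis by (simp add: admissible_def)
qed

lemma refine_contracts:
  "N (refine q t - refine q' t) \<le> lam * N (q (real m * t - real (index t)) - q' (real m * t - real (index t)))"
  using copy[OF index_less[of t]] contractionD N_nonneg lam by (auto simp: refine_def link_def N_zero)

definition iterate :: "nat \<Rightarrow> real \<Rightarrow> 'a" where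
  "iterate n = (refine ^^ n) (\<lambda>t. (1 - t) *\<^sub>R x 0 + t *\<^sub>R x m)"

lemma iterate_Suc: "iterate (Suc n) = refine (iterate n)"
  by (simp add: iterate_def)

lemma iterate_admissible: "admissible (iterate n)"
proof (induction n)
  case 0 show ?case by (auto simp: iterate_def admissible_def intro!: continuous_intros)
qed (simp add: iterate_Suc refine_admissible)

lemma iterate_increment:
  obtains D where "\<And>n t. t \<in> {0..1} \<Longrightarrow> norm (iterate (Suc n) t - iterate n t) \<le> D * lam ^ n"
proof -
  have "bounded (iterate n ` {0..1})" for n
    using iterate_admissible[of n]
    by (auto simp: admissible_def intro!: compact_imp_bounded compact_continuous_image)
  then obtain E where E: "\<And>s t. s \<in> {0..1} \<Longrightarrow> t \<in> {0..1} \<Longrightarrow> N (iterate 1 s - iterate 0 t) \<le> E"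
    using bounded_differences[of "iterate 1 ` {0..1}" "iterate 0 ` {0..1}"] by (metis imageI)
  have increment: "N (iterate (Suc n) t - iterate n t) \<le> lam ^ n * E" if "t \<in> {0..1}" for n t using that
  proof (induction n arbitrary: t)
    case 0 then show ?case using E[of t t] by simp
  next
    case (Suc n)
    define s where "s = real m * t - real (index t)"
    have "N (iterate (Suc (Suc n)) t - iterate (Suc n) t) \<le> lam * N (iterate (Suc n) s - iterate n s)"
      using refine_contracts[of "iterate (Suc n)" t "iterate n"] by (simp add: iterate_Suc s_def)
    also have "\<dots> \<le> lam * (lam ^ n * E)"
      using Suc.IH[of s] index_offset[OF Suc.prems] lam by (intro mult_left_mono) (auto simp: s_def)
    finally show ?case by (simp add: mult.assoc)
  qed
  have "norm (iterate (Suc n) t - iterate n t) \<le> (E / c0) * lam ^ n" if "t \<in> {0..1}" for n t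
  proof -
    have "c0 * norm (iterate (Suc n) t - iterate n t) \<le> lam ^ n * E"
      using increment[OF that] N_lower order_trans by blast
    then show ?thesis using c01 by (simp add: field_simps)
  qed
  then show thesis by (rule that)
qed

lemma iterate_uniform_limit:
  obtains p where "uniform_limit {0..1} iterate p sequentially"
proof -
  obtain D where D: "\<And>n t. t \<in> {0..1} \<Longrightarrow> norm (iterate (Suc n) t - iterate n t) \<le> D * lam ^ n"
    using iterate_increment by blast
  define f where "f n t = iterate (Suc n) t - iterate n t" for n t
  have "uniform_limit {0..1} (\<lambda>n t. \<Sum>i<n. f i t) (\<lambda>t. suminf (\<lambda>i. f i t)) sequentially"
    by (rule Weierstrass_m_test[of _ _ "\<lambda>n. D * lam ^ n"])
      (use D lam in \<open>auto simp: f_def intro!: summable_mult summable_geometric\<close>)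
  then have "uniform_limit {0..1} (\<lambda>n t. iterate 0 t + (\<Sum>i<n. f i t))
      (\<lambda>t. iterate 0 t + suminf (\<lambda>i. f i t)) sequentially"
    by (intro uniform_limit_add uniform_limit_const)
  moreover have "iterate 0 t + (\<Sum>i<n. f i t) = iterate n t" for n t
    unfolding f_def by (subst sum_lessThan_telescope) simp
  ultimately show thesis using that by simp
qed

lemma limit_path:
  obtains p where "admissible p" "\<And>i s. i < m \<Longrightarrow> s \<in> {0..1} \<Longrightarrow> p ((real i + s) / m) = link i p s"
proof -
  obtain p where limit: "uniform_limit {0..1} iterate p sequentially" by (rule iterate_uniform_limit)
  note pointwise = tendsto_uniform_limitI[OF limit]
  have ends: "iterate n 0 = x 0" "iterate n 1 = x m" for n using iterate_admissible by (auto simp: admissible_def)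
  show thesis
  proof (rule that)
    have "continuous_on {0..1} p"
      by (rule uniform_limit_theorem[OF _ limit])
        (use iterate_admissible in \<open>auto simp: admissible_def intro!: always_eventually\<close>)
    moreover have "p 0 = x 0" "p 1 = x m"
      using pointwise[of 0] pointwise[of 1] by (auto simp: ends LIMSEQ_const_iff)
    ultimately show "admissible p" by (simp add: admissible_def)
    fix i s assume i: "i < m" and s: "s \<in> {0..1::real}"
    have "(\<lambda>n. link i (iterate n) s) \<longlonglongrightarrow> link i p s"
    proof (cases "i \<in> I")
      case True
      then have cont: "continuous_on UNIV (h i)" using copy[OF i] contraction_continuous by blast
      have "(\<lambda>n. h i (iterate n s)) \<longlonglongrightarrow> h i (p s)"
        by (rule continuous_on_tendsto_compose[OF cont pointwise[OF s]]) auto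
      then show ?thesis using True by (simp add: link_def)
    qed (simp add: link_def)
    moreover have "iterate (Suc n) ((real i + s) / m) = link i (iterate n) s" for n
      unfolding iterate_Suc by (rule refine_link[OF ends i s])
    then have "(\<lambda>n. link i (iterate n) s) \<longlonglongrightarrow> p ((real i + s) / m)"
      using LIMSEQ_Suc[OF pointwise[OF link_mem_unit[OF i s]]] by simp
    ultimately show "p ((real i + s) / m) = link i p s" using LIMSEQ_unique by blast
  qed
qed

context
  fixes p
  assumes adm: "admissible p" and self_similar: "\<And>i s. i < m \<Longrightarrow> s \<in> {0..1} \<Longrightarrow> p ((real i + s) / m) = link i p s"
begin

lemma p_ends: "p 0 = x 0" "p 1 = x m" and compact_p_image: "compact (p ` {0..1})"
  using adm by (auto simp: admissible_def intro: compact_continuous_image)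

lemma link_subset: "i < m \<Longrightarrow> link i p ` {0..1} \<subseteq> p ` {0..1}"
  using self_similar link_mem_unit by (metis image_eqI image_subsetI)

lemma p_image_subset: "p ` {0..1} \<subseteq> K"
proof (rule subset_if_pullback[OF compact_imp_bounded[OF compact_p_image] K(1,2)])
  fix y assume "y \<in> p ` {0..1}"
  then obtain i s where iy: "i < m" "s \<in> {0..1}" "y = link i p s"
    using unit_interval_split self_similar by (metis imageE)
  show "y \<in> K \<or> (\<exists>f. contraction f \<and> f ` K \<subseteq> K \<and> y \<in> f ` p ` {0..1})"
  proof (cases "i \<in> I")
    case True
    then have "h i ` K \<subseteq> K" "y \<in> h i ` p ` {0..1}" using copy[OF iy(1) True] K(3) iy by (auto simp: link_def)
    then show ?thesis using copy[OF iy(1) True] by blast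
  next
    case False
    then have "y \<in> P i" using \<gamma>_arc[OF iy(1) False] iy by (auto simp: link_def path_image_def)
    then show ?thesis using K(3) iy(1) by blast
  qed
qed

lemma subset_p_image: "K \<subseteq> p ` {0..1}"
proof (rule subset_if_pullback[OF compact_imp_bounded[OF K(1)] compact_p_image])
  show "p ` {0..1} \<noteq> {}" by simp
  fix y assume "y \<in> K"
  then obtain i where i: "i < m" "y \<in> P i" using K(3) by blast
  show "y \<in> p ` {0..1} \<or> (\<exists>f. contraction f \<and> f ` p ` {0..1} \<subseteq> p ` {0..1} \<and> y \<in> f ` K)"
  proof (cases "i \<in> I")
    case True
    then have "h i ` p ` {0..1} \<subseteq> p ` {0..1}" using link_subset[OF i(1)] by (auto simp: link_def)
    then show ?thesis using copy[OF i(1) True] i(2) by blast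
  next
    case False
    then have "y \<in> link i p ` {0..1}"
      using \<gamma>_arc[OF i(1) False] i(2) by (simp add: link_def[abs_def] path_image_def)
    then show ?thesis using link_subset[OF i(1)] by blast
  qed
qed

lemma p_image: "p ` {0..1} = K"
  using p_image_subset subset_p_image by blast

lemma link_image:
  assumes i: "i < m" shows "link i p ` {0..1} = P i"
proof (cases "i \<in> I")
  case True
  then have "link i p ` {0..1} = h i ` p ` {0..1}" by (auto simp: link_def)
  then show ?thesis using p_image copy[OF i True] by simp
next
  case False
  then show ?thesis using \<gamma>_arc[OF i False] by (simp add: link_def path_image_def)
qed

lemma link_point:
  assumes "i < m" "s \<in> {0..1}" shows "p ((real i + s) / m) \<in> P i"
  using link_image[OF assms(1)] self_similar[OF assms] assms(2) by auto

text \<open>Coinciding points lie in the same link or in adjacent ones; in the second case both coincide with the common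
  vertex. Each step thus shortens the distance of their parameters by the factor \<open>2/m < 1\<close>.\<close>

context
  fixes q :: real
  assumes gap: "\<And>s t. s \<in> {0..1} \<Longrightarrow> t \<in> {0..1} \<Longrightarrow> p s = p t \<Longrightarrow> \<bar>s - t\<bar> \<le> q"
begin

lemma gap_within_link:
  assumes i: "i < m" and st: "s \<in> {0..1}" "t \<in> {0..1}" "p ((real i + s) / m) = p ((real i + t) / m)"
  shows "\<bar>s - t\<bar> \<le> q"
proof (cases "i \<in> I")
  case True
  then have "p s = p t" using copy[OF i] st(3) self_similar[OF i] st(1,2) by (auto simp: link_def inj_def)
  then show ?thesis using gap st by blast
next
  case False
  then have "inj_on (\<gamma> i) {0..1}" "\<gamma> i s = \<gamma> i t"
    using \<gamma>_arc[OF i] st(3) self_similar[OF i] st(1,2) by (auto simp: link_def arc_def)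
  then have "s = t" using st by (auto dest: inj_onD)
  then show ?thesis using gap[of 0 0] by simp
qed

lemma gap_across_vertex:
  assumes i: "Suc i < m" and st: "s \<in> {0..1}" "t \<in> {0..1}" "p ((real i + s) / m) = p ((real (Suc i) + t) / m)"
  shows "\<bar>(real i + s) / m - (real (Suc i) + t) / m\<bar> \<le> 2 / m * q"
proof -
  have "p ((real i + s) / m) \<in> P i \<inter> P (Suc i)" using link_point[of i s] link_point[of "Suc i" t] i st by auto
  then have "p ((real i + s) / m) = x (Suc i)" using adj[OF i] by blast
  then have "p ((real i + s) / m) = p ((real i + 1) / m)" "p ((real (Suc i) + t) / m) = p ((real (Suc i) + 0) / m)"
    using self_similar[of i 1] self_similar[of "Suc i" 0] link_ends[OF p_ends] i st(3) by auto
  then have "\<bar>s - 1\<bar> \<le> q" "\<bar>t - 0\<bar> \<le> q"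
    using gap_within_link[of i s 1] gap_within_link[of "Suc i" t 0] i st by auto
  then have "\<bar>s - 1 - t\<bar> / m \<le> 2 * q / m" by (intro divide_right_mono) linarith+
  moreover have "(real i + s) / m - (real (Suc i) + t) / m = (s - 1 - t) / m"
    by (simp add: diff_divide_distrib[symmetric])
  ultimately show ?thesis by (simp add: abs_divide)
qed

lemma gap_shrinks:
  assumes st: "s \<in> {0..1}" "t \<in> {0..1}" "p s = p t"
  shows "\<bar>s - t\<bar> \<le> 2 / m * q"
proof -
  obtain i s' where i: "i < m" "s' \<in> {0..1}" "s = (real i + s') / m" by (rule unit_interval_split[OF st(1)])
  obtain j t' where j: "j < m" "t' \<in> {0..1}" "t = (real j + t') / m" by (rule unit_interval_split[OF st(2)])
  have "p s \<in> P i" "p s \<in> P j"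
    using link_point[OF i(1,2)] link_point[OF j(1,2)] st(3) unfolding i(3) j(3) by simp_all
  then have "\<not> Suc i < j" "\<not> Suc j < i" using disj i(1) j(1) by blast+
  then consider "i = j" | "j = Suc i" | "i = Suc j" by linarith
  then show ?thesis
  proof cases
    assume "i = j"
    then have "\<bar>s' - t'\<bar> \<le> 2 * q" using gap_within_link[of i s' t'] gap[of 0 0] i j st(3) by simp
    then have "\<bar>s' - t'\<bar> / m \<le> 2 * q / m" by (rule divide_right_mono) simp
    moreover have "\<bar>s - t\<bar> = \<bar>s' - t'\<bar> / m"
      using \<open>i = j\<close> i j by (simp add: diff_divide_distrib[symmetric] abs_divide)
    ultimately show ?thesis by simp
  next
    assume "j = Suc i"
    then show ?thesis using gap_across_vertex[of i s' t'] i j st(3) by simp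
  next
    assume "i = Suc j"
    then have "\<bar>t - s\<bar> \<le> 2 / m * q" using gap_across_vertex[of j t' s'] i j st(3) by simp
    then show ?thesis by (simp only: abs_minus_commute)
  qed
qed

end

lemma coincidence_gap:
  assumes "s \<in> {0..1}" "t \<in> {0..1}" "p s = p t"
  shows "\<bar>s - t\<bar> \<le> (2 / m) ^ n"
  using assms
proof (induction n arbitrary: s t)
  case 0 then show ?case by auto
next
  case (Suc n)
  show ?case unfolding power_Suc by (rule gap_shrinks[OF Suc.IH Suc.prems])
qed

lemma inj_on_p: "inj_on p {0..1}"
proof (rule inj_onI)
  fix s t assume st: "s \<in> {0..1}" "t \<in> {0..1}" "p s = p t"
  have "(\<lambda>n. (2 / real m) ^ n) \<longlonglongrightarrow> 0" using m by (intro LIMSEQ_realpow_zero) auto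
  then have "\<bar>s - t\<bar> \<le> 0" using coincidence_gap[OF st] by (meson LIMSEQ_le_const)
  then show "s = t" by simp
qed

end

lemma uniform_arc_exists:
  obtains p where "arc p" "\<And>i. i < m \<Longrightarrow> p ` {real i / m .. (real i + 1) / m} = P i"
    "\<And>i. i \<le> m \<Longrightarrow> p (real i / m) = x i"
proof -
  obtain p where p: "admissible p" "\<And>i s. i < m \<Longrightarrow> s \<in> {0..1} \<Longrightarrow> p ((real i + s) / m) = link i p s"
    using limit_path by blast
  have ends: "p 0 = x 0" "p 1 = x m" using p(1) by (simp_all add: admissible_def)
  show thesis
  proof (rule that)
    show "arc p" using p(1) inj_on_p[OF p] by (simp add: arc_def path_def admissible_def)
    show "p ` {real i / m .. (real i + 1) / m} = P i" if i: "i < m" for i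
    proof -
      have "{real i / m .. (real i + 1) / m} = (\<lambda>s. (real i + s) / m) ` {0..1}"
      proof (intro equalityI subsetI)
        fix t assume "t \<in> {real i / m .. (real i + 1) / m}"
        then show "t \<in> (\<lambda>s. (real i + s) / m) ` {0..1}"
          using m_pos by (intro image_eqI[of _ _ "real m * t - real i"]) (auto simp: field_simps)
      qed (use m_pos in \<open>auto simp: field_simps\<close>)
      then have "p ` {real i / m .. (real i + 1) / m} = link i p ` {0..1}"
        using p(2)[OF i] by (auto simp: image_image intro!: image_cong)
      then show ?thesis using link_image[OF p i] by simp
    qed
    show "p (real i / m) = x i" if "i \<le> m" for i
      using that p(2)[of i 0] link_ends(1)[OF ends, of i] ends m_pos by (cases "i < m") auto
  qed
qed

theorem subchain_arc:
  assumes "i < j" "j \<le> m" shows "arc_between (\<Union>l\<in>{i..<j}. P l) (x i) (x j)"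
proof -
  obtain p where p: "arc p" "\<And>i. i < m \<Longrightarrow> p ` {real i / m .. (real i + 1) / m} = P i"
      "\<And>i. i \<le> m \<Longrightarrow> p (real i / m) = x i"
    using uniform_arc_exists by blast
  have union: "p ` {real i / m .. real k / m} = (\<Union>l\<in>{i..<k}. P l)" if "i < k" "k \<le> m" for k using that
  proof (induction k)
    case (Suc k)
    show ?case
    proof (cases "i = k")
      case True
      have "{k..<Suc k} = {k}" by auto
      then show ?thesis using p(2)[of k] True Suc.prems by (simp add: add.commute)
    next
      case False
      have "{real i / m .. real (Suc k) / m} = {real i / m .. real k / m} \<union> {real k / m .. (real k + 1) / m}"
        using False Suc.prems m_pos by (subst ivl_disj_un_two_touch) (auto simp: divide_right_mono add.commute)
      moreover have "{i..<Suc k} = insert k {i..<k}" using Suc.prems by auto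
      ultimately show ?thesis using Suc p(2)[of k] False by (simp add: image_Un Un_commute)
    qed
  qed simp
  have ij: "real i / m < real j / m" using assms(1) m_pos by (simp add: divide_strict_right_mono)
  have "arc (subpath (real i / m) (real j / m) p)"
    using ij assms m_pos by (intro arc_subpath_arc p(1)) (auto simp: field_simps)
  moreover have "path_image (subpath (real i / m) (real j / m) p) = (\<Union>l\<in>{i..<j}. P l)"
    unfolding path_image_subpath using ij union[OF assms] by simp
  ultimately show ?thesis unfolding arc_between_def using p(3)[of i] p(3)[of j] assms
    by (intro exI[of _ "subpath (real i / m) (real j / m) p"]) simp
qed

corollary chain_arc: "arc_between K (x 0) (x m)"
  using subchain_arc[of 0 m] m K(3) by (simp add: atLeast0LessThan)

end

section \<open>The tile as an attractor\<close>

lemma ex_reflect_atLeastAtMost: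
  fixes a b c :: int
  assumes "a + b = c"
  shows "(\<exists>k\<in>{a..b}. P (c - k)) \<longleftrightarrow> (\<exists>k\<in>{a..b}. P k)"
proof
  assume "\<exists>k\<in>{a..b}. P k"
  then obtain k where "k \<in> {a..b}" "P k" by blast
  then show "\<exists>k\<in>{a..b}. P (c - k)" using assms by (intro bexI[of _ "c - k"]) auto
next
  assume "\<exists>k\<in>{a..b}. P (c - k)"
  then obtain k where "k \<in> {a..b}" "P (c - k)" by blast
  then show "\<exists>k\<in>{a..b}. P k" using assms by (intro bexI[of _ "c - k"]) auto
qed

lemma mem_image_inverse:
  assumes "\<And>x. h (f x) = x" "\<And>y. f (h y) = y"
  shows "y \<in> f ` X \<longleftrightarrow> h y \<in> X"
  using assms by (metis image_iff)

lemma mem_uminus_image: "x \<in> uminus ` X \<longleftrightarrow> - x \<in> X" for X :: "'a::group_add set"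
  by (rule mem_image_inverse) simp_all

definition ginv :: "int \<Rightarrow> int \<Rightarrow> real \<times> real \<Rightarrow> real \<times> real" where
  "ginv A B p =
    (snd p + of_int A * (((of_int B - 1) / 2 - fst p) / of_int B), ((of_int B - 1) / 2 - fst p) / of_int B)"

lemma gmap_ginv: "B \<noteq> 0 \<Longrightarrow> gmap A B (ginv A B p) = p"
  by (cases p) (simp add: gmap_def ginv_def)

lemma ginv_gmap: "B \<noteq> 0 \<Longrightarrow> ginv A B (gmap A B p) = p"
  by (cases p) (simp add: gmap_def ginv_def)

lemma ginv_diff:
  "ginv A B p - ginv A B q = (snd (p - q) - of_int A * fst (p - q) / of_int B, - fst (p - q) / of_int B)"
  by (simp add: ginv_def prod_eq_iff add_divide_distrib diff_divide_distrib algebra_simps)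

lemma continuous_on_gmap: "continuous_on X (gmap A B)"
  unfolding gmap_def[abs_def] by (intro continuous_intros)

locale tile_gauge = gauge N lam c0 c1 for N :: "real \<times> real \<Rightarrow> real" and lam c0 c1 +
  fixes A B :: int
  assumes B_ge_2: "2 \<le> B" and contraction_ginv: "contraction (ginv A B)"
begin

abbreviation "g \<equiv> gmap A B"
abbreviation "gi \<equiv> ginv A B"

lemma g_gi [simp]: "g (gi x) = x" and gi_g [simp]: "gi (g x) = x"
  using B_ge_2 by (auto simp: gmap_ginv ginv_gmap)

lemma g_inj: "g x = g y \<Longrightarrow> x = y" by (metis gi_g)

lemma inj_gi: "inj gi" by (rule inj_on_inverseI[of _ g]) simp

lemma eq_gi_iff: "x = gi y \<longleftrightarrow> g x = y" by auto

lemma mem_gi_image: "x \<in> gi ` X \<longleftrightarrow> g x \<in> X"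
  by (rule mem_image_inverse) simp_all

lemma mem_g_image: "x \<in> g ` X \<longleftrightarrow> gi x \<in> X"
  by (rule mem_image_inverse) simp_all

lemma continuous_on_gi: "continuous_on X gi"
  by (rule contraction_continuous[OF contraction_ginv])

end

definition weighted_norm :: "real \<times> real \<Rightarrow> real" where
  "weighted_norm v = \<bar>fst v\<bar> + 3/2 * \<bar>snd v\<bar>"

lemma gauge_weighted_norm:
  assumes "0 \<le> lam" "lam < 1" shows "gauge weighted_norm lam 1 (5/2)"
proof
  fix v w
  have "norm v \<le> \<bar>fst v\<bar> + \<bar>snd v\<bar>" using norm_Pair_le[of "fst v" "snd v"] by simp
  then show "1 * norm v \<le> weighted_norm v" by (simp add: weighted_norm_def)
  have "\<bar>fst v\<bar> \<le> norm v" "\<bar>snd v\<bar> \<le> norm v"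
    using norm_fst_le[of "fst v" "snd v"] norm_snd_le[of "snd v" "fst v"] by auto
  then show "weighted_norm v \<le> 5/2 * norm v" unfolding weighted_norm_def by linarith
  show "weighted_norm (v + w) \<le> weighted_norm v + weighted_norm w"
    using abs_triangle_ineq[of "fst v" "fst w"] abs_triangle_ineq[of "snd v" "snd w"]
    unfolding weighted_norm_def fst_add snd_add by linarith
qed (use assms in \<open>auto simp: weighted_norm_def\<close>)

lemma weighted_norm_ginv:
  assumes B: "2 \<le> B" and A: "\<bar>A\<bar> \<le> B - 2"
  shows "weighted_norm (ginv A B p - ginv A B q) \<le> (1 - 1 / (2 * of_int B)) * weighted_norm (p - q)"
proof -
  define a b where "a = real_of_int A" and "b = real_of_int B"
  have b: "2 \<le> b" and a: "\<bar>a\<bar> \<le> b - 2" using assms by (simp_all add: a_def b_def flip: of_int_abs)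
  define lam where "lam = 1 - 1 / (2 * b)"
  define u v where "u = fst (p - q)" and "v = snd (p - q)"
  have "weighted_norm (ginv A B p - ginv A B q) = \<bar>v - a * u / b\<bar> + 3/2 * (\<bar>u\<bar> / b)"
    unfolding ginv_diff weighted_norm_def u_def v_def a_def b_def using B by (simp add: abs_divide)
  also have "\<bar>v - a * u / b\<bar> \<le> \<bar>v\<bar> + \<bar>a\<bar> * \<bar>u\<bar> / b"
    using abs_triangle_ineq4[of v "a * u / b"] b by (simp add: abs_mult abs_divide)
  also have "\<bar>a\<bar> * \<bar>u\<bar> / b \<le> (b - 2) * \<bar>u\<bar> / b" using a b by (intro divide_right_mono mult_right_mono) auto
  finally have "weighted_norm (ginv A B p - ginv A B q) \<le> \<bar>v\<bar> + ((b - 2) * \<bar>u\<bar> / b + 3/2 * (\<bar>u\<bar> / b))" by simp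
  also have "(b - 2) * \<bar>u\<bar> / b + 3/2 * (\<bar>u\<bar> / b) = lam * \<bar>u\<bar>" using b by (simp add: lam_def field_simps)
  also have "\<bar>v\<bar> + lam * \<bar>u\<bar> \<le> lam * weighted_norm (p - q)"
  proof -
    have "2/3 \<le> lam" using b by (simp add: lam_def field_simps)
    then have "1 * \<bar>v\<bar> \<le> (3/2 * lam) * \<bar>v\<bar>" by (intro mult_right_mono) auto
    then show ?thesis by (simp add: weighted_norm_def u_def v_def algebra_simps)
  qed
  finally show ?thesis unfolding lam_def b_def .
qed

lemma tile_gauge_weighted:
  assumes B: "2 \<le> B" and A: "\<bar>A\<bar> \<le> B - 2"
  shows "tile_gauge weighted_norm (1 - 1 / (2 * of_int B)) 1 (5/2) A B"
proof -
  interpret gauge weighted_norm "1 - 1 / (2 * of_int B)" 1 "5/2"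
    by (rule gauge_weighted_norm) (use B in \<open>auto simp: field_simps\<close>)
  have "contraction (ginv A B)" unfolding contraction_def using weighted_norm_ginv[OF B A] by blast
  then show ?thesis using B by unfold_locales
qed

lemma norm_complete_square:
  assumes d: "d\<^sup>2 = 4 * b - a\<^sup>2"
  shows "(norm (Complex (x - a/2 * y) (d/2 * y)))\<^sup>2 = x\<^sup>2 - a * x * y + b * y\<^sup>2"
proof -
  have "(norm (Complex (x - a/2 * y) (d/2 * y)))\<^sup>2 = (x - a/2 * y)\<^sup>2 + d\<^sup>2 * y\<^sup>2 / 4"
    by (simp add: cmod_power2 power_mult_distrib power_divide)
  also have "d\<^sup>2 * y\<^sup>2 / 4 = b * y\<^sup>2 - (a/2 * y)\<^sup>2" unfolding d by (simp add: power2_eq_square field_simps)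
  finally show ?thesis by (simp add: power2_eq_square algebra_simps)
qed

text \<open>The characteristic polynomial has complex roots; in suitable coordinates \<open>ginv A B\<close> is a similarity with
  ratio \<open>1 / sqrt B\<close>.\<close>

lemma tile_gauge_similarity:
  assumes B: "2 \<le> B" and A: "A * A < 4 * B"
  shows "\<exists>N c0 c1. tile_gauge N (1 / sqrt (of_int B)) c0 c1 A B"
proof -
  define a b where "a = real_of_int A" and "b = real_of_int B"
  have b: "2 \<le> b" using B by (simp add: b_def)
  have "a\<^sup>2 < 4 * b" using A
    unfolding a_def b_def power2_eq_square by (metis of_int_less_iff of_int_mult of_int_numeral)
  define d where "d = sqrt (4 * b - a\<^sup>2)"
  have d: "0 < d" "d\<^sup>2 = 4 * b - a\<^sup>2" using \<open>a\<^sup>2 < 4 * b\<close> by (auto simp: d_def)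
  define L :: "real \<times> real \<Rightarrow> complex" where "L v = Complex (fst v - a/2 * snd v) (d/2 * snd v)" for v
  have L: "linear L" by (rule linearI) (simp_all add: L_def complex_eq_iff algebra_simps)
  moreover have "inj L" using d by (auto simp: L_def inj_def)
  ultimately obtain c0 c1 where c01: "0 < c0" "\<And>v. c0 * norm v \<le> norm (L v)" "0 < c1" "\<And>v. norm (L v) \<le> c1 * norm v"
    by (metis linear_inj_bounded_below_pos linear_bounded_pos)
  have norm_L: "(norm (L v))\<^sup>2 = (fst v)\<^sup>2 - a * fst v * snd v + b * (snd v)\<^sup>2" for v
    unfolding L_def by (rule norm_complete_square[OF d(2)])
  interpret gauge "\<lambda>v. norm (L v)" "1 / sqrt b" c0 c1
    by unfold_locales (use b c01 in \<open>auto simp: linear_add[OF L] linear_neg[OF L] norm_triangle_ineq\<close>)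
  have "contraction (ginv A B)" unfolding contraction_def
  proof (intro allI)
    fix p q :: "real \<times> real"
    define u v where "u = fst (p - q)" and "v = snd (p - q)"
    have "(norm (L (ginv A B p - ginv A B q)))\<^sup>2 =
        (v - a * u / b)\<^sup>2 - a * (v - a * u / b) * (- u / b) + b * (- u / b)\<^sup>2"
      unfolding norm_L ginv_diff u_def v_def a_def b_def by simp
    also have "\<dots> = (u\<^sup>2 - a * u * v + b * v\<^sup>2) / b" using b by (simp add: power2_eq_square field_simps)
    also have "\<dots> = (1 / sqrt b * norm (L (p - q)))\<^sup>2"
      unfolding power_mult_distrib norm_L using b by (simp add: u_def v_def power_divide)
    finally show "norm (L (ginv A B p - ginv A B q)) \<le> 1 / sqrt b * norm (L (p - q))"
      using b by (simp add: power2_eq_iff_nonneg)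
  qed
  then have "tile_gauge (\<lambda>v. norm (L v)) (1 / sqrt b) c0 c1 A B" using B by unfold_locales
  then show ?thesis unfolding b_def by blast
qed

lemma tile_gauge_exists:
  assumes "2 \<le> B" "\<bar>A\<bar> \<le> B - 2 \<or> A * A < 4 * B"
  shows "\<exists>N lam c0 c1. tile_gauge N lam c0 c1 A B"
  using assms tile_gauge_weighted tile_gauge_similarity by blast

definition lv :: "int \<Rightarrow> int \<Rightarrow> real \<times> real" where "lv p q = (of_int p, of_int q)"

lemma lv_simps [simp]: "lv 0 0 = 0" "fst (lv p q) = of_int p" "snd (lv p q) = of_int q"
  by (simp_all add: lv_def zero_prod_def)

lemma lv_add: "lv (p + p') (q + q') = lv p q + lv p' q'" and lv_diff: "lv (p - p') (q - q') = lv p q - lv p' q'"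
  and lv_minus: "lv (- p) (- q) = - lv p q"
  by (simp_all add: lv_def)

lemma gmap_diff_lv: "gmap A B (x - lv p q) = gmap A B x - lv (- B * q) (p - A * q)"
  by (simp add: gmap_def lv_def prod_eq_iff algebra_simps)

lemma gmap_minus: "gmap A B (- x) = lv (B - 1) 0 - gmap A B x"
  by (simp add: gmap_def lv_def prod_eq_iff field_simps)

lemma tr_a_pow: "tr_a ^^ k = (\<lambda>p. p + lv (int k) 0)"
  by (induction k) (auto simp: tr_a_def lv_def fun_eq_iff prod_eq_iff)

lemma rot_c_eq: "rot_c = uminus"
  by (auto simp: rot_c_def fun_eq_iff prod_eq_iff)

lemma digits_eq:
  assumes "2 \<le> B" shows "digits B = (\<lambda>k p. p + lv k 0) ` {0..B-2} \<union> {uminus}"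
proof (cases "3 \<le> B")
  case True
  have "{0..B-2} = int ` {..nat (B - 2)}" using True by (simp add: atMost_atLeast0 image_int_atLeastAtMost)
  then have "(\<lambda>k p. p + lv k 0) ` {0..B-2} = (\<lambda>k. tr_a ^^ k) ` {..nat (B - 2)}"
    by (simp add: image_image tr_a_pow)
  then show ?thesis using True by (auto simp: digits_def rot_c_eq)
next
  case False
  then have "B = 2" using assms by simp
  then show ?thesis by (auto simp: digits_def rot_c_eq fun_eq_iff id_def)
qed

context tile_gauge
begin

lemma tile_properties: "compact (tile A B)" "tile A B \<noteq> {}" "g ` tile A B = (\<Union>\<delta>\<in>digits B. \<delta> ` tile A B)"
proof -
  define fs where "fs = (\<lambda>\<delta>. gi \<circ> \<delta>) ` digits B"
  have contr: "contraction f" if "f \<in> fs" for f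
  proof -
    obtain \<delta> where \<delta>: "\<delta> \<in> digits B" "f = gi \<circ> \<delta>" using \<open>f \<in> fs\<close> unfolding fs_def by blast
    have "N (\<delta> p - \<delta> q) \<le> N (p - q)" for p q
      using \<delta>(1) N_minus[of "p - q"] by (auto simp: digits_eq[OF B_ge_2])
    then show ?thesis unfolding \<delta>(2) o_def by (rule contraction_comp[OF contraction_ginv])
  qed
  have fixed: "g ` X = (\<Union>\<delta>\<in>digits B. \<delta> ` X) \<longleftrightarrow> X = hutchinson fs X" for X
  proof -
    have "hutchinson fs X = gi ` (\<Union>\<delta>\<in>digits B. \<delta> ` X)" by (auto simp: hutchinson_def fs_def image_UN image_comp)
    moreover have "gi ` g ` X = X" "g ` gi ` Y = Y" for Y by (simp_all add: image_image)
    ultimately show ?thesis by metis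
  qed
  have "finite fs" "fs \<noteq> {}" unfolding fs_def digits_eq[OF B_ge_2] using B_ge_2 by auto
  then have "\<exists>X. compact X \<and> X \<noteq> {} \<and> X = hutchinson fs X" using attractor_exists contr by blast
  then have "\<exists>!X. compact X \<and> X \<noteq> {} \<and> X = hutchinson fs X"
    using attractor_unique contr by (intro ex_ex1I) blast+
  from theI'[OF this] show "compact (tile A B)" "tile A B \<noteq> {}" "g ` tile A B = (\<Union>\<delta>\<in>digits B. \<delta> ` tile A B)"
    unfolding tile_def fixed by auto
qed

lemma mem_tile_iff: "x \<in> tile A B \<longleftrightarrow> (\<exists>k\<in>{0..B-2}. g x - lv k 0 \<in> tile A B) \<or> - g x \<in> tile A B"
proof -
  have shift: "y \<in> (\<lambda>p. p + v) ` X \<longleftrightarrow> y - v \<in> X" for y v and X :: "(real \<times> real) set"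
    by (rule mem_image_inverse) simp_all
  have "x \<in> tile A B \<longleftrightarrow> g x \<in> g ` tile A B" by (simp add: mem_g_image)
  also have "\<dots> \<longleftrightarrow> (\<exists>k\<in>{0..B-2}. g x \<in> (\<lambda>p. p + lv k 0) ` tile A B) \<or> g x \<in> uminus ` tile A B"
    unfolding tile_properties(3) digits_eq[OF B_ge_2] by auto
  finally show ?thesis unfolding shift mem_uminus_image .
qed

end

section \<open>Bounded integer recurrences\<close>

locale bounded_recurrence =
  fixes A B Q :: int and q k :: "nat \<Rightarrow> int"
  assumes A: "1 \<le> A" "A \<le> B" and B: "2 \<le> B" "2 * A < B + 3"
    and digit: "\<And>n. \<bar>k n\<bar> \<le> B - 1" and bound: "\<And>n. \<bar>q n\<bar> \<le> Q" and start: "q 0 = Q"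
    and rec: "\<And>n. q (Suc (Suc n)) = k n - A * q (Suc n) - B * q n"
begin

lemma rec_first: "q 2 = k 0 - A * q 1 - B * Q" and rec_second: "q 3 = k 1 - A * q 2 - B * q 1"
  and rec_third: "q 4 = k 2 - A * q 3 - B * q 2"
  using rec[of 0] rec[of 1] rec[of 2] start by (simp_all add: eval_nat_numeral)

context
  assumes Q: "2 \<le> Q"
begin

lemma q1_negative: "q 1 \<le> -1"
proof -
  have "A * q 1 \<le> B - 1 - B * Q + Q" using rec_first digit[of 0] bound[of 2] unfolding abs_le_iff by linarith
  moreover have "0 \<le> (B - 1) * (Q - 2)" using B Q by simp
  ultimately have "A * q 1 < 0" using B(1) by (simp add: algebra_simps)
  then show ?thesis using A(1) by (simp add: mult_less_0_iff)
qed

lemma eliminated_q2: "Q * (A * B - 1) \<le> (A + 1) * (B - 1) + (A * A - B) * (- q 1)"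
proof -
  have "q 2 \<le> B - 1 - B * Q - A * q 1" using rec_first digit[of 0] unfolding abs_le_iff by linarith
  then have "A * q 2 \<le> A * (B - 1 - B * Q - A * q 1)" using A(1) by (intro mult_left_mono) auto
  moreover have "- B * q 1 - (B - 1) - Q \<le> A * q 2"
    using rec_second digit[of 1] bound[of 3] unfolding abs_le_iff by linarith
  ultimately show ?thesis by (simp add: algebra_simps)
qed

lemma B_less_A_square: "B < A * A"
proof (rule ccontr)
  assume "\<not> B < A * A"
  then have "(B - A * A) * 1 \<le> (B - A * A) * (- q 1)" using q1_negative by (intro mult_left_mono) auto
  moreover have "1 * 1 \<le> A * B" using A B by (intro mult_mono) auto
  then have "2 * (A * B - 1) \<le> Q * (A * B - 1)" using Q by (intro mult_right_mono) auto
  ultimately have "A * (B + 1 - A) \<le> 1" using eliminated_q2 by (simp add: algebra_simps)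
  moreover have "1 * 1 \<le> A * (B + 1 - A)" using A by (intro mult_mono) auto
  ultimately have "A * (B + 1 - A) = 1" by simp
  then have "A = 1" "B + 1 - A = 1" using A by (auto simp: zmult_eq_1_iff)
  then show False using B by simp
qed

lemma Q_bound: "Q * ((A + 1) * (B - A + 1) - 2) \<le> (A + 1) * (B - 1)"
proof -
  have "(A * A - B) * (- q 1) \<le> (A * A - B) * Q"
    using B_less_A_square bound[of 1] by (intro mult_left_mono) auto
  then show ?thesis using eliminated_q2 by (simp add: algebra_simps)
qed

lemma exceptional_coefficients: "A = 2 \<and> B = 2 \<or> A = 3 \<and> B = 4"
proof -
  have "2 * 1 \<le> (A + 1) * (B - A + 1)" using A by (intro mult_mono) auto
  then have "2 * ((A + 1) * (B - A + 1) - 2) \<le> Q * ((A + 1) * (B - A + 1) - 2)"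
    using Q by (intro mult_right_mono) auto
  then have small: "(A + 1) * (B - 2 * A + 3) \<le> 4" using Q_bound by (simp add: algebra_simps)
  moreover have "(A + 1) * 1 \<le> (A + 1) * (B - 2 * A + 3)" using A B by (intro mult_left_mono) auto
  ultimately have "A \<le> 3" by simp
  moreover have "A \<noteq> 1" using B_less_A_square B by auto
  ultimately have "A = 2 \<or> A = 3" using A(1) by auto
  then show ?thesis using small B by auto
qed

lemma coefficients_not_2_2: "\<not> (A = 2 \<and> B = 2)"
proof
  assume "A = 2 \<and> B = 2"
  then have "q 4 = k 2 - 2 * k 1 + 2 * k 0 - 4 * Q" and k: "\<bar>k n\<bar> \<le> 1" for n
    using rec_first rec_second rec_third digit[of n] by auto
  then show False using bound[of 4] k[of 0] k[of 1] k[of 2] Q unfolding abs_le_iff by linarith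
qed

lemma coefficients_not_3_4: "\<not> (A = 3 \<and> B = 4)"
proof
  assume A_B: "A = 3 \<and> B = 4"
  then have "Q = 2" using Q_bound Q by simp
  then have "q 1 = -2" using eliminated_q2 bound[of 1] A_B by simp
  have k: "\<bar>k 0\<bar> \<le> 3" "\<bar>k 1\<bar> \<le> 3" "\<bar>k 2\<bar> \<le> 3" using digit A_B by auto
  have "q 2 = k 0 - 2" "q 3 = k 1 - 3 * q 2 + 8" "q 4 = k 2 - 3 * q 3 - 4 * q 2"
    using rec_first rec_second rec_third A_B \<open>Q = 2\<close> \<open>q 1 = -2\<close> by simp_all
  then show False using k bound[of 3] bound[of 4] \<open>Q = 2\<close> unfolding abs_le_iff by linarith
qed

end

lemma Q_le_1: "Q \<le> 1"
  using exceptional_coefficients coefficients_not_2_2 coefficients_not_3_4 by force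

end

locale neighbour_graph =
  fixes A B :: int and V :: "(int \<times> int) set"
  assumes A: "1 \<le> A" "A \<le> B" and B: "2 \<le> B" "2 * A < B + 3"
    and finite_V: "finite V" and minus_V: "\<And>p q. (p, q) \<in> V \<Longrightarrow> (- p, - q) \<in> V"
    and step_V: "\<And>p q. (p, q) \<in> V \<Longrightarrow> \<exists>k. \<bar>k\<bar> \<le> B - 1 \<and> (k - B * q, p - A * q) \<in> V"
begin

lemma walk_exists:
  assumes "v \<in> V"
  obtains w k where "w 0 = v" "\<And>n. w n \<in> V" "\<And>n. \<bar>k n\<bar> \<le> B - 1"
    "\<And>n. w (Suc n) = (k n - B * snd (w n), fst (w n) - A * snd (w n))"
proof -
  have "\<exists>w. \<forall>n. (w n \<in> V \<and> (n = 0 \<longrightarrow> w n = v)) \<and>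
      (\<exists>k. \<bar>k\<bar> \<le> B - 1 \<and> w (Suc n) = (k - B * snd (w n), fst (w n) - A * snd (w n)))"
  proof (rule dependent_nat_choice)
    fix u and n :: nat assume "u \<in> V \<and> (n = 0 \<longrightarrow> u = v)"
    then obtain k where "\<bar>k\<bar> \<le> B - 1" "(k - B * snd u, fst u - A * snd u) \<in> V"
      using step_V[of "fst u" "snd u"] by auto
    then show "\<exists>u'. (u' \<in> V \<and> (Suc n = 0 \<longrightarrow> u' = v)) \<and>
        (\<exists>k. \<bar>k\<bar> \<le> B - 1 \<and> u' = (k - B * snd u, fst u - A * snd u))" by blast
  qed (use assms in blast)
  then obtain w where w: "w 0 = v" "\<And>n. w n \<in> V"
    and "\<forall>n. \<exists>k. \<bar>k\<bar> \<le> B - 1 \<and> w (Suc n) = (k - B * snd (w n), fst (w n) - A * snd (w n))" by blast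
  then obtain k where "\<And>n. \<bar>k n\<bar> \<le> B - 1" "\<And>n. w (Suc n) = (k n - B * snd (w n), fst (w n) - A * snd (w n))"
    by metis
  then show thesis using that w by blast
qed

lemma second_component_bound:
  assumes "(p, q) \<in> V" shows "\<bar>q\<bar> \<le> 1"
proof -
  define Q where "Q = Max ((\<lambda>v. \<bar>snd v\<bar>) ` V)"
  have le_Q: "\<bar>snd v\<bar> \<le> Q" if "v \<in> V" for v unfolding Q_def using finite_V that by (intro Max_ge) auto
  have "Q \<in> (\<lambda>v. \<bar>snd v\<bar>) ` V" unfolding Q_def using finite_V assms by (intro Max_in) auto
  then obtain p' q' where "(p', q') \<in> V" "Q = \<bar>q'\<bar>" by force
  then have "(p', Q) \<in> V \<or> (- p', Q) \<in> V" using minus_V[of p' q'] by (cases "0 \<le> q'") auto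
  then obtain v where v: "v \<in> V" "snd v = Q" by force
  obtain w k where w: "w 0 = v" "\<And>n. w n \<in> V" "\<And>n. \<bar>k n\<bar> \<le> B - 1"
    "\<And>n. w (Suc n) = (k n - B * snd (w n), fst (w n) - A * snd (w n))"
    using walk_exists[OF v(1)] by blast
  interpret bounded_recurrence A B Q "\<lambda>n. snd (w n)" k
    by unfold_locales (use A B w v le_Q in auto)
  show ?thesis using Q_le_1 le_Q[OF assms] by simp
qed

lemma vertex_cases:
  assumes "(p, q) \<in> V"
  shows "q = 0 \<and> \<bar>p\<bar> \<le> 1 \<or> q = 1 \<and> (p = A \<or> p = A - 1) \<or> q = -1 \<and> (p = - A \<or> p = 1 - A)"
proof -
  define r where "r = p - A * q"
  obtain k where k: "\<bar>k\<bar> \<le> B - 1" "(k - B * q, r) \<in> V" using step_V[OF assms] by (auto simp: r_def)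
  obtain k' where "(k' - B * r, k - B * q - A * r) \<in> V" using step_V[OF k(2)] by blast
  then have "\<bar>q\<bar> \<le> 1" "\<bar>r\<bar> \<le> 1" "\<bar>k - B * q - A * r\<bar> \<le> 1"
    using second_component_bound assms k(2) by blast+
  moreover from this have "\<not> (q = 1 \<and> r = 1)" "\<not> (q = -1 \<and> r = -1)" using k(1) A by auto
  ultimately have "q = 0 \<or> q = 1 \<and> r \<in> {-1, 0} \<or> q = -1 \<and> r \<in> {0, 1}" by auto
  then show ?thesis using \<open>\<bar>r\<bar> \<le> 1\<close> by (auto simp: r_def)
qed

end

section \<open>The lattice tile and its neighbours\<close>

locale lattice_tile = tile_gauge +
  fixes S :: "(real \<times> real) set"
  assumes S_compact: "compact S" and S_ne: "S \<noteq> {}" and S_sym: "\<And>x. x \<in> S \<Longrightarrow> - x \<in> S"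
    and S_rec: "\<And>x. x \<in> S \<longleftrightarrow> (\<exists>k\<in>{0..B-1}. gmap A B x - lv k 0 \<in> S)"
begin

definition inS :: "real \<times> real \<Rightarrow> int \<Rightarrow> int \<Rightarrow> bool" where "inS x p q \<longleftrightarrow> x - lv p q \<in> S"

lemma inS_00 [simp]: "inS x 0 0 \<longleftrightarrow> x \<in> S" by (simp add: inS_def)

lemma inS_rec: "inS x p q \<longleftrightarrow> (\<exists>k\<in>{0..B-1}. inS (g x) (k - B * q) (p - A * q))"
proof -
  have "g (x - lv p q) - lv k 0 = g x - lv (k - B * q) (p - A * q)" for k
    unfolding gmap_diff_lv by (simp add: lv_def prod_eq_iff)
  then show ?thesis unfolding inS_def by (subst S_rec) simp
qed

lemma inS_shift: "inS (x - lv a b) p q \<longleftrightarrow> inS x (p + a) (q + b)"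
  by (simp add: inS_def lv_add algebra_simps)

lemma inS_plus: "inS (x + lv a b) p q \<longleftrightarrow> inS x (p - a) (q - b)"
  by (simp add: inS_def lv_diff algebra_simps)

lemma inS_minus: "inS (- x) p q \<longleftrightarrow> inS x (- p) (- q)"
proof -
  have "- x - lv p q = - (x - lv (- p) (- q))" by (simp add: lv_minus)
  then show ?thesis unfolding inS_def using S_sym by (metis minus_minus)
qed

lemma inS_reflect: "inS (lv a b - x) p q \<longleftrightarrow> inS x (a - p) (b - q)"
  using inS_plus[of "- x" a b p q] by (simp add: inS_minus)

lemma compact_inS: "compact {x. inS x p q}"
proof -
  have "{x. inS x p q} = (+) (lv p q) ` S"
    using mem_image_inverse[of "\<lambda>x. x - lv p q" "(+) (lv p q)"] by (auto simp: inS_def)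
  then show ?thesis using compact_translation[OF S_compact] by simp
qed

lemma closed_lattice_translates: "closed (\<Union>(p, q)\<in>I. {x. inS x p q})"
proof -
  have "closed ((\<lambda>(p, q). lv p q) ` I)"
  proof (rule discrete_imp_closed[of 1])
    have "lv p q = lv p' q'" if "dist (lv p q) (lv p' q') < 1" for p q p' q'
    proof -
      have "\<bar>real_of_int (p - p')\<bar> < 1" "\<bar>real_of_int (q - q')\<bar> < 1"
        using that dist_fst_le[of "lv p q" "lv p' q'"] dist_snd_le[of "lv p q" "lv p' q'"]
        by (auto simp: dist_real_def)
      then have "p = p'" "q = q'" by linarith+
      then show ?thesis by simp
    qed
    then show "\<forall>x\<in>(\<lambda>(p, q). lv p q) ` I. \<forall>y\<in>(\<lambda>(p, q). lv p q) ` I. dist y x < 1 \<longrightarrow> y = x" by auto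
  qed simp
  from closed_compact_sums[OF this S_compact]
  have "closed (\<Union>v\<in>(\<lambda>(p, q). lv p q) ` I. \<Union>y\<in>S. {v + y})" .
  also have "(\<Union>v\<in>(\<lambda>(p, q). lv p q) ` I. \<Union>y\<in>S. {v + y}) = (\<Union>(p, q)\<in>I. {x. inS x p q})"
    by (force simp: inS_def algebra_simps)
  finally show ?thesis .
qed

lemma gi_in_translate: "inS w p q \<Longrightarrow> \<exists>p' q'. inS (gi w) p' q'"
proof -
  assume w: "inS w p q"
  define r where "r = - (p div B)"
  have "p = p mod B - B * r" by (simp add: r_def)
  moreover have "p mod B \<in> {0..B-1}" using B_ge_2 by (simp add: pos_mod_bound pos_mod_sign le_diff_iff)
  ultimately have "inS (g (gi w)) (p mod B - B * r) (q + A * r - A * r)" "p mod B \<in> {0..B-1}" using w by auto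
  then have "inS (gi w) (q + A * r) r" by (subst inS_rec) blast
  then show ?thesis by blast
qed

lemma near_lattice_point: "\<exists>p q. N (y - lv p q) \<le> c1 * 2"
proof -
  define p q where "p = \<lfloor>fst y\<rfloor>" and "q = \<lfloor>snd y\<rfloor>"
  have "norm (y - lv p q) \<le> \<bar>fst y - p\<bar> + \<bar>snd y - q\<bar>"
    using norm_Pair_le[of "fst (y - lv p q)" "snd (y - lv p q)"]
    unfolding prod.collapse by (simp add: fst_diff snd_diff)
  also have "\<dots> \<le> 2" unfolding p_def q_def by linarith
  finally have "c1 * norm (y - lv p q) \<le> c1 * 2" using c01 by (intro mult_left_mono) auto
  then show ?thesis using N_upper order_trans by blast
qed

lemma lattice_preimages_dense:
  assumes W: "gi ` W \<subseteq> W" and lattice: "\<And>p q. w + lv p q \<in> W"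
  shows "x \<in> closure W"
proof (rule mem_closure_if_pullback[of UNIV W "c1 * 2"])
  fix y :: "real \<times> real"
  obtain p q where "N (y - w - lv p q) \<le> c1 * 2" using near_lattice_point by blast
  then show "\<exists>w\<in>W. N (y - w) \<le> c1 * 2"
    using lattice by (intro bexI[of _ "w + lv p q"]) (simp_all add: algebra_simps)
  have "y \<in> range gi" by (metis gi_g rangeI)
  then show "y \<in> W \<or> (\<exists>f. contraction f \<and> f ` W \<subseteq> W \<and> y \<in> range f)" using contraction_ginv W by blast
qed simp

lemma covering: "\<exists>p q. inS x p q"
proof -
  define W where "W = (\<Union>(p, q)\<in>UNIV. {x. inS x p q})"
  obtain s where s: "s \<in> S" using S_ne by blast
  have "x \<in> closure W"
  proof (rule lattice_preimages_dense)
    show "gi ` W \<subseteq> W" using gi_in_translate by (force simp: W_def)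
    show "s + lv p q \<in> W" for p q 
      using s unfolding W_def by (intro UN_I[of "(p, q)"]) (simp_all add: inS_def)
  qed
  then have "x \<in> W" using closed_lattice_translates[of UNIV] by (simp add: W_def)
  then show ?thesis by (auto simp: W_def)
qed

definition branch :: "int \<Rightarrow> real \<times> real \<Rightarrow> real \<times> real" where
  "branch k x = gi (x + lv k 0)"

lemma contraction_branch: "contraction (branch k)"
  unfolding branch_def[abs_def] by (rule contraction_comp[OF contraction_ginv]) simp

lemma mem_branch_image: "x \<in> branch k ` X \<longleftrightarrow> g x - lv k 0 \<in> X"
  by (rule mem_image_inverse) (simp_all add: branch_def)

lemma subset_S_if_invariant:
  assumes "bounded X" "\<And>x. x \<in> X \<Longrightarrow> \<exists>k\<in>{0..B-1}. g x - lv k 0 \<in> X"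
  shows "X \<subseteq> S"
proof (rule subset_if_pullback[OF assms(1) S_compact S_ne])
  fix x assume "x \<in> X"
  then obtain k where k: "k \<in> {0..B-1}" "x \<in> branch k ` X"
    using assms(2)[OF \<open>x \<in> X\<close>] unfolding mem_branch_image by blast
  have "branch k ` S \<subseteq> S"
  proof
    fix y assume "y \<in> branch k ` S"
    then show "y \<in> S" using k(1) S_rec[of y] by (auto simp: mem_branch_image)
  qed
  then show "x \<in> S \<or> (\<exists>f. contraction f \<and> f ` S \<subseteq> S \<and> x \<in> f ` X)" using contraction_branch k(2) by blast
qed

lemma S_unique:
  assumes Q: "compact Q" "Q \<noteq> {}" and Q_rec: "\<And>x. x \<in> Q \<longleftrightarrow> (\<exists>k\<in>{0..B-1}. gmap A B x - lv k 0 \<in> Q)"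
  shows "Q = S"
proof
  show "Q \<subseteq> S" using subset_S_if_invariant[OF compact_imp_bounded[OF Q(1)]] Q_rec by blast
  show "S \<subseteq> Q"
  proof (rule subset_if_pullback[OF compact_imp_bounded[OF S_compact] Q])
    fix x assume "x \<in> S"
    then obtain k where k: "k \<in> {0..B-1}" "x \<in> branch k ` S" using S_rec[of x] by (auto simp: mem_branch_image)
    have "branch k ` Q \<subseteq> Q"
    proof
      fix y assume "y \<in> branch k ` Q"
      then show "y \<in> Q" using k(1) Q_rec[of y] by (auto simp: mem_branch_image)
    qed
    then show "x \<in> Q \<or> (\<exists>f. contraction f \<and> f ` Q \<subseteq> Q \<and> x \<in> f ` S)" using contraction_branch k(2) by blast
  qed
qed

lemma fixed_point_unique:
  assumes X: "bounded X" "\<And>x. x \<in> X \<Longrightarrow> g x + v \<in> X" and z: "g z + v = z" and x: "x \<in> X"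
  shows "x = z"
proof -
  have contr: "contraction (\<lambda>y. gi (y - v))" by (rule contraction_comp[OF contraction_ginv]) simp
  have "X \<subseteq> {z}"
  proof (rule subset_if_pullback[OF X(1)])
    fix y assume "y \<in> X"
    then have "y \<in> (\<lambda>y. gi (y - v)) ` X" using X(2)[of y] by (intro image_eqI[of _ _ "g y + v"]) auto
    moreover have "z - v = g z" using z by (simp add: algebra_simps)
    then have "(\<lambda>y. gi (y - v)) ` {z} \<subseteq> {z}" by simp
    ultimately show "y \<in> {z} \<or> (\<exists>f. contraction f \<and> f ` {z} \<subseteq> {z} \<and> y \<in> f ` X)" using contr by blast
  qed auto
  then show ?thesis using x by blast
qed

definition nbrs :: "(int \<times> int) set" where "nbrs = {(p, q). \<exists>x. x \<in> S \<and> inS x p q}"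

lemma nbrs_finite: "finite nbrs"
proof -
  obtain R where R: "\<And>x. x \<in> S \<Longrightarrow> norm x \<le> R" using compact_imp_bounded[OF S_compact] by (auto simp: bounded_iff)
  have "nbrs \<subseteq> {- \<lceil>2 * R\<rceil>..\<lceil>2 * R\<rceil>} \<times> {- \<lceil>2 * R\<rceil>..\<lceil>2 * R\<rceil>}"
  proof
    fix v assume "v \<in> nbrs"
    then obtain p q x where v: "v = (p, q)" "x \<in> S" "x - lv p q \<in> S" by (auto simp: nbrs_def inS_def)
    have "norm (lv p q) \<le> norm x + norm (x - lv p q)" using norm_triangle_ineq4[of x "x - lv p q"] by simp
    then have "norm (lv p q) \<le> 2 * R" using R[OF v(2)] R[OF v(3)] by simp
    then have "\<bar>real_of_int p\<bar> \<le> 2 * R" "\<bar>real_of_int q\<bar> \<le> 2 * R"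
      using norm_fst_le[of "real_of_int p" "real_of_int q"] norm_snd_le[of "real_of_int q" "real_of_int p"]
      unfolding lv_def by auto
    then show "v \<in> {- \<lceil>2 * R\<rceil>..\<lceil>2 * R\<rceil>} \<times> {- \<lceil>2 * R\<rceil>..\<lceil>2 * R\<rceil>}" unfolding v(1) by (auto simp: abs_le_iff) linarith+
  qed
  then show ?thesis by (rule finite_subset) simp
qed

lemma inS_nbrs: assumes "inS x p q" "inS x p' q'" shows "(p' - p, q' - q) \<in> nbrs"
proof -
  have "inS (x - lv p q) 0 0" "inS (x - lv p q) (p' - p) (q' - q)" unfolding inS_shift using assms by simp_all
  then show ?thesis unfolding nbrs_def inS_00 by blast
qed

lemma nbrs_minus: assumes "(p, q) \<in> nbrs" shows "(- p, - q) \<in> nbrs"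
proof -
  obtain x where "inS x 0 0" "inS x p q" using assms by (auto simp: nbrs_def)
  then show ?thesis using inS_nbrs[of x p q 0 0] by simp
qed

lemma nbrs_step: assumes "(p, q) \<in> nbrs" shows "\<exists>k. \<bar>k\<bar> \<le> B - 1 \<and> (k - B * q, p - A * q) \<in> nbrs"
proof -
  obtain x where x: "inS x 0 0" "inS x p q" using assms by (auto simp: nbrs_def)
  obtain j where j: "j \<in> {0..B-1}" "inS (g x) j 0" using x(1)[unfolded inS_rec[of x 0 0]] by auto
  obtain k where k: "k \<in> {0..B-1}" "inS (g x) (k - B * q) (p - A * q)"
    using x(2)[unfolded inS_rec[of x p q]] by auto
  have "(k - j - B * q, p - A * q) \<in> nbrs" using inS_nbrs[OF j(2) k(2)] by (simp add: algebra_simps)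
  then show ?thesis using j k by (intro exI[of _ "k - j"]) auto
qed

definition side :: "int \<Rightarrow> int \<Rightarrow> (real \<times> real) set" where
  "side p q = {x. inS x 0 0 \<and> inS x p q}"

lemma compact_side: "compact (side p q)"
proof -
  have "side p q = {x. inS x 0 0} \<inter> {x. inS x p q}" by (auto simp: side_def)
  then show ?thesis using compact_inS compact_Int by metis
qed

lemma side_minus: "- x \<in> side p q \<longleftrightarrow> x \<in> side (- p) (- q)"
  unfolding side_def mem_Collect_eq inS_minus by simp

lemma side_reflect: "lv p q - x \<in> side p q \<longleftrightarrow> x \<in> side p q"
  unfolding side_def mem_Collect_eq inS_reflect by auto

end

text \<open>With six neighbours \<open>\<plusminus>(1, 0)\<close>, \<open>\<plusminus>(A, 1)\<close>, \<open>\<plusminus>(A - 1, 1)\<close> the tile \<open>S\<close> is hexagonal. Its sides \<open>side 1 0\<close>,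
  \<open>side A 1\<close>, \<open>side (A - 1) 1\<close> follow one another, meeting in \<open>vertex1\<close> and \<open>vertex2\<close>.\<close>

locale six_neighbour_tile = lattice_tile +
  assumes A_ge_1: "1 \<le> A" and A_le_B: "A \<le> B" and A_bound: "2 * A < B + 3"
begin

lemma neighbours:
  assumes "inS x p q" "inS x p' q'"
  shows "q' - q = 0 \<and> \<bar>p' - p\<bar> \<le> 1 \<or> q' - q = 1 \<and> (p' - p = A \<or> p' - p = A - 1) \<or>
    q' - q = -1 \<and> (p' - p = - A \<or> p' - p = 1 - A)"
proof -
  interpret neighbour_graph A B nbrs
    by unfold_locales (use A_ge_1 A_le_B A_bound B_ge_2 nbrs_finite nbrs_minus nbrs_step in auto)
  show ?thesis using vertex_cases[OF inS_nbrs[OF assms]] .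
qed

lemma row_neighbours: "inS x p q \<Longrightarrow> inS x p' q \<Longrightarrow> \<bar>p' - p\<bar> \<le> 1"
  using neighbours[of x p q p' q] by auto

lemma zero_only: assumes "inS 0 p q" shows "p = 0 \<and> q = 0"
proof -
  have "inS 0 (- p) (- q)" using assms inS_minus[of 0 p q] by simp
  from neighbours[OF this assms] show ?thesis by presburger
qed

definition vertex1 :: "real \<times> real" where
  "vertex1 =
    (of_int (A + 1) * (of_int (B + 1) / (2 * of_int (A + B + 1))), of_int (B + 1) / (2 * of_int (A + B + 1)))"

definition vertex2 :: "real \<times> real" where
  "vertex2 = lv A 1 - vertex1"

lemma g_vertex1: "g vertex1 = vertex1 - lv 1 0"
proof -
  define a b y where "a = real_of_int A" and "b = real_of_int B" and "y = (b + 1) / (2 * (a + b + 1))"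
  have v: "vertex1 = ((a + 1) * y, y)" by (simp add: vertex1_def a_def b_def y_def)
  have "0 < a + b + 1" using A_ge_1 B_ge_2 by (simp add: a_def b_def add_pos_pos)
  then have "y * (2 * (a + b + 1)) = b + 1" by (simp add: y_def)
  then have "a * y + b * y + y = (b + 1) / 2" by (simp add: algebra_simps)
  then have "- b * y + (b - 1) / 2 = (a + 1) * y - 1" by (simp add: distrib_right field_simps)
  moreover have "(a + 1) * y - a * y = y" by (simp add: algebra_simps)
  ultimately show ?thesis unfolding v by (simp add: gmap_def lv_def prod_eq_iff flip: a_def b_def)
qed

lemma g_vertex1_left: "g (vertex1 - lv 1 0) = vertex1 - lv 1 1"
  unfolding gmap_diff_lv g_vertex1 by (simp add: lv_def prod_eq_iff)

lemma g_vertex2: "g vertex2 = - vertex1"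
proof -
  have "vertex2 = - (vertex1 - lv A 1)" by (simp add: vertex2_def)
  then have "g vertex2 = lv (B - 1) 0 - g (vertex1 - lv A 1)" by (simp only: gmap_minus)
  also have "\<dots> = - vertex1" unfolding gmap_diff_lv g_vertex1 by (simp add: lv_def prod_eq_iff)
  finally show ?thesis .
qed

lemma gi_vertex:
  "gi (vertex1 - lv 1 0) = vertex1" "gi (vertex1 - lv 1 1) = vertex1 - lv 1 0" "gi (- vertex1) = vertex2"
  by (metis g_vertex1 gi_g, metis g_vertex1_left gi_g, metis g_vertex2 gi_g)

lemma vertex1_mem: "inS vertex1 0 0" "inS vertex1 1 0" "inS vertex1 A 1"
proof -
  define orbit where "orbit = {vertex1, vertex1 - lv 1 0, vertex1 - lv A 1}"
  have cycle: "g vertex1 - lv 0 0 = vertex1 - lv 1 0"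
      "g (vertex1 - lv 1 0) - lv (A - 1) 0 = vertex1 - lv A 1" "g (vertex1 - lv A 1) - lv (B - 1) 0 = vertex1"
    unfolding gmap_diff_lv g_vertex1 by (simp_all add: lv_def prod_eq_iff)
  have "orbit \<subseteq> S"
  proof (rule subset_S_if_invariant)
    fix x assume "x \<in> orbit"
    then have "\<exists>k\<in>{0, A - 1, B - 1}. g x - lv k 0 \<in> orbit" using cycle by (auto simp: orbit_def)
    moreover have "{0, A - 1, B - 1} \<subseteq> {0..B-1}" using A_ge_1 A_le_B by auto
    ultimately show "\<exists>k\<in>{0..B-1}. g x - lv k 0 \<in> orbit" by blast
  qed (simp add: orbit_def)
  then show "inS vertex1 0 0" "inS vertex1 1 0" "inS vertex1 A 1" by (simp_all add: orbit_def inS_def)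
qed

lemma vertex2_mem: "inS vertex2 0 0" "inS vertex2 (A - 1) 1" "inS vertex2 A 1"
  unfolding vertex2_def inS_reflect using vertex1_mem by simp_all

lemma mem_side_upper: "x \<in> side A 1 \<longleftrightarrow> inS (g x) 0 0 \<and> inS (g x) (-1) 0"
proof
  assume "x \<in> side A 1"
  then have x: "inS x 0 0" "inS x A 1" by (auto simp: side_def)
  obtain k where k: "k \<in> {0..B-1}" "inS (g x) k 0" using inS_rec[of x 0 0] x(1) by auto
  obtain n where n: "n \<in> {0..B-1}" "inS (g x) (n - B) 0" using inS_rec[of x A 1] x(2) by auto
  have "k = 0" "n - B = -1" using row_neighbours[OF n(2) k(2)] k(1) n(1) by auto
  then show "inS (g x) 0 0 \<and> inS (g x) (-1) 0" using k n by simp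
next
  assume gx: "inS (g x) 0 0 \<and> inS (g x) (-1) 0"
  have "inS (g x) (0 - B * 0) (0 - A * 0)" "0 \<in> {0..B-1}" using gx B_ge_2 by auto
  then have "inS x 0 0" using inS_rec[of x 0 0] by blast
  moreover have "inS (g x) (B - 1 - B * 1) (A - A * 1)" "B - 1 \<in> {0..B-1}" using gx B_ge_2 by auto
  then have "inS x A 1" using inS_rec[of x A 1] by blast
  ultimately show "x \<in> side A 1" by (simp add: side_def)
qed

lemma mem_side_upper_shift: "x \<in> side A 1 \<longleftrightarrow> g x + lv 1 0 \<in> side 1 0"
  unfolding mem_side_upper by (auto simp: side_def inS_plus simp del: inS_00)

lemma mem_side_upper_minus: "x \<in> side A 1 \<longleftrightarrow> - g x \<in> side 1 0"
  unfolding mem_side_upper by (auto simp: side_minus) (auto simp: side_def)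

lemma vertex1_unique:
  assumes "inS x 0 0" "inS x 1 0" "inS x A 1" shows "x = vertex1"
proof (rule fixed_point_unique[of "side 1 0 \<inter> side A 1" "lv 1 0" vertex1])
  show "bounded (side 1 0 \<inter> side A 1)" using compact_side compact_imp_bounded by blast
  show "g vertex1 + lv 1 0 = vertex1" using g_vertex1 by simp
  show "x \<in> side 1 0 \<inter> side A 1" using assms by (simp add: side_def)
  fix y assume y: "y \<in> side 1 0 \<inter> side A 1"
  then have gy: "inS (g y) 0 0" "inS (g y) (-1) 0" using mem_side_upper by auto
  obtain j where j: "inS (g y) j 1" using y inS_rec[of y 1 0] by (auto simp: side_def)
  have "j = A - 1" using neighbours[OF gy(1) j] neighbours[OF gy(2) j] by auto
  then show "g y + lv 1 0 \<in> side 1 0 \<inter> side A 1" using gy j by (simp add: side_def inS_plus del: inS_00)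
qed

lemma vertex2_unique:
  assumes "inS x 0 0" "inS x (A - 1) 1" "inS x A 1" shows "x = vertex2"
proof -
  have "lv A 1 - x = vertex1" by (rule vertex1_unique) (unfold inS_reflect, use assms in simp_all)
  then show ?thesis unfolding vertex2_def by (simp add: algebra_simps)
qed

end

section \<open>The crystallographic tile as half of the lattice tile\<close>

locale half_tile = lattice_tile +
  fixes T :: "(real \<times> real) set"
  assumes T_compact: "compact T" and S_T: "\<And>x. x \<in> S \<longleftrightarrow> x \<in> T \<or> - x \<in> T"
begin

definition inT :: "real \<times> real \<Rightarrow> int \<Rightarrow> int \<Rightarrow> bool" where "inT x p q \<longleftrightarrow> x - lv p q \<in> T"

definition inU :: "real \<times> real \<Rightarrow> int \<Rightarrow> int \<Rightarrow> bool" where "inU x p q \<longleftrightarrow> lv p q - x \<in> T"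

lemma inT_00 [simp]: "inT x 0 0 \<longleftrightarrow> x \<in> T" and inU_00 [simp]: "inU x 0 0 \<longleftrightarrow> - x \<in> T"
  by (simp_all add: inT_def inU_def)

lemma inS_iff: "inS x p q \<longleftrightarrow> inT x p q \<or> inU x p q"
  unfolding inS_def inT_def inU_def S_T by (simp only: minus_diff_eq)

lemma inT_inS: "inT x p q \<Longrightarrow> inS x p q" and inU_inS: "inU x p q \<Longrightarrow> inS x p q" by (auto simp: inS_iff)

lemma inT_shift: "inT (x - lv a b) p q \<longleftrightarrow> inT x (p + a) (q + b)"
  and inU_shift: "inU (x - lv a b) p q \<longleftrightarrow> inU x (p + a) (q + b)"
  by (simp_all add: inT_def inU_def lv_add algebra_simps)

lemma inT_plus: "inT (x + lv a b) p q \<longleftrightarrow> inT x (p - a) (q - b)"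
  and inU_plus: "inU (x + lv a b) p q \<longleftrightarrow> inU x (p - a) (q - b)"
  by (simp_all add: inT_def inU_def lv_diff algebra_simps)

lemma inT_minus: "inT (- x) p q \<longleftrightarrow> inU x (- p) (- q)" and inU_minus: "inU (- x) p q \<longleftrightarrow> inT x (- p) (- q)"
proof -
  have "- x - lv p q = lv (- p) (- q) - x" "lv p q - - x = x - lv (- p) (- q)" by (simp_all add: lv_minus)
  then show "inT (- x) p q \<longleftrightarrow> inU x (- p) (- q)" "inU (- x) p q \<longleftrightarrow> inT x (- p) (- q)"
    by (simp_all only: inT_def inU_def)
qed

lemma inT_reflect: "inT (lv a b - x) p q \<longleftrightarrow> inU x (a - p) (b - q)"
  and inU_reflect: "inU (lv a b - x) p q \<longleftrightarrow> inT x (a - p) (b - q)"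
  using inT_plus[of "- x" a b p q] inU_plus[of "- x" a b p q] by (simp_all add: inT_minus inU_minus)

lemma compact_inT: "compact {x. inT x p q}"
proof -
  have "{x. inT x p q} = (+) (lv p q) ` T"
    using mem_image_inverse[of "\<lambda>x. x - lv p q" "(+) (lv p q)"] by (auto simp: inT_def)
  then show ?thesis using compact_translation[OF T_compact] by simp
qed

lemma compact_inU: "compact {x. inU x p q}"
proof -
  have "{x. inU x p q} = (\<lambda>x. lv p q - x) ` T"
    using mem_image_inverse[of "\<lambda>x. lv p q - x" "\<lambda>x. lv p q - x"] by (auto simp: inU_def)
  then show ?thesis using T_compact by (auto intro!: compact_continuous_image continuous_intros)
qed

lemma low_digit:
  assumes "inS y 0 q \<or> (\<exists>k\<in>{1..B-2}. inT y k q)"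
  obtains k where "0 \<le> k" "k \<le> B - 2" "inS y k q"
  using assms
proof
  assume "inS y 0 q" then show thesis using that[of 0] B_ge_2 by simp
next
  assume "\<exists>k\<in>{1..B-2}. inT y k q"
  then obtain k where "k \<in> {1..B-2}" "inT y k q" by blast
  then show thesis using that[of k] inT_inS[of y k q] by simp
qed

lemma high_digit:
  assumes "inS y (B-1) q \<or> (\<exists>k\<in>{1..B-2}. inU y k q)"
  obtains k where "1 \<le> k" "k \<le> B - 1" "inS y k q"
  using assms
proof
  assume "inS y (B-1) q" then show thesis using that[of "B-1"] B_ge_2 by simp
next
  assume "\<exists>k\<in>{1..B-2}. inU y k q"
  then obtain k where "k \<in> {1..B-2}" "inU y k q" by blast
  then show thesis using that[of k] inU_inS[of y k q] by simp
qed

end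

locale crystile = half_tile +
  assumes T_rec: "\<And>x. x \<in> T \<longleftrightarrow> gmap A B x \<in> S \<or> (\<exists>k\<in>{1..B-2}. gmap A B x - lv k 0 \<in> T)"
begin

lemma inT_rec: "inT x p q \<longleftrightarrow> inS (g x) (- B * q) (p - A * q) \<or> (\<exists>k\<in>{1..B-2}. inT (g x) (k - B * q) (p - A * q))"
proof -
  have digit: "g (x - lv p q) - lv k 0 = g x - lv (k - B * q) (p - A * q)" for k
    unfolding gmap_diff_lv by (simp add: lv_def prod_eq_iff)
  show ?thesis unfolding inT_def inS_def T_rec[of "x - lv p q"] digit unfolding gmap_diff_lv ..
qed

lemma inU_rec:
  "inU x p q \<longleftrightarrow> inS (g x) (B - 1 - B * q) (p - A * q) \<or> (\<exists>k\<in>{1..B-2}. inU (g x) (k - B * q) (p - A * q))"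
proof -
  have "inU x p q \<longleftrightarrow> inT (- x) (- p) (- q)" by (simp add: inT_minus)
  also have "\<dots> \<longleftrightarrow> inS (g x) (B - 1 - B * q) (p - A * q) \<or> (\<exists>k\<in>{1..B-2}. inU (g x) (B - 1 - k - B * q) (p - A * q))"
    by (subst inT_rec) (simp add: gmap_minus inS_reflect inT_reflect algebra_simps)
  also have "(\<exists>k\<in>{1..B-2}. inU (g x) (B - 1 - k - B * q) (p - A * q)) \<longleftrightarrow>
      (\<exists>k\<in>{1..B-2}. inU (g x) (k - B * q) (p - A * q))"
    by (rule ex_reflect_atLeastAtMost) simp
  finally show ?thesis .
qed

end

definition sym_tile :: "int \<Rightarrow> int \<Rightarrow> (real \<times> real) set" where
  "sym_tile A B = tile A B \<union> uminus ` tile A B"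

lemma mem_sym_tile: "x \<in> sym_tile A B \<longleftrightarrow> x \<in> tile A B \<or> - x \<in> tile A B"
  unfolding sym_tile_def Un_iff mem_uminus_image ..

context tile_gauge
begin

lemma mem_tile_iff_sym: "x \<in> tile A B \<longleftrightarrow> g x \<in> sym_tile A B \<or> (\<exists>k\<in>{1..B-2}. g x - lv k 0 \<in> tile A B)"
proof -
  have "{0..B-2} = insert 0 {1..B-2}" using B_ge_2 by auto
  then show ?thesis unfolding mem_tile_iff[of x] mem_sym_tile by auto
qed

lemma minus_mem_tile_iff:
  "- x \<in> tile A B \<longleftrightarrow> g x - lv (B-1) 0 \<in> sym_tile A B \<or> (\<exists>k\<in>{1..B-2}. - (g x - lv k 0) \<in> tile A B)"
proof -
  have flip: "g (- x) - lv k 0 = - (g x - lv (B-1-k) 0)" for k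
    unfolding gmap_minus by (simp add: lv_def prod_eq_iff)
  have "- x \<in> tile A B \<longleftrightarrow> g (- x) \<in> sym_tile A B \<or> (\<exists>k\<in>{1..B-2}. - (g x - lv (B-1-k) 0) \<in> tile A B)"
    unfolding mem_tile_iff_sym[of "- x"] flip ..
  also have "(\<exists>k\<in>{1..B-2}. - (g x - lv (B-1-k) 0) \<in> tile A B) \<longleftrightarrow> (\<exists>k\<in>{1..B-2}. - (g x - lv k 0) \<in> tile A B)"
    by (rule ex_reflect_atLeastAtMost) simp
  also have "g (- x) \<in> sym_tile A B \<longleftrightarrow> g x - lv (B-1) 0 \<in> sym_tile A B"
    unfolding mem_sym_tile gmap_minus by (auto simp: minus_diff_eq)
  finally show ?thesis .
qed

lemma mem_sym_tile_iff: "x \<in> sym_tile A B \<longleftrightarrow> (\<exists>k\<in>{0..B-1}. g x - lv k 0 \<in> sym_tile A B)"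
proof -
  have "{0..B-1} = {0, B - 1} \<union> {1..B-2}" using B_ge_2 by auto
  then have "(\<exists>k\<in>{0..B-1}. g x - lv k 0 \<in> sym_tile A B) \<longleftrightarrow>
      g x \<in> sym_tile A B \<or> g x - lv (B-1) 0 \<in> sym_tile A B \<or> (\<exists>k\<in>{1..B-2}. g x - lv k 0 \<in> sym_tile A B)"
    by (simp add: bex_Un)
  then show ?thesis using mem_tile_iff_sym[of x] minus_mem_tile_iff[of x] mem_sym_tile by blast
qed

lemma crystile_tile: "crystile N lam c0 c1 A B (sym_tile A B) (tile A B)"
proof unfold_locales
  show "compact (sym_tile A B)" unfolding sym_tile_def using tile_properties(1)
    by (intro compact_Un compact_negations)
  show "sym_tile A B \<noteq> {}" using tile_properties(2) by (simp add: sym_tile_def)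
qed (rule tile_properties mem_sym_tile mem_sym_tile_iff mem_tile_iff_sym | simp add: mem_sym_tile disj_commute)+

end

lemma crystile_exists:
  assumes "2 \<le> B" "\<bar>A\<bar> \<le> B - 2 \<or> A * A < 4 * B"
  shows "\<exists>N lam c0 c1. crystile N lam c0 c1 A B (sym_tile A B) (tile A B)"
  using tile_gauge_exists[OF assms] tile_gauge.crystile_tile by blast

section \<open>The plane as pairs of reals\<close>

definition toC :: "real \<times> real \<Rightarrow> complex" where "toC p = Complex (fst p) (snd p)"

lemma toC_homeomorphism: "homeomorphism UNIV UNIV toC (\<lambda>z. (Re z, Im z))"
proof
  show "continuous_on UNIV toC" unfolding toC_def[abs_def] by (intro continuous_intros)
  show "continuous_on UNIV (\<lambda>z. (Re z, Im z))" by (intro continuous_intros)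
qed (auto simp: toC_def)

lemma bij_toC: "bij toC"
  by (rule o_bij[of "\<lambda>z. (Re z, Im z)"]) (auto simp: toC_def fun_eq_iff)

lemmas inj_toC = bij_is_inj[OF bij_toC]

lemma homeomorphic_toC: "X homeomorphic toC ` X"
  using homeomorphism_of_subsets[OF toC_homeomorphism, of X] unfolding homeomorphic_def by blast

lemma continuous_on_toC: "continuous_on X toC"
  using toC_homeomorphism by (auto simp: homeomorphism_def intro: continuous_on_subset)

lemma connected_toC: "connected (toC ` X) \<longleftrightarrow> connected X"
  using homeomorphic_toC homeomorphic_connectedness by blast

lemma Janiszewski_dual_prod:
  fixes X Y :: "(real \<times> real) set"
  assumes "compact X" "compact Y" "connected X" "connected Y" "connected (- (X \<union> Y))"
  shows "connected (X \<inter> Y)"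
proof -
  have "connected (toC ` X \<inter> toC ` Y)"
  proof (rule Janiszewski_dual)
    show "compact (toC ` X)" "compact (toC ` Y)"
      using assms by (auto intro!: compact_continuous_image continuous_on_toC)
    show "connected (toC ` X)" "connected (toC ` Y)" using assms by (simp_all add: connected_toC)
    have "- (toC ` X \<union> toC ` Y) = toC ` (- (X \<union> Y))"
      unfolding image_Un[symmetric] by (rule bij_image_Compl_eq[OF bij_toC, symmetric])
    then show "connected (- (toC ` X \<union> toC ` Y))" using assms by (simp add: connected_toC)
  qed
  then show ?thesis using inj_toC by (simp add: connected_toC flip: image_Int)
qed

lemma disk_like_homeomorphic: "X homeomorphic Y \<Longrightarrow> disk_like Y \<Longrightarrow> disk_like X"
  unfolding disk_like_def using homeomorphic_trans by blast

lemma disk_like_interior: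
  assumes "disk_like X"
  shows "connected X" "connected (interior X)" "X \<subseteq> closure (interior X)" "interior X \<noteq> {}"
proof -
  obtain f h where fh: "homeomorphism (cball (0::real\<times>real) 1) X f h"
    using assms homeomorphic_sym unfolding disk_like_def homeomorphic_def by blast
  have f: "continuous_on (cball 0 1) f" "f ` cball 0 1 = X" "inj_on f (cball 0 1)"
    using fh unfolding homeomorphism_def by (auto intro: inj_on_inverseI)
  show "connected X" unfolding f(2)[symmetric] by (intro connected_continuous_image f) simp
  define W where "W = f ` ball 0 1"
  have "open W" unfolding W_def
    by (intro invariance_of_domain continuous_on_subset[OF f(1)] inj_on_subset[OF f(3)]) auto
  then have W_sub: "W \<subseteq> interior X" using f(2) by (intro interior_maximal) (auto simp: W_def)
  have "connected W" unfolding W_def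
    by (intro connected_continuous_image continuous_on_subset[OF f(1)]) auto
  have "f ` closure (ball 0 1) \<subseteq> closure W"
    by (rule image_closure_subset) (use f in \<open>simp_all add: closure_subset flip: W_def\<close>)
  then have dense: "X \<subseteq> closure W" using f(2) by simp
  then show "connected (interior X)"
    using connected_intermediate_closure[OF \<open>connected W\<close> W_sub] interior_subset by blast
  show "X \<subseteq> closure (interior X)" using dense closure_mono[OF W_sub] by blast
  show "interior X \<noteq> {}" using W_sub by (auto simp: W_def)
qed

definition joined_in :: "'a::topological_space set \<Rightarrow> 'a set \<Rightarrow> 'a set \<Rightarrow> bool" where
  "joined_in E X Y \<longleftrightarrow> (\<forall>x\<in>X \<inter> E. \<forall>y\<in>Y \<inter> E. connected_component E x y)"

lemma joined_in_refl: "connected (X \<inter> E) \<Longrightarrow> joined_in E X X"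
  unfolding joined_in_def connected_component_def by (intro ballI exI[of _ "X \<inter> E"]) auto

lemma joined_in_sym: "joined_in E X Y \<Longrightarrow> joined_in E Y X"
  unfolding joined_in_def using connected_component_sym by blast

lemma joined_in_trans:
  assumes "joined_in E X Y" "joined_in E Y Z" "Y \<inter> E \<noteq> {}" shows "joined_in E X Z"
  using assms unfolding joined_in_def by (meson connected_component_trans equals0I)

lemma joined_in_if_meet:
  assumes "connected (X \<inter> E)" "connected (Y \<inter> E)" "X \<inter> Y \<inter> E \<noteq> {}"
  shows "joined_in E X Y"
proof -
  have "connected ((X \<inter> E) \<union> (Y \<inter> E))" using assms by (intro connected_Un) auto
  then show ?thesis unfolding joined_in_def connected_component_def
    by (intro ballI exI[of _ "(X \<inter> E) \<union> (Y \<inter> E)"]) auto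
qed

section \<open>The tiles that are not disk-like\<close>

lemma digit_unique:
  fixes B k k' q q' :: int
  assumes eq: "k - B * q = k' - B * q'" and k: "0 \<le> k" "k < B" and k': "0 \<le> k'" "k' < B"
  shows "k = k'" "q = q'"
proof -
  have "(k - B * q) mod B = k" "(k' - B * q') mod B = k'"
    using k k' by (simp_all add: mod_pos_pos_trivial flip: mod_diff_right_eq)
  then show "k = k'" using eq by simp
  then show "q = q'" using eq k by simp
qed

locale nondisk_tile = crystile +
  assumes A_ge_2: "2 \<le> A" and B_ge_3: "3 \<le> B" and two_A_less: "2 * A < B + 3"
begin

lemma A_less_B: "A \<le> B - 1" using A_ge_2 B_ge_3 two_A_less by linarith

sublocale six_neighbour_tile by unfold_locales (use A_ge_2 A_less_B two_A_less in auto)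

lemma inT_no_lower_neighbour: "\<not> (inT x p q \<and> inS x (p - A) (q - 1))"
proof
  assume x: "inT x p q \<and> inS x (p - A) (q - 1)"
  obtain n where n: "n \<in> {0..B-1}" "inS (g x) (n - B * (q - 1)) (p - A - A * (q - 1))"
    using x inS_rec[of x "p - A" "q - 1"] by blast
  have "inT (x - lv p q) 0 0" unfolding inT_shift using x by simp
  then obtain k where k: "0 \<le> k" "k \<le> B - 2" "inS (g (x - lv p q)) k 0"
    using inT_rec[of "x - lv p q" 0 0] low_digit[of "g (x - lv p q)" 0] by auto
  then have "inS (g x) (k - B * q) (p - A * q)" unfolding gmap_diff_lv inS_shift by simp
  from neighbours[OF this n(2)] show False using n(1) k(1,2) by (auto simp: algebra_simps)
qed

lemma inU_no_upper_neighbour: "\<not> (inU x p q \<and> inS x (p + A) (q + 1))"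
  using inT_no_lower_neighbour[of "- x" "- p" "- q"] by (simp add: inT_minus inS_minus add.commute)

lemma vertex1_halves: "inT vertex1 0 0" "inU vertex1 A 1"
  using vertex1_mem inU_no_upper_neighbour[of vertex1 0 0] inT_no_lower_neighbour[of vertex1 A 1]
    inS_iff[of vertex1 0 0] inS_iff[of vertex1 A 1] by auto

definition piece :: "bool \<Rightarrow> int \<Rightarrow> int \<Rightarrow> (real \<times> real) set" where
  "piece s p q = (if s then {x. inT x p q} else {x. inU x p q})"

definition low_part :: "(real \<times> real) set" where
  "low_part = piece True 0 0 \<inter> piece False 1 0 \<inter> g -` S"

definition high_part :: "(real \<times> real) set" where
  "high_part = piece True 0 0 \<inter> piece False 1 0 \<inter> g -` (\<Union>k\<in>{1..B-2}. {y. inT y k 0})"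

lemma compact_piece: "compact (piece s p q)"
  by (simp add: piece_def compact_inT compact_inU)

lemma closed_parts: "closed low_part" "closed high_part"
  unfolding low_part_def high_part_def
  by (intro closed_Int closed_vimage closed_UN ballI compact_imp_closed compact_piece S_compact compact_inT
      continuous_on_gmap finite_atLeastAtMost_int)+

lemma parts_cover: "piece True 0 0 \<inter> piece False 1 0 = low_part \<union> high_part"
  using inT_rec[of _ 0 0] by (auto simp: low_part_def high_part_def piece_def)

lemma parts_disjoint: "low_part \<inter> high_part = {}"
proof (rule ccontr)
  assume "low_part \<inter> high_part \<noteq> {}"
  then obtain x where "x \<in> low_part" "x \<in> high_part" by blast
  then have x: "inU x 1 0" "inS (g x) 0 0" and "\<exists>k\<in>{1..B-2}. inT (g x) k 0"
    by (auto simp: low_part_def high_part_def piece_def)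
  then obtain k where k: "k \<in> {1..B-2}" "inT (g x) k 0" by blast
  have "k = 1" using row_neighbours[OF x(2) inT_inS[OF k(2)]] k(1) by auto
  from x(1) obtain j where j: "inS (g x) j 1"
    using inU_rec[of x 1 0] inU_inS by (metis diff_zero minus_zero mult_zero_right)
  have "j = A" using neighbours[OF x(2) j] neighbours[OF inT_inS[OF k(2)] j] \<open>k = 1\<close> by auto
  define y where "y = g x - lv 1 0"
  have y: "inS y (-1) 0" "inT y 0 0" "inS y (A - 1) 1"
    unfolding y_def inS_shift inT_shift using x(2) k(2) j \<open>k = 1\<close> \<open>j = A\<close> by auto
  obtain m where m: "m \<in> {0..B-1}" "inS (g y) m (-1)" using y(1) inS_rec[of y "-1" 0] by auto
  obtain n where n: "n \<in> {0..B-1}" "inS (g y) (n - B) (-1)" using y(3) inS_rec[of y "A-1" 1] by auto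
  have mn: "m = 0" "n - B = -1" using row_neighbours[OF m(2) n(2)] m(1) n(1) by auto
  from y(2) have "inS (g y) 0 0 \<or> (\<exists>k\<in>{1..B-2}. inT (g y) k 0)" using inT_rec[of y 0 0] by simp
  then show False
  proof (elim disjE bexE)
    assume "inS (g y) 0 0"
    from neighbours[OF this m(2)] show False using mn A_ge_2 by auto
  next
    fix l assume l: "inT (g y) l 0"
    have "l = A - 1" using neighbours[OF inT_inS[OF l] m(2)] neighbours[OF inT_inS[OF l] n(2)] mn by auto
    then show False using inT_no_lower_neighbour[of "g y" l 0] l n(2) mn by auto
  qed
qed

lemma gi_vertex1_mem: "gi vertex1 \<in> low_part"
proof -
  have "inT (gi vertex1) 0 0" using inT_rec[of "gi vertex1" 0 0] vertex1_mem by simp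
  moreover have "inU (gi vertex1) 1 0"
  proof (cases "A = B - 1")
    case True
    have "inS vertex1 (B - 1) 1" by (simp only: True[symmetric] vertex1_mem)
    then show ?thesis using inU_rec[of "gi vertex1" 1 0] by simp
  next
    case False
    then have "A \<in> {1..B-2}" using A_less_B A_ge_2 by auto
    then show ?thesis using inU_rec[of "gi vertex1" 1 0] vertex1_halves by auto
  qed
  ultimately show ?thesis using vertex1_mem by (simp add: low_part_def piece_def)
qed

lemma high_part_nonempty: "high_part \<noteq> {}"
proof -
  define w where "w = vertex1 - lv A 1"
  define y where "y = gi w + lv (B - A) 0"
  have w: "inS w 0 0" "inS w (- A) (-1)" unfolding w_def inS_shift using vertex1_mem by simp_all
  have digit: "B - A \<in> {1..B-2}" using A_less_B A_ge_2 by auto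
  have "inT (gi w) 0 0" using inT_rec[of "gi w" 0 0] w by simp
  then have y_right: "inT y (B - A) 0" unfolding y_def inT_plus by simp
  have "inS (g (gi w)) (B - A - B * 1) (A - 1 - A * 1)" "B - A \<in> {0..B-1}" using w(2) digit by auto
  then have "inS (gi w) (A - 1) 1" using inS_rec[of "gi w" "A - 1" 1] by blast
  then have "inS y (B - 1) 1" unfolding y_def inS_plus by simp
  then have "inU (gi y) 1 0" using inU_rec[of "gi y" 1 0] by simp
  moreover have "inT (gi y) 0 0" using inT_rec[of "gi y" 0 0] y_right digit by auto
  ultimately have "gi y \<in> high_part" using y_right digit by (auto simp: high_part_def piece_def)
  then show ?thesis by blast
qed

lemma tile_Int_neighbour_disconnected: "\<not> connected (piece True 0 0 \<inter> piece False 1 0)"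
  unfolding connected_closed parts_cover
  using closed_parts parts_disjoint gi_vertex1_mem high_part_nonempty by blast

lemma piece_subset_translate: "x \<in> piece s p q \<Longrightarrow> inS x p q"
  by (auto simp: piece_def inT_inS inU_inS split: if_splits)

lemma translate_eq_pieces: "{x. inS x p q} = piece True p q \<union> piece False p q"
  by (auto simp: piece_def inS_iff)

lemma inS_piece: "inS x p q \<Longrightarrow> \<exists>s. x \<in> piece s p q"
  using translate_eq_pieces[of p q] by blast

lemma piece_child:
  assumes "x \<in> piece s p q"
  obtains s' k where "g x \<in> piece s' (k - B * q) (p - A * q)" "0 \<le> k" "k < B" "s \<longleftrightarrow> (if s' then k \<le> B - 2 else k = 0)"
proof (cases s)
  case True
  then have "inS (g x) (0 - B * q) (p - A * q) \<or> (\<exists>k\<in>{1..B-2}. inT (g x) (k - B * q) (p - A * q))"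
    using assms inT_rec[of x p q] by (simp add: piece_def)
  then show thesis
  proof (elim disjE bexE)
    assume "inS (g x) (0 - B * q) (p - A * q)"
    then obtain s' where "g x \<in> piece s' (0 - B * q) (p - A * q)" using inS_piece by blast
    then show thesis using that[of s' 0] True B_ge_3 by auto
  next
    fix k assume "k \<in> {1..B-2}" "inT (g x) (k - B * q) (p - A * q)"
    then show thesis using that[of True k] True by (auto simp: piece_def)
  qed
next
  case False
  then have "inS (g x) (B - 1 - B * q) (p - A * q) \<or> (\<exists>k\<in>{1..B-2}. inU (g x) (k - B * q) (p - A * q))"
    using assms inU_rec[of x p q] by (simp add: piece_def)
  then show thesis
  proof (elim disjE bexE)
    assume "inS (g x) (B - 1 - B * q) (p - A * q)"
    then obtain s' where "g x \<in> piece s' (B - 1 - B * q) (p - A * q)" using inS_piece by blast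
    then show thesis using that[of s' "B - 1"] False B_ge_3 by auto
  next
    fix k assume "k \<in> {1..B-2}" "inU (g x) (k - B * q) (p - A * q)"
    then show thesis using that[of False k] False by (auto simp: piece_def)
  qed
qed

lemma piece_shift: "x + lv a b \<in> piece s p q \<longleftrightarrow> x \<in> piece s (p - a) (q - b)"
  by (simp add: piece_def inT_plus inU_plus)

lemma piece_of_gi_0:
  assumes "gi 0 + lv a b \<in> piece s p q" shows "s \<and> p = a \<and> q = b"
proof -
  have "gi 0 \<in> piece s (p - a) (q - b)" using assms by (simp add: piece_shift)
  then obtain s' k where k: "g (gi 0) \<in> piece s' (k - B * (q - b)) (p - a - A * (q - b))" "0 \<le> k" "k < B"
    "s \<longleftrightarrow> (if s' then k \<le> B - 2 else k = 0)" by (rule piece_child)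
  then have "k - B * (q - b) = 0 \<and> p - a - A * (q - b) = 0" using zero_only piece_subset_translate g_gi by metis
  moreover from this have "k = 0" "q - b = 0" using digit_unique[of k B "q - b" 0 0] k B_ge_3 by auto
  ultimately show ?thesis using k(4) B_ge_3 by auto
qed

lemma piece_unique_if_reaches_lattice:
  assumes "(g ^^ n) u = gi 0 + lv a b" "u \<in> piece s p q" "u \<in> piece s' p' q'"
  shows "s = s' \<and> p = p' \<and> q = q'"
  using assms
proof (induction n arbitrary: u s p q s' p' q')
  case 0
  then have "u = gi 0 + lv a b" by simp
  then show ?case using piece_of_gi_0[of a b s p q] piece_of_gi_0[of a b s' p' q'] 0 by auto
next
  case (Suc n)
  obtain r k where k: "g u \<in> piece r (k - B * q) (p - A * q)" "0 \<le> k" "k < B" "s \<longleftrightarrow> (if r then k \<le> B - 2 else k = 0)"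
    by (rule piece_child[OF Suc.prems(2)])
  obtain r' k' where k': "g u \<in> piece r' (k' - B * q') (p' - A * q')" "0 \<le> k'" "k' < B"
      "s' \<longleftrightarrow> (if r' then k' \<le> B - 2 else k' = 0)"
    by (rule piece_child[OF Suc.prems(3)])
  have "(g ^^ n) (g u) = gi 0 + lv a b" using Suc.prems(1) by (simp add: funpow_Suc_right del: funpow.simps)
  from Suc.IH[OF this k(1) k'(1)] have same: "r = r'" "k - B * q = k' - B * q'" "p - A * q = p' - A * q'" by auto
  then have "k = k'" "q = q'" using digit_unique[OF same(2)] k k' by auto
  then show ?case using same k(4) k'(4) by auto
qed

lemma pieces_nonoverlapping:
  assumes U: "open U" "U \<noteq> {}" "U \<subseteq> piece s p q" "U \<subseteq> piece s' p' q'"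
  shows "s = s' \<and> p = p' \<and> q = q'"
proof -
  define W where "W = (\<Union>n. {u. \<exists>a b. (g ^^ n) u = gi 0 + lv a b})"
  obtain x where "x \<in> U" using U(2) by blast
  have "x \<in> closure W"
  proof (rule lattice_preimages_dense)
    have "gi u \<in> W" if "(g ^^ n) u = gi 0 + lv a b" for n u a b
    proof -
      have "(g ^^ Suc n) (gi u) = gi 0 + lv a b" using that by (simp add: funpow_Suc_right del: funpow.simps)
      then show ?thesis unfolding W_def by blast
    qed
    then show "gi ` W \<subseteq> W" by (auto simp: W_def)
    have "(g ^^ 0) (gi 0 + lv a b) = gi 0 + lv a b" for a b by simp
    then show "gi 0 + lv a b \<in> W" for a b unfolding W_def by blast
  qed
  then have "W \<inter> U \<noteq> {}" using U(1) \<open>x \<in> U\<close> by (meson closure_iff_nhds_not_empty subset_refl)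
  then obtain n u a b where "u \<in> U" "(g ^^ n) u = gi 0 + lv a b" unfolding W_def by blast
  then show ?thesis using piece_unique_if_reaches_lattice U(3,4) by blast
qed

lemma center_point:
  obtains x where "inT x 0 0" "inU x 0 0" "\<forall>p q. inS x p q \<longrightarrow> q < 0 \<or> q = 0 \<and> p \<le> 0"
proof -
  have "gi vertex1 \<in> low_part" by (rule gi_vertex1_mem)
  then have v: "inT (gi vertex1) 0 0" "inS (gi vertex1) 1 0"
    using inU_inS[of "gi vertex1" 1 0] by (auto simp: low_part_def piece_def)
  define y where "y = gi vertex1 + lv (B - 2) 0"
  have y: "inT y (B - 2) 0" "inS y (B - 1) 0" unfolding y_def inT_plus inS_plus using v by simp_all
  have absent: "\<not> inS (gi y) p q" if "\<And>j. 0 \<le> j \<Longrightarrow> j \<le> B - 1 \<Longrightarrow> \<not> inS y (j - B * q) (p - A * q)" for p q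
    using inS_rec[of "gi y" p q] that by auto
  show thesis
  proof (rule that[of "gi y"])
    show center: "inT (gi y) 0 0" using inT_rec[of "gi y" 0 0] y B_ge_3 by force
    show "inU (gi y) 0 0" using inU_rec[of "gi y" 0 0] y by simp
    have "\<not> inS (gi y) 1 0" "\<not> inS (gi y) A 1" "\<not> inS (gi y) (A - 1) 1"
      by (rule absent; use neighbours[OF y(2)] A_ge_2 A_less_B B_ge_3 in fastforce)+
    then have "\<not> (p = 1 \<and> q = 0)" "\<not> (p = A \<and> q = 1)" "\<not> (p = A - 1 \<and> q = 1)" if "inS (gi y) p q" for p q
      using that by auto
    then have "q < 0 \<or> q = 0 \<and> p \<le> 0" if "inS (gi y) p q" for p q
      using neighbours[OF inT_inS[OF center] that] that by fastforce
    then show "\<forall>p q. inS (gi y) p q \<longrightarrow> q < 0 \<or> q = 0 \<and> p \<le> 0" by blast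
  qed
qed

lemma side_point:
  obtains x where "inS x 0 0" "inS x 1 0" "\<forall>p q. inS x p q \<longrightarrow> q < 0 \<or> q = 0 \<and> p \<in> {0, 1}"
proof -
  define y where "y = vertex1 + lv (B - A - 1) 0"
  have y: "inS y (B - A) 0" "inS y (B - 1) 1" unfolding y_def inS_plus using vertex1_mem by simp_all
  have digits: "B - A \<in> {0..B-1}" "B - 1 \<in> {0..B-1}" using A_less_B A_ge_2 by auto
  show thesis
  proof (rule that[of "gi y"])
    show right: "inS (gi y) 0 0" "inS (gi y) 1 0"
      using inS_rec[of "gi y" 0 0] inS_rec[of "gi y" 1 0] y digits by auto
    have "\<not> inS (gi y) A 1"
    proof
      assume "inS (gi y) A 1"
      then obtain j where "j \<in> {0..B-1}" "inS y (j - B) 0" using inS_rec[of "gi y" A 1] by auto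
      then show False using row_neighbours[OF y(1), of "j - B"] A_less_B by auto
    qed
    then have "\<not> (p = A \<and> q = 1)" if "inS (gi y) p q" for p q using that by auto
    then have "q < 0 \<or> q = 0 \<and> p \<in> {0, 1}" if "inS (gi y) p q" for p q
      using neighbours[OF right(1) that] neighbours[OF right(2) that] that by fastforce
    then show "\<forall>p q. inS (gi y) p q \<longrightarrow> q < 0 \<or> q = 0 \<and> p \<in> {0, 1}" by blast
  qed
qed

definition exterior :: "(real \<times> real) set" where
  "exterior = - (piece True 0 0 \<union> piece False 1 0)"

definition outer :: "int \<Rightarrow> int \<Rightarrow> bool" where
  "outer p q \<longleftrightarrow> (p, q) \<noteq> (0, 0) \<and> (p, q) \<noteq> (1, 0)"

definition block :: "int \<Rightarrow> int \<Rightarrow> (real \<times> real) set" where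
  "block p q = {x. inS x p q}"

lemma exteriorI: "\<not> inS x 0 0 \<Longrightarrow> \<not> inS x 1 0 \<Longrightarrow> x \<in> exterior"
  unfolding exterior_def using piece_subset_translate by blast

lemma reflect_exterior: "lv 1 0 - x \<in> exterior \<longleftrightarrow> x \<in> exterior"
  by (auto simp: exterior_def piece_def inT_reflect inU_reflect simp del: inT_00 inU_00)

lemma mem_block_shift: "x + lv p q \<in> block a b \<longleftrightarrow> inS x (a - p) (b - q)"
  by (simp add: block_def inS_plus)

context
  assumes disk: "disk_like T"
begin

lemma piece_disk_like: "disk_like (piece s p q)"
proof -
  define \<sigma> where "\<sigma> x = (if s then lv p q + x else lv p q - x)" for x
  define \<tau> where "\<tau> x = (if s then x - lv p q else lv p q - x)" for x
  have inverse: "\<tau> (\<sigma> x) = x" "\<sigma> (\<tau> x) = x" for x by (simp_all add: \<sigma>_def \<tau>_def)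
  have "continuous_on X \<sigma>" "continuous_on X \<tau>" for X
    unfolding \<sigma>_def[abs_def] \<tau>_def[abs_def] by (cases s; auto intro!: continuous_intros)+
  then have "homeomorphism T (\<sigma> ` T) \<sigma> \<tau>" by (intro homeomorphismI) (auto simp: inverse)
  moreover have "\<sigma> ` T = piece s p q"
    by (rule set_eqI) (simp add: mem_image_inverse[OF inverse] piece_def inT_def inU_def \<tau>_def)
  ultimately have "piece s p q homeomorphic T" using homeomorphic_sym homeomorphic_def by metis
  then show ?thesis using disk by (rule disk_like_homeomorphic)
qed

lemmas piece_interior = disk_like_interior[OF piece_disk_like]

lemma interior_piece_disjoint:
  assumes "\<not> (s = s' \<and> p = p' \<and> q = q')"
  shows "interior (piece s p q) \<inter> piece s' p' q' = {}"
proof (rule ccontr)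
  assume "interior (piece s p q) \<inter> piece s' p' q' \<noteq> {}"
  then have "interior (piece s p q) \<inter> closure (interior (piece s' p' q')) \<noteq> {}" using piece_interior(3) by blast
  then have "interior (piece s p q) \<inter> interior (piece s' p' q') \<noteq> {}" by (simp add: open_Int_closure_eq_empty)
  from pieces_nonoverlapping[OF _ this, of s p q s' p' q'] show False
    using assms interior_subset[of "piece s p q"] interior_subset[of "piece s' p' q'"] by auto
qed

lemma piece_exterior:
  assumes "(s, p, q) \<noteq> (True, 0, 0)" "(s, p, q) \<noteq> (False, 1, 0)"
  shows "connected (piece s p q \<inter> exterior)" "piece s p q \<inter> exterior \<noteq> {}"
proof -
  have "interior (piece s p q) \<inter> piece True 0 0 = {}" "interior (piece s p q) \<inter> piece False 1 0 = {}"
    using assms interior_piece_disjoint by auto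
  then have inner: "interior (piece s p q) \<subseteq> piece s p q \<inter> exterior"
    unfolding exterior_def using interior_subset by blast
  show "connected (piece s p q \<inter> exterior)"
    by (rule connected_intermediate_closure[OF piece_interior(2) inner]) (use piece_interior(3) in blast)
  show "piece s p q \<inter> exterior \<noteq> {}" using inner piece_interior(4) by blast
qed

lemma halves_meet_outside:
  assumes "outer p q" shows "piece True p q \<inter> piece False p q \<inter> exterior \<noteq> {}"
proof -
  obtain x where x: "inT x 0 0" "inU x 0 0" "\<forall>p q. inS x p q \<longrightarrow> q < 0 \<or> q = 0 \<and> p \<le> 0" by (rule center_point)
  define y where "y = (if q < 0 \<or> q = 0 \<and> p < 0 then x else - x)"
  have "inT y 0 0" "inU y 0 0" using x(1,2) by (auto simp: y_def)
  then have "y + lv p q \<in> piece True p q \<inter> piece False p q" by (simp add: piece_def inT_plus inU_plus)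
  moreover have "\<not> inS y (- p) (- q)" "\<not> inS y (1 - p) (- q)"
    using x(3)[rule_format, of "- p" "- q"] x(3)[rule_format, of "1 - p" "- q"]
      x(3)[rule_format, of p q] x(3)[rule_format, of "p - 1" q] assms
    by (auto simp: y_def outer_def inS_minus)
  then have "y + lv p q \<in> exterior" by (intro exteriorI) (simp_all add: inS_plus del: inS_00)
  ultimately show ?thesis by blast
qed

lemma block_exterior:
  assumes "outer p q" shows "connected (block p q \<inter> exterior)" "block p q \<inter> exterior \<noteq> {}"
proof -
  have not_central: "(s, p, q) \<noteq> (True, 0, 0)" "(s, p, q) \<noteq> (False, 1, 0)" for s
    using assms by (auto simp: outer_def)
  have halves: "block p q \<inter> exterior = (piece True p q \<inter> exterior) \<union> (piece False p q \<inter> exterior)"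
    unfolding block_def translate_eq_pieces by blast
  show "connected (block p q \<inter> exterior)"
    unfolding halves using halves_meet_outside[OF assms] by (intro connected_Un piece_exterior not_central) blast
  show "block p q \<inter> exterior \<noteq> {}" unfolding halves using piece_exterior(2)[OF not_central] by blast
qed

abbreviation linked :: "int \<Rightarrow> int \<Rightarrow> int \<Rightarrow> int \<Rightarrow> bool" where
  "linked p q p' q' \<equiv> joined_in exterior (block p q) (block p' q')"

lemma linked_trans: "linked p q p' q' \<Longrightarrow> linked p' q' p'' q'' \<Longrightarrow> outer p' q' \<Longrightarrow> linked p q p'' q''"
  using joined_in_trans block_exterior(2) by blast

lemma linkedI:
  assumes "outer p q" "outer p' q'" "inS y 0 0" "inS y (p' - p) (q' - q)"
    and "\<not> inS y (- p) (- q)" "\<not> inS y (1 - p) (- q)"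
  shows "linked p q p' q'"
proof (rule joined_in_if_meet)
  have "y + lv p q \<in> exterior" using assms(5,6) by (intro exteriorI) (simp_all add: inS_plus del: inS_00)
  moreover have "y + lv p q \<in> block p q" "y + lv p q \<in> block p' q'"
    using assms(3,4) by (simp_all add: mem_block_shift)
  ultimately show "block p q \<inter> block p' q' \<inter> exterior \<noteq> {}" by blast
qed (rule block_exterior[OF assms(1)] block_exterior[OF assms(2)])+

lemma linked_right:
  assumes "outer p q" "outer (p + 1) q" shows "linked p q (p + 1) q"
proof -
  obtain x where x: "inS x 0 0" "inS x 1 0" "\<forall>p q. inS x p q \<longrightarrow> q < 0 \<or> q = 0 \<and> p \<in> {0, 1}" by (rule side_point)
  define y where "y = (if q < 0 then x else lv 1 0 - x)"
  show ?thesis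
  proof (rule linkedI[OF assms])
    show "inS y 0 0" "inS y (p + 1 - p) (q - q)" using x(1,2) by (simp_all add: y_def inS_reflect del: inS_00)
    show "\<not> inS y (- p) (- q)" "\<not> inS y (1 - p) (- q)"
      using x(3)[rule_format, of "- p" "- q"] x(3)[rule_format, of "1 - p" "- q"]
        x(3)[rule_format, of "1 + p" q] x(3)[rule_format, of p q] assms
      by (auto simp: y_def inS_reflect outer_def split: if_splits)
  qed
qed

lemma linked_row:
  assumes "p \<le> p'" "\<And>i. p \<le> i \<Longrightarrow> i \<le> p' \<Longrightarrow> outer i q" shows "linked p q p' q"
  using assms
proof (induction p' rule: int_ge_induct)
  case base
  then show ?case by (intro joined_in_refl block_exterior) simp
next
  case (step i)
  then have "outer i q" "outer (i + 1) q" by simp_all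
  then show ?case using linked_trans[OF step.IH linked_right] step.prems by simp
qed

lemma linked_full_row: assumes "q \<noteq> 0" shows "linked p q p' q"
proof -
  have "outer i q" for i using assms by (simp add: outer_def)
  then show ?thesis using linked_row[of p p' q] joined_in_sym[OF linked_row[of p' p q]] by (cases "p \<le> p'") auto
qed

lemma linked_up: assumes "A + 2 \<le> \<bar>p\<bar>" shows "linked p q (p + A) (q + 1)"
proof (rule linkedI[where y=vertex1])
  show "inS vertex1 0 0" "inS vertex1 (p + A - p) (q + 1 - q)" using vertex1_mem by simp_all
  show "\<not> inS vertex1 (- p) (- q)" "\<not> inS vertex1 (1 - p) (- q)"
    using neighbours[OF vertex1_mem(1), of "- p" "- q"] neighbours[OF vertex1_mem(1), of "1 - p" "- q"] assms A_ge_2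
    by auto
qed (use assms A_ge_2 in \<open>auto simp: outer_def\<close>)

lemma linked_next_row: assumes "q \<noteq> 0" "q + 1 \<noteq> 0" shows "linked p q p' (q + 1)"
proof -
  have outer: "outer i q" "outer i (q + 1)" for i using assms by (simp_all add: outer_def)
  have up: "linked (A + 2) q (A + 2 + A) (q + 1)" using A_ge_2 by (intro linked_up) simp
  have "linked p q (A + 2 + A) (q + 1)" by (rule linked_trans[OF linked_full_row[OF assms(1)] up outer(1)])
  then show ?thesis by (rule linked_trans[OF _ linked_full_row[OF assms(2)] outer(2)])
qed

lemma linked_above: "1 \<le> q \<Longrightarrow> linked p q p' 1"
proof (induction q arbitrary: p rule: int_ge_induct)
  case base show ?case by (rule linked_full_row) simp
next
  case (step q)
  then show ?case
    using linked_trans[OF joined_in_sym[OF linked_next_row[of q 0 p]] step.IH[of 0]] by (simp add: outer_def)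
qed

lemma linked_below: "q \<le> -1 \<Longrightarrow> linked p q p' (-1)"
proof (induction q arbitrary: p rule: int_le_induct)
  case base show ?case by (rule linked_full_row) simp
next
  case (step q)
  then show ?case using linked_trans[OF linked_next_row[of "q - 1" p 0] _] step.IH[of 0] by (simp add: outer_def)
qed

text \<open>In the row \<open>q = 0\<close> the two central blocks are missing; its left half is reached through the row above.\<close>

lemma linked_base: assumes "outer p q" shows "linked p q (A + 2) 0"
proof -
  have base_up: "linked (A + 2 + A) 1 (A + 2) 0" using joined_in_sym[OF linked_up[of "A + 2" 0]] A_ge_2 by simp
  have right: "linked p 0 (A + 2) 0" if "2 \<le> p" for p
    using linked_row[of p "A + 2" 0] joined_in_sym[OF linked_row[of "A + 2" p 0]] that A_ge_2
    by (cases "p \<le> A + 2") (auto simp: outer_def)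
  have above: "linked p q (A + 2) 0" if "1 \<le> q" for p q
    by (rule linked_trans[OF linked_above[OF that] base_up]) (simp add: outer_def)
  consider "1 \<le> q" | "q \<le> -1" | "q = 0" "2 \<le> p" | "q = 0" "p \<le> -1" using assms by (force simp: outer_def)
  then show ?thesis
  proof cases
    assume "q \<le> -1"
    then have below: "linked p q (A + 2) (-1)" by (rule linked_below)
    have up: "linked (A + 2) (-1) (A + 2 + A) 0" using linked_up[of "A + 2" "-1"] A_ge_2 by simp
    have "linked (A + 2) (-1) (A + 2) 0" by (rule linked_trans[OF up right]) (use A_ge_2 in \<open>simp_all add: outer_def\<close>)
    then show ?thesis by (rule linked_trans[OF below]) (simp add: outer_def)
  next
    assume left: "q = 0" "p \<le> -1"
    have outer: "outer i 0" if "i \<le> -1" for i using that by (simp add: outer_def)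
    have "linked p 0 (- A - 2) 0"
    proof (cases "p \<le> - A - 2")
      case True
      then show ?thesis using A_ge_2 by (intro linked_row outer) simp_all
    next
      case False
      then show ?thesis using left by (intro joined_in_sym[OF linked_row] outer) simp_all
    qed
    moreover have "linked (- A - 2) 0 (A + 2) 0"
      using linked_trans[OF _ above[of 1 "- 2"]] linked_up[of "- A - 2" 0] A_ge_2 by (simp add: outer_def)
    ultimately show ?thesis using left linked_trans outer[of "- A - 2"] A_ge_2 by simp
  qed (use above right in auto)
qed

lemma half_tile_joined: "joined_in exterior (piece False 0 0) (block (A + 2) 0)"
  "joined_in exterior (piece True 1 0) (block (A + 2) 0)"
proof -
  define x where "x = - vertex1"
  have x: "inU x 0 0" "inS x (- A) (-1)"
    unfolding x_def using vertex1_halves vertex1_mem by (simp_all add: inU_minus inS_minus)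
  have "\<not> inT x 0 0" using inT_no_lower_neighbour[of x 0 0] x(2) by simp
  moreover have "\<not> inU x 1 0" using neighbours[OF inU_inS[of x 1 0] x(2)] A_ge_2 by auto
  ultimately have exterior: "x \<in> exterior" by (simp add: exterior_def piece_def)
  have outer: "outer (- A) (-1)" "outer (A + 1) 1" by (simp_all add: outer_def)
  have "joined_in exterior (piece False 0 0) (block (- A) (-1))"
    by (rule joined_in_if_meet[OF piece_exterior(1) block_exterior(1)[OF outer(1)]])
      (use x exterior in \<open>auto simp: piece_def block_def\<close>)
  then show "joined_in exterior (piece False 0 0) (block (A + 2) 0)"
    by (rule joined_in_trans[OF _ linked_base[OF outer(1)] block_exterior(2)[OF outer(1)]])
  have "lv 1 0 - x \<in> piece True 1 0 \<inter> block (A + 1) 1 \<inter> exterior"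
    using x exterior by (simp add: piece_def block_def inT_reflect inS_reflect reflect_exterior)
  then have "joined_in exterior (piece True 1 0) (block (A + 1) 1)"
    by (intro joined_in_if_meet[OF piece_exterior(1) block_exterior(1)[OF outer(2)]]) auto
  then show "joined_in exterior (piece True 1 0) (block (A + 2) 0)"
    by (rule joined_in_trans[OF _ linked_base[OF outer(2)] block_exterior(2)[OF outer(2)]])
qed

lemma connected_exterior: "connected exterior"
proof -
  have "outer (A + 2) 0" using A_ge_2 by (simp add: outer_def)
  then obtain b where b: "b \<in> block (A + 2) 0 \<inter> exterior" using block_exterior(2) by blast
  have "connected_component exterior x b" if x: "x \<in> exterior" for x
  proof -
    obtain p q where pq: "inS x p q" using covering by blast
    then obtain s where s: "x \<in> piece s p q" using inS_piece by blast
    consider "outer p q" | "(s, p, q) = (False, 0, 0)" | "(s, p, q) = (True, 1, 0)"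
      using s x by (cases s) (auto simp: exterior_def outer_def)
    then show ?thesis
    proof cases
      assume "outer p q"
      then show ?thesis using linked_base pq x b unfolding joined_in_def block_def by blast
    qed (use half_tile_joined s x b in \<open>auto simp: joined_in_def\<close>)
  qed
  then show ?thesis unfolding connected_iff_connected_component
    by (intro ballI) (rule connected_component_trans[OF _ connected_component_sym])
qed

lemma tile_Int_neighbour_connected: "connected (piece True 0 0 \<inter> piece False 1 0)"
  by (rule Janiszewski_dual_prod[OF compact_piece compact_piece piece_interior(1) piece_interior(1)])
    (use connected_exterior in \<open>simp add: exterior_def\<close>)

end

theorem not_disk_like: "\<not> disk_like T"
  using tile_Int_neighbour_connected tile_Int_neighbour_disconnected by blast

end

section \<open>A Jordan curve bounding the tile\<close>

lemma Jordan_curve_closed_disk_if_clopen: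
  fixes X :: "complex set"
  assumes c: "simple_path c" "pathfinish c = pathstart c" and X: "compact X" "path_image c \<subseteq> X"
    and opn: "open (X - path_image c)" and ne: "X - path_image c \<noteq> {}"
  shows "X homeomorphic cball (0::complex) 1"
proof -
  let ?J = "path_image c"
  note curve = Jordan_inside_outside[OF c]
  have all_or_nothing: "V \<subseteq> X \<or> V \<inter> X = {}" if V: "connected V" "V \<inter> ?J = {}" for V
  proof -
    have "V \<subseteq> (X - ?J) \<union> - X" "(X - ?J) \<inter> (- X) \<inter> V = {}" using V(2) by auto
    then have "(X - ?J) \<inter> V = {} \<or> (- X) \<inter> V = {}"
      using connectedD[OF V(1) opn, of "- X"] compact_imp_closed[OF X(1)] by blast
    then show ?thesis using V(2) by blast
  qed
  have disjoint: "inside ?J \<inter> ?J = {}" "outside ?J \<inter> ?J = {}" using curve by blast+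
  have "\<not> outside ?J \<subseteq> X" using curve compact_imp_bounded[OF X(1)] bounded_subset by blast
  then have "outside ?J \<inter> X = {}" using all_or_nothing[of "outside ?J"] curve disjoint by blast
  then have sub: "X \<subseteq> ?J \<union> inside ?J" using curve by blast
  then have "inside ?J \<inter> X \<noteq> {}" using ne by blast
  then have "inside ?J \<subseteq> X" using all_or_nothing[of "inside ?J"] curve disjoint by blast
  then have "X = ?J \<union> inside ?J" using sub X(2) by blast
  then show ?thesis using Jordan_curve_closed_disk[OF c] by simp
qed

lemma toC_cball: "toC ` cball 0 1 = cball 0 1"
proof -
  have "toC -` cball 0 1 = cball 0 1" by (auto simp: toC_def cmod_def norm_prod_def)
  then show ?thesis using surj_image_vimage_eq[OF bij_is_surj[OF bij_toC]] by metis
qed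

lemma disk_like_if_complex_disk:
  assumes "toC ` X homeomorphic cball (0::complex) 1" shows "disk_like X"
  unfolding disk_like_def
  using assms homeomorphic_toC[of X] homeomorphic_toC[of "cball 0 1"] unfolding toC_cball
  by (meson homeomorphic_sym homeomorphic_trans)

lemma disk_like_if_bounded_by_arcs:
  assumes X: "compact X" and P: "arc_between P a b" and Q: "arc_between Q b a" and PQ: "P \<inter> Q \<subseteq> {a, b}"
    and W: "closed W" "X \<inter> W = P \<union> Q" "- W \<subseteq> X" "W \<noteq> UNIV"
  shows "disk_like X"
proof -
  obtain p where p: "arc p" "path_image p = P" "pathstart p = a" "pathfinish p = b" by (rule arc_betweenE[OF P])
  obtain q where q: "arc q" "path_image q = Q" "pathstart q = b" "pathfinish q = a" by (rule arc_betweenE[OF Q])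
  define c where "c = p +++ q"
  have c: "simple_path c" "pathfinish c = pathstart c"
    unfolding c_def using simple_path_join_loop[OF p(1) q(1)] p q PQ by simp_all
  have image: "path_image c = X \<inter> W" unfolding c_def W(2) using p q by (simp add: path_image_join)
  have simple: "simple_path (toC \<circ> c)" using c(1) inj_toC
    by (intro simple_path_continuous_image continuous_on_toC) (auto intro: inj_on_subset)
  have loop: "pathfinish (toC \<circ> c) = pathstart (toC \<circ> c)"
    using c(2) by (simp add: pathfinish_compose pathstart_compose)
  have rest: "toC ` X - path_image (toC \<circ> c) = toC ` (- W)"
    unfolding path_image_compose image image_set_diff[OF inj_toC, symmetric]
    using W(3) by (intro arg_cong[of _ _ "image toC"]) blast
  have "toC ` X homeomorphic cball (0::complex) 1"
  proof (rule Jordan_curve_closed_disk_if_clopen[OF simple loop])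
    show "compact (toC ` X)" using X by (intro compact_continuous_image continuous_on_toC)
    show "path_image (toC \<circ> c) \<subseteq> toC ` X" unfolding path_image_compose image by blast
    show "open (toC ` X - path_image (toC \<circ> c))"
      unfolding rest using homeomorphism_imp_open_map[OF toC_homeomorphism, of "- W"] W(1) by (simp add: open_Compl)
    show "toC ` X - path_image (toC \<circ> c) \<noteq> {}" unfolding rest using W(4) by blast
  qed
  then show ?thesis by (rule disk_like_if_complex_disk)
qed

lemma arc_between_shift:
  fixes a b v :: "'a::real_normed_vector"
  assumes "arc_between X a b" shows "arc_between {x. x - v \<in> X} (a + v) (b + v)"
proof -
  have "(\<lambda>x. x + v) ` X = {x. x - v \<in> X}" using mem_image_inverse[of "\<lambda>x. x - v" "\<lambda>x. x + v" _ X] by auto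
  then show ?thesis using arc_between_image[OF assms, of "\<lambda>x. x + v"] by (simp add: continuous_intros inj_on_def)
qed

lemma arc_between_reflect:
  fixes a b v :: "'a::real_normed_vector"
  assumes "arc_between X a b" shows "arc_between {x. v - x \<in> X} (v - a) (v - b)"
proof -
  have "(\<lambda>x. v - x) ` X = {x. v - x \<in> X}" using mem_image_inverse[of "\<lambda>x. v - x" "\<lambda>x. v - x" _ X] by auto
  then show ?thesis using arc_between_image[OF assms, of "\<lambda>x. v - x"] by (simp add: continuous_intros inj_on_def)
qed

context lattice_tile
begin

definition other_blocks :: "(real \<times> real) set" where
  "other_blocks = (\<Union>(p, q)\<in>- {(0, 0)}. {x. inS x p q})"

lemma mem_other_blocks: "x \<in> other_blocks \<longleftrightarrow> (\<exists>p q. (p \<noteq> 0 \<or> q \<noteq> 0) \<and> inS x p q)"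
  by (auto simp: other_blocks_def)

lemma closed_other_blocks: "closed other_blocks"
  unfolding other_blocks_def by (rule closed_lattice_translates)

lemma mem_S_or_other_blocks: "x \<in> S \<or> x \<in> other_blocks"
proof -
  obtain p q where "inS x p q" using covering by blast
  then show ?thesis by (cases "p = 0 \<and> q = 0") (auto simp: mem_other_blocks)
qed

lemma uminus_mem_other_blocks: "- x \<in> other_blocks \<longleftrightarrow> x \<in> other_blocks"
  unfolding mem_other_blocks inS_minus by (metis minus_minus neg_equal_0_iff_equal)

end

context half_tile
begin

text \<open>In the row \<open>q = 0\<close> the halves follow one another as \<open>\<dots>, half 0, half 1 = T, half 2, half 3, \<dots>\<close>.\<close>

definition half :: "int \<Rightarrow> (real \<times> real) set" where
  "half n = (if even n then {x. inU x (n div 2) 0} else {x. inT x (n div 2) 0})"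

lemma half_even: "half (2 * k) = {x. inU x k 0}" and half_odd: "half (2 * k + 1) = {x. inT x k 0}"
  by (simp_all add: half_def)

lemma half_0: "half 0 = {x. - x \<in> T}" and half_1: "half 1 = T"
  using half_even[of 0] half_odd[of 0] by simp_all

lemma half_cases:
  obtains (even) k where "n = 2 * k" "half n = {x. inU x k 0}"
  | (odd) k where "n = 2 * k + 1" "half n = {x. inT x k 0}"
  by (cases n rule: parity_cases) (metis half_even evenE even odd half_odd oddE)+

lemma half_block: "x \<in> half n \<Longrightarrow> inS x (n div 2) 0"
  by (auto simp: half_def inT_inS inU_inS split: if_splits)

lemma inS_half: "inS x p 0 \<longleftrightarrow> x \<in> half (2 * p) \<or> x \<in> half (2 * p + 1)"
  unfolding half_even half_odd by (auto simp: inS_iff)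

lemma mem_half_shift: "x - lv k 0 \<in> half n \<longleftrightarrow> x \<in> half (n + 2 * k)"
  by (auto simp: half_def inT_shift inU_shift add.commute)

lemma mem_half_reflect: "lv k 0 - x \<in> half n \<longleftrightarrow> x \<in> half (2 * k + 1 - n)"
proof (cases n rule: half_cases)
  case (even j)
  then have "half (2 * k + 1 - n) = {x. inT x (k - j) 0}" using half_odd[of "k - j"] by (simp add: algebra_simps)
  then show ?thesis unfolding even(2) by (simp add: inU_reflect)
next
  case (odd j)
  then have "half (2 * k + 1 - n) = {x. inU x (k - j) 0}" using half_even[of "k - j"] by (simp add: algebra_simps)
  then show ?thesis unfolding odd(2) by (simp add: inT_reflect)
qed

lemma closed_half: "closed (half n)"
  by (simp add: half_def compact_inT compact_inU compact_imp_closed)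

definition low :: "int \<Rightarrow> bool" where "low n \<longleftrightarrow> n = 0 \<or> odd n \<and> 1 \<le> n \<and> n \<le> 2 * B - 3"

definition high :: "int \<Rightarrow> bool" where "high n \<longleftrightarrow> n = 2 * B - 1 \<or> even n \<and> 2 \<le> n \<and> n \<le> 2 * B - 2"

lemma high_iff_low: "high n \<longleftrightarrow> low (2 * B - 1 - n)"
  by (auto simp: low_def high_def)

lemma ex_reflect: "(\<exists>n. P n) \<longleftrightarrow> (\<exists>n. P (c - n))" for c :: int
  by (metis diff_diff_eq2 add_diff_cancel_left')

lemma low_half: "inS y 0 0 \<or> (\<exists>k\<in>{1..B-2}. inT y k 0) \<longleftrightarrow> (\<exists>n. low n \<and> y \<in> half n)"
proof
  assume "inS y 0 0 \<or> (\<exists>k\<in>{1..B-2}. inT y k 0)"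
  then consider "y \<in> half 0" | "y \<in> half 1" | k where "k \<in> {1..B-2}" "y \<in> half (2 * k + 1)"
    unfolding inS_half by (auto simp: half_odd)
  then show "\<exists>n. low n \<and> y \<in> half n"
  proof cases
    case 1 then show ?thesis by (auto simp: low_def)
  next
    case 2 then show ?thesis using B_ge_2 by (intro exI[of _ 1]) (simp add: low_def)
  next
    case (3 k) then show ?thesis by (intro exI[of _ "2 * k + 1"]) (simp add: low_def)
  qed
next
  assume "\<exists>n. low n \<and> y \<in> half n"
  then obtain n where n: "low n" "y \<in> half n" by blast
  show "inS y 0 0 \<or> (\<exists>k\<in>{1..B-2}. inT y k 0)"
  proof (cases "n div 2 = 0")
    case True then show ?thesis using half_block[OF n(2)] by simp
  next
    case False
    then have "inT y (n div 2) 0" "n div 2 \<in> {1..B-2}" using n by (auto simp: half_def low_def)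
    then show ?thesis by blast
  qed
qed

lemma high_half: "inS y (B-1) 0 \<or> (\<exists>k\<in>{1..B-2}. inU y k 0) \<longleftrightarrow> (\<exists>n. high n \<and> y \<in> half n)"
proof -
  define y' where "y' = lv (B-1) 0 - y"
  have "inS y (B-1) 0 \<or> (\<exists>k\<in>{1..B-2}. inU y k 0) \<longleftrightarrow> inS y' 0 0 \<or> (\<exists>k\<in>{1..B-2}. inT y' (B-1-k) 0)"
    unfolding y'_def by (simp add: inS_reflect inT_reflect del: inS_00)
  also have "(\<exists>k\<in>{1..B-2}. inT y' (B-1-k) 0) \<longleftrightarrow> (\<exists>k\<in>{1..B-2}. inT y' k 0)"
    by (rule ex_reflect_atLeastAtMost) simp
  also note low_half
  also have "(\<exists>n. low n \<and> y' \<in> half n) \<longleftrightarrow> (\<exists>n. low (2 * B - 1 - n) \<and> y' \<in> half (2 * B - 1 - n))"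
    by (rule ex_reflect)
  also have "\<dots> \<longleftrightarrow> (\<exists>n. high n \<and> y \<in> half n)"
    unfolding y'_def mem_half_reflect high_iff_low by simp
  finally show ?thesis .
qed

end

text \<open>The image of \<open>T \<inter> - T\<close> under \<open>g\<close> is a chain of \<open>2 * B - 1\<close> intersections of halves that are two steps apart at
  both ends of the chain and one step apart in between. Every second inner link is a translate of \<open>T \<inter> - T\<close> itself.\<close>

locale row_tile = half_tile +
  assumes row_distance: "\<And>x p p'. inS x p 0 \<Longrightarrow> inS x p' 0 \<Longrightarrow> \<bar>p' - p\<bar> \<le> 1"
    and zero_block: "\<And>p q. inS 0 p q \<Longrightarrow> p = 0 \<and> q = 0"
    and halves_disjoint: "\<And>x. \<not> (inU x 0 0 \<and> inT x 1 0)"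
    and center_rec: "\<And>x. x \<in> T \<and> - x \<in> T \<longleftrightarrow>
      (inS (gmap A B x) 0 0 \<or> (\<exists>k\<in>{1..B-2}. inT (gmap A B x) k 0)) \<and>
      (inS (gmap A B x) (B-1) 0 \<or> (\<exists>k\<in>{1..B-2}. inU (gmap A B x) k 0))"
    and center_other_rows: "\<And>x p q. x \<in> T \<Longrightarrow> q \<noteq> 0 \<Longrightarrow> inS x p q \<Longrightarrow> - x \<notin> T"
begin

lemma half_far:
  assumes "n + 2 < n'" shows "half n \<inter> half n' = {}"
proof (rule ccontr)
  assume "half n \<inter> half n' \<noteq> {}"
  then obtain x where x: "x \<in> half n" "x \<in> half n'" by blast
  then have "n' div 2 \<le> n div 2 + 1" using row_distance[OF half_block half_block, of x n n'] by auto
  then have "even n" "n' = n + 3" using assms by presburger+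
  then have "inU x (n div 2) 0" "inT x (n div 2 + 1) 0" using x by (auto simp: half_def elim!: evenE)
  then show False using halves_disjoint[of "x - lv (n div 2) 0"]
    by (simp add: inT_shift inU_shift add.commute del: inU_00)
qed

definition n_links :: nat where "n_links = nat (2 * B - 1)"

lemma n_links: "3 \<le> n_links" "odd n_links" "int n_links = 2 * B - 1"
  using B_ge_2 by (auto simp: n_links_def even_nat_iff)

definition link :: "nat \<Rightarrow> (real \<times> real) set" where
  "link i = half (int (min i (n_links - 2))) \<inter> half (int (max (i + 1) 2))"

lemma link_first: "link 0 = half 0 \<inter> half 2"
  and link_last: "link (n_links - 1) = half (int n_links - 2) \<inter> half (int n_links)"
  using n_links(1) by (simp_all add: link_def of_nat_diff)

lemma link_inner:
  assumes "i \<noteq> 0" "i < n_links - 1" shows "link i = half (int i) \<inter> half (int i + 1)"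
proof -
  have "min i (n_links - 2) = i" "max (i + 1) 2 = i + 1" using assms by auto
  then show ?thesis by (simp add: link_def add.commute)
qed

lemma links_disjoint:
  assumes "Suc i < j" shows "link i \<inter> link j = {}"
proof -
  have "int (min i (n_links - 2)) + 2 < int (max (j + 1) 2)" using assms by linarith
  then show ?thesis using half_far unfolding link_def by blast
qed

lemma adjacent_links:
  assumes "Suc i < n_links" shows "link i \<inter> link (Suc i) \<subseteq> half (int i) \<inter> half (int i + 1) \<inter> half (int i + 2)"
proof (cases "i = 0")
  case True
  then show ?thesis using link_first link_inner[of 1] link_last n_links(1) by (cases "n_links = 3") auto
next
  case False
  show ?thesis
  proof (cases "Suc i = n_links - 1")
    case True
    then have "int i = int n_links - 2" using n_links(1) by linarith
    then show ?thesis using False assms link_inner[of i] link_last True by auto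
  next
    case outer: False
    then show ?thesis using False assms link_inner[of i] link_inner[of "Suc i"] by (auto simp: add.commute)
  qed
qed

definition center :: "(real \<times> real) set" where "center = half 0 \<inter> half 1"

lemma mem_center: "x \<in> center \<longleftrightarrow> x \<in> T \<and> - x \<in> T"
  by (auto simp: center_def half_0 half_1)

lemma compact_center: "compact center"
  unfolding center_def half_1 by (simp add: closed_Int_compact closed_half T_compact)

lemma mem_center_iff_low_high: "x \<in> center \<longleftrightarrow> (\<exists>n n'. low n \<and> high n' \<and> g x \<in> half n \<inter> half n')"
  unfolding mem_center center_rec low_half high_half by blast

lemma link_if_low_high:
  assumes "low n" "high n'" "half n \<inter> half n' \<noteq> {}" shows "\<exists>i<n_links. link i = half n \<inter> half n'"
proof -
  have near: "n' \<le> n + 2" "n \<le> n' + 2"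
    using half_far[of n n'] half_far[of n' n] assms(3) by (blast intro: leI dest: not_le_imp_less)+
  have bounds: "low n \<Longrightarrow> n \<le> int n_links - 2" "high n' \<Longrightarrow> 2 \<le> n'" using n_links by (auto simp: low_def high_def)
  from assms(1,2) consider "n = 0" | "n' = int n_links" "n \<noteq> 0" | "odd n" "even n'" "1 \<le> n" "n' < int n_links"
    unfolding low_def high_def n_links(3) by fastforce
  then show ?thesis
  proof cases
    case 1
    then have "n' = 2" using near bounds assms by simp
    then show ?thesis using 1 n_links link_first by (intro exI[of _ 0]) simp
  next
    case 2
    then have "n = int n_links - 2" using near bounds assms by simp
    then show ?thesis using 2 n_links link_last by (intro exI[of _ "n_links - 1"]) simp
  next
    case 3
    then have "n' = n + 1 \<or> n = n' + 1" using near by presburger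
    then show ?thesis
    proof
      assume "n' = n + 1"
      then show ?thesis using 3 n_links link_inner[of "nat n"] bounds assms by (intro exI[of _ "nat n"]) auto
    next
      assume "n = n' + 1"
      then show ?thesis using n_links link_inner[of "nat n'"] bounds assms by (intro exI[of _ "nat n'"]) auto
    qed
  qed
qed

lemma low_high_if_link:
  assumes "i < n_links" shows "\<exists>n n'. low n \<and> high n' \<and> link i = half n \<inter> half n'"
proof -
  consider "i = 0" | "i = n_links - 1" | "i \<noteq> 0" "i < n_links - 1" "odd i" | "i \<noteq> 0" "i < n_links - 1" "even i"
    using assms by linarith
  then show ?thesis
  proof cases
    case 1 then show ?thesis using link_first B_ge_2 by (intro exI[of _ 0] exI[of _ 2]) (simp add: low_def high_def)
  next
    case 2 then show ?thesis using link_last n_links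
      by (intro exI[of _ "int n_links - 2"] exI[of _ "int n_links"]) (simp add: low_def high_def)
  next
    case 3 then show ?thesis using link_inner n_links
      by (intro exI[of _ "int i"] exI[of _ "int i + 1"]) (auto simp: low_def high_def)
  next
    case 4
    then have "int i + 1 \<le> int n_links - 2" using n_links by presburger
    then show ?thesis using 4 link_inner n_links
      by (intro exI[of _ "int i + 1"] exI[of _ "int i"]) (auto simp: low_def high_def)
  qed
qed

lemma mem_center_iff_link: "x \<in> center \<longleftrightarrow> (\<exists>i<n_links. g x \<in> link i)"
  using mem_center_iff_low_high[of x] link_if_low_high low_high_if_link by blast

lemma preimage_of_zero: "gi 0 \<notin> center" "gi 0 \<notin> other_blocks"
proof -
  show "gi 0 \<notin> center"
  proof
    assume "gi 0 \<in> center"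
    then obtain i where "i < n_links" "0 \<in> half (int (max (i + 1) 2))"
      unfolding mem_center_iff_link link_def by auto
    then have "int (max (i + 1) 2) div 2 = 0" using half_block zero_block by blast
    then show False by simp
  qed
  show "gi 0 \<notin> other_blocks"
  proof
    assume "gi 0 \<in> other_blocks"
    then obtain p q where pq: "p \<noteq> 0 \<or> q \<noteq> 0" "inS (gi 0) p q" unfolding mem_other_blocks by blast
    obtain k where k: "k \<in> {0..B-1}" "inS 0 (k - B * q) (p - A * q)"
      using pq(2) unfolding inS_rec[of "gi 0"] g_gi by blast
    then have "k = B * q" "p = A * q" using zero_block[OF k(2)] by auto
    then have "0 \<le> B * q" "B * q < B * 1" using k(1) by auto
    then have "q = 0" using B_ge_2 by (auto simp: zero_le_mult_iff mult_less_cancel_left)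
    then show False using pq \<open>p = A * q\<close> by simp
  qed
qed

end

text \<open>The boundary of \<open>T = half 1\<close> consists of \<open>T \<inter> - T\<close>, of the intersections of \<open>T\<close> with \<open>half 2\<close>, \<open>half 3\<close> and
  \<open>half (-1)\<close>, and of its \<open>cap\<close>, where it meets the other rows.\<close>

locale boundary_arcs = row_tile +
  fixes a w :: "real \<times> real"
  assumes right_arc: "arc_between (half 1 \<inter> half 3) a (lv 1 0 - w)"
    and middle_arc: "arc_between (half 1 \<inter> half 2) (lv 1 0 - w) w"
    and cap_arc: "arc_between {x \<in> T. \<exists>p q. q \<noteq> 0 \<and> inS x p q} a (a - lv 1 0)"
    and joint_unique: "half 1 \<inter> half 2 \<inter> half 3 \<subseteq> {lv 1 0 - w}"
    and cap_right: "\<And>x p q. x \<in> T \<Longrightarrow> q \<noteq> 0 \<Longrightarrow> inS x p q \<Longrightarrow> inS x 1 0 \<Longrightarrow> x = a"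
    and cap_left: "\<And>x p q. x \<in> T \<Longrightarrow> q \<noteq> 0 \<Longrightarrow> inS x p q \<Longrightarrow> inS x (-1) 0 \<Longrightarrow> x = a - lv 1 0"
    and center_end: "gmap A B w = lv 1 0 - a \<or> gmap A B (- w) = lv 1 0 - a"
begin

definition joint :: "int \<Rightarrow> real \<times> real" where
  "joint n = (if even n then w else lv 1 0 - w) + lv (n div 2) 0"

lemma three_halves: "half n \<inter> half (n + 1) \<inter> half (n + 2) \<subseteq> {joint n}"
proof
  fix x assume x: "x \<in> half n \<inter> half (n + 1) \<inter> half (n + 2)"
  define k where "k = n div 2"
  show "x \<in> {joint n}"
  proof (cases "even n")
    case True
    then have n: "n = 2 * k" by (simp add: k_def)
    have "lv (k + 1) 0 - x \<in> half 1 \<inter> half 2 \<inter> half 3"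
      unfolding Int_iff mem_half_reflect using x by (simp add: n add.commute)
    then have "lv (k + 1) 0 - x = lv 1 0 - w" using joint_unique by blast
    then have "x = lv (k + 1) 0 - (lv 1 0 - w)" by (simp add: algebra_simps)
    then show ?thesis by (simp add: n joint_def lv_def prod_eq_iff)
  next
    case False
    then have n: "n = 2 * k + 1" by (simp add: k_def)
    have "x - lv k 0 \<in> half 1 \<inter> half 2 \<inter> half 3"
      unfolding Int_iff mem_half_shift using x by (simp add: n add.commute)
    then have "x - lv k 0 = lv 1 0 - w" using joint_unique by blast
    then have "x = lv 1 0 - w + lv k 0" by (simp add: algebra_simps)
    then show ?thesis by (simp add: n joint_def)
  qed
qed

definition point :: "nat \<Rightarrow> real \<times> real" where
  "point i = (if i = 0 then lv 1 0 - a else if i = n_links then a + lv (B-2) 0 else joint (int i - 1))"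

lemma given_link:
  assumes "i < n_links" "i = 0 \<or> i = n_links - 1 \<or> odd i" shows "arc_between (link i) (point i) (point (Suc i))"
proof -
  consider "i = 0" | "i = n_links - 1" | k where "i = 2 * k + 1" "i \<noteq> 0" "i < n_links - 1"
    using assms by (cases "i = 0 \<or> i = n_links - 1") (auto elim!: oddE)
  then show ?thesis
  proof cases
    case 1
    have "{x. lv 1 0 - x \<in> half 1 \<inter> half 3} = link 0" unfolding link_first Int_iff mem_half_reflect by auto
    moreover have "lv 1 0 - a = point 0" "lv 1 0 - (lv 1 0 - w) = point (Suc 0)"
      using n_links by (simp_all add: point_def joint_def lv_def prod_eq_iff)
    ultimately show ?thesis using arc_between_reflect[OF right_arc, of "lv 1 0"] 1 by simp
  next
    case 2
    have "{x. x - lv (B-2) 0 \<in> half 1 \<inter> half 3} = link (n_links - 1)"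
      unfolding link_last Int_iff mem_half_shift n_links(3) by (auto simp: algebra_simps)
    moreover have "(2 * B - 3) div 2 = B - 2" "n_links - 1 \<noteq> n_links" using n_links by auto
    then have "lv 1 0 - w + lv (B-2) 0 = point (n_links - 1)" "a + lv (B-2) 0 = point (Suc (n_links - 1))"
      using n_links by (simp_all add: point_def joint_def of_nat_diff)
    ultimately show ?thesis using arc_between_shift[OF arc_between_reverse[OF right_arc], of "lv (B-2) 0"] 2 by simp
  next
    case 3
    have "{x. x - lv k 0 \<in> half 1 \<inter> half 2} = link i"
      unfolding link_inner[OF 3(2,3)] Int_iff mem_half_shift using 3(1) by (auto simp: algebra_simps)
    moreover have "i \<noteq> n_links" "Suc i \<noteq> n_links" using 3(3) by auto
    then have "w + lv k 0 = point i" "lv 1 0 - w + lv k 0 = point (Suc i)"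
      using 3(1,2) by (simp_all add: point_def joint_def)
    ultimately show ?thesis using arc_between_shift[OF arc_between_reverse[OF middle_arc], of "lv k 0"] by simp
  qed
qed

definition sign :: real where "sign = (if gmap A B w = lv 1 0 - a then -1 else 1)"

lemma sign_cases: "sign = 1 \<or> sign = -1" by (simp add: sign_def)

lemma sign_square [simp]: "sign * sign = 1"
  using sign_cases by auto

lemma sign_center: "sign *\<^sub>R x \<in> center \<longleftrightarrow> x \<in> center"
  using sign_cases by (auto simp: mem_center)

lemma gi_point_ends: "gi (point 0) = - sign *\<^sub>R w" "gi (point n_links) = sign *\<^sub>R w"
proof -
  have g: "g (- sign *\<^sub>R w) = lv 1 0 - a" using center_end by (auto simp: sign_def)
  then have "gi (lv 1 0 - a) = - sign *\<^sub>R w" by (metis gi_g)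
  then show "gi (point 0) = - sign *\<^sub>R w" by (simp add: point_def)
  have "g (sign *\<^sub>R w) = lv (B-1) 0 - g (- sign *\<^sub>R w)" using gmap_minus[of A B "- sign *\<^sub>R w"] by simp
  also have "\<dots> = point n_links" unfolding g using n_links by (simp add: point_def lv_def prod_eq_iff)
  finally show "gi (point n_links) = sign *\<^sub>R w" by (metis gi_g)
qed

definition center_copy :: "nat \<Rightarrow> real \<times> real \<Rightarrow> real \<times> real" where
  "center_copy i x = gi (sign *\<^sub>R x + lv (int (i div 2)) 0)"

lemma contraction_center_copy: "contraction (center_copy i)"
proof -
  have "N (sign *\<^sub>R p + lv (int (i div 2)) 0 - (sign *\<^sub>R q + lv (int (i div 2)) 0)) \<le> N (p - q)" for p q
    using sign_cases N_minus[of "p - q"] by auto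
  then show ?thesis unfolding center_copy_def[abs_def] by (rule contraction_comp[OF contraction_ginv])
qed

lemma inj_center_copy: "inj (center_copy i)"
  by (rule injI) (use sign_cases in \<open>auto simp: center_copy_def dest!: injD[OF inj_gi]\<close>)

lemma center_copy_image:
  assumes "even i" "i \<noteq> 0" "i < n_links - 1" shows "gi ` link i = center_copy i ` center"
proof (rule set_eqI)
  fix x
  define k where "k = int (i div 2)"
  have k: "int i = 2 * k" using assms(1) by (auto simp: k_def)
  have "x \<in> center_copy i ` center \<longleftrightarrow> sign *\<^sub>R (g x - lv k 0) \<in> center"
    by (rule mem_image_inverse) (simp_all add: center_copy_def k_def)
  also have "\<dots> \<longleftrightarrow> g x \<in> link i"
    unfolding sign_center link_inner[OF assms(2,3)] by (simp add: center_def mem_half_shift k add.commute)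
  finally show "x \<in> gi ` link i \<longleftrightarrow> x \<in> center_copy i ` center" by (simp add: mem_gi_image)
qed

lemma center_copy_ends:
  assumes "even i" "i \<noteq> 0" "i < n_links - 1"
  shows "center_copy i (gi (point 0)) = gi (point i)" "center_copy i (gi (point n_links)) = gi (point (Suc i))"
proof -
  define k where "k = int (i div 2)"
  have k: "int i = 2 * k" using assms(1) by (auto simp: k_def)
  have "(2 * k - 1) div 2 = k - 1" "i \<noteq> n_links" using assms by auto
  then have "point i = - w + lv k 0" using assms by (simp add: point_def joint_def k lv_def prod_eq_iff)
  then show "center_copy i (gi (point 0)) = gi (point i)"
    unfolding gi_point_ends center_copy_def by (simp add: k_def)
  have "Suc i \<noteq> n_links" using assms(3) by auto
  then have "point (Suc i) = w + lv k 0" using assms by (simp add: point_def joint_def k)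
  then show "center_copy i (gi (point n_links)) = gi (point (Suc i))"
    unfolding gi_point_ends center_copy_def by (simp add: k_def)
qed

lemma center_arc: "arc_between center (- w) w"
proof -
  interpret chain: arc_chain N lam c0 c1 center "\<lambda>i. gi ` link i" "\<lambda>i. gi (point i)"
    center_copy "{i. even i \<and> i \<noteq> 0 \<and> i < n_links - 1}" n_links
  proof
    show "3 \<le> n_links" by (rule n_links)
    show "compact center" by (rule compact_center)
    show K: "center = (\<Union>i<n_links. gi ` link i)"
      by (rule set_eqI) (simp only: mem_center_iff_link UN_iff mem_gi_image Bex_def lessThan_iff)
    have "point 0 \<in> link 0" using arc_between_ends(1)[OF given_link[of 0]] n_links by simp
    then show "center \<noteq> {}" unfolding K using n_links by force
    show "gi ` link i = center_copy i ` center \<and> center_copy i (gi (point 0)) = gi (point i) \<and>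
        center_copy i (gi (point n_links)) = gi (point (Suc i)) \<and> inj (center_copy i) \<and> contraction (center_copy i)"
      if "i \<in> {i. even i \<and> i \<noteq> 0 \<and> i < n_links - 1}" for i
      using that by (intro conjI center_copy_image center_copy_ends inj_center_copy contraction_center_copy) simp_all
    show "arc_between (gi ` link i) (gi (point i)) (gi (point (Suc i)))"
      if "i < n_links" "i \<notin> {i. even i \<and> i \<noteq> 0 \<and> i < n_links - 1}" for i
      using that inj_gi by (intro arc_between_image given_link continuous_on_gi) (auto intro: inj_on_subset)
    show "gi ` link i \<inter> gi ` link j = {}" if "Suc i < j" for i j
      using links_disjoint[OF that] inj_gi by (simp add: image_Int[symmetric])
    show "gi ` link i \<inter> gi ` link (Suc i) \<subseteq> {gi (point (Suc i))}" if "Suc i < n_links" for i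
    proof -
      have "link i \<inter> link (Suc i) \<subseteq> {point (Suc i)}"
        using adjacent_links[OF that] three_halves[of "int i"] that by (auto simp: point_def)
      then show ?thesis using inj_gi by (auto simp: image_Int[symmetric])
    qed
  qed
  have "arc_between center (- sign *\<^sub>R w) (sign *\<^sub>R w)" using chain.chain_arc unfolding gi_point_ends .
  then show ?thesis using sign_cases arc_between_reverse by auto
qed

definition cap :: "(real \<times> real) set" where "cap = {x \<in> T. \<exists>p q. q \<noteq> 0 \<and> inS x p q}"

lemma half_3_block: "x \<in> half 3 \<Longrightarrow> inS x 1 0" and half_2_block: "x \<in> half 2 \<Longrightarrow> inS x 1 0"
  and half_minus1_block: "x \<in> half (-1) \<Longrightarrow> inS x (-1) 0"
  using half_block[of x] by force+

lemma cap_meets: "cap \<inter> half 0 = {}" "cap \<inter> half 2 = {}" "cap \<inter> half 3 \<subseteq> {a}" "cap \<inter> half (-1) \<subseteq> {a - lv 1 0}"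
proof -
  show "cap \<inter> half 0 = {}" using center_other_rows unfolding cap_def half_0 by blast
  show "cap \<inter> half 3 \<subseteq> {a}" using cap_right half_3_block unfolding cap_def by blast
  show "cap \<inter> half (-1) \<subseteq> {a - lv 1 0}" using cap_left half_minus1_block unfolding cap_def by blast
  have "cap \<inter> half 2 \<subseteq> {a} \<inter> (half 1 \<inter> half 2)" using cap_right half_2_block unfolding cap_def half_1 by blast
  moreover have "a \<in> half 1 \<inter> half 3" "a \<noteq> lv 1 0 - w" using arc_between_ends[OF right_arc] by auto
  ultimately show "cap \<inter> half 2 = {}" using joint_unique by blast
qed

lemma boundary_eq:
  "T \<inter> (half 0 \<union> other_blocks) = (center \<union> ((half 1 \<inter> half 2) \<union> ((half 1 \<inter> half 3) \<union> cap))) \<union> (half (-1) \<inter> half 1)"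
proof -
  have cover: "T \<inter> other_blocks \<subseteq> half (-1) \<union> half 2 \<union> half 3 \<union> cap"
  proof
    fix x assume "x \<in> T \<inter> other_blocks"
    then obtain p q where x: "x \<in> T" "p \<noteq> 0 \<or> q \<noteq> 0" "inS x p q" by (auto simp only: Int_iff mem_other_blocks)
    show "x \<in> half (-1) \<union> half 2 \<union> half 3 \<union> cap"
    proof (cases "q = 0")
      case True
      have "inS x 0 0" using x(1) by (simp add: S_T)
      then have "\<bar>p\<bar> \<le> 1" using row_distance[of x 0 p] x(3) True by simp
      then have "p = 1 \<or> p = -1" using x(2) True by auto
      then have "x \<in> half 2 \<union> half 3 \<union> half (-2) \<union> half (-1)" using x(3) True inS_half[of x p] by auto
      moreover have "x \<notin> half (-2)" using half_far[of "-2" 1] x(1) by (auto simp: half_1)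
      ultimately show ?thesis by blast
    next
      case False then show ?thesis using x unfolding cap_def by blast
    qed
  qed
  have other: "x \<in> other_blocks" if "inS x p q" "p \<noteq> 0 \<or> q \<noteq> 0" for x p q
    using that unfolding mem_other_blocks by blast
  have "half (-1) \<union> half 2 \<union> half 3 \<subseteq> other_blocks"
    using other[OF half_3_block] other[OF half_2_block] other[OF half_minus1_block] by auto
  moreover have "cap \<subseteq> T \<inter> other_blocks" unfolding cap_def using other by blast
  ultimately show ?thesis using cover unfolding center_def half_1 by blast
qed

lemma interior_point: "half 0 \<union> other_blocks \<noteq> UNIV"
proof (cases "gi 0 \<in> half 0")
  case True
  then have "- gi 0 \<notin> half 0" using preimage_of_zero(1) by (auto simp: center_def half_0 half_1)
  then show ?thesis using preimage_of_zero(2) uminus_mem_other_blocks by blast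
qed (use preimage_of_zero(2) in blast)

theorem disk_like_T: "disk_like T"
proof (rule disk_like_if_bounded_by_arcs[OF T_compact _ _ _ _ boundary_eq])
  have "arc_between ((half 1 \<inter> half 3) \<union> cap) (lv 1 0 - w) (a - lv 1 0)"
    using arc_between_join[OF arc_between_reverse[OF right_arc] cap_arc[folded cap_def]] cap_meets(3) by blast
  then have "arc_between ((half 1 \<inter> half 2) \<union> ((half 1 \<inter> half 3) \<union> cap)) w (a - lv 1 0)"
    using joint_unique cap_meets(2) by (intro arc_between_join[OF arc_between_reverse[OF middle_arc]]) blast+
  moreover have "center \<inter> ((half 1 \<inter> half 2) \<union> ((half 1 \<inter> half 3) \<union> cap)) \<subseteq> {w}"
    using three_halves[of 0] half_far[of 0 3] cap_meets(1) by (auto simp: center_def joint_def)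
  ultimately show "arc_between (center \<union> ((half 1 \<inter> half 2) \<union> ((half 1 \<inter> half 3) \<union> cap))) (- w) (a - lv 1 0)"
    by (rule arc_between_join[OF center_arc])
  have left_joint: "joint (-1) = - w" by (simp add: joint_def lv_def prod_eq_iff)
  have "{x. x - lv (-1) 0 \<in> half 1 \<inter> half 3} = half (-1) \<inter> half 1" unfolding Int_iff mem_half_shift by auto
  moreover have "a + lv (-1) 0 = a - lv 1 0" "lv 1 0 - w + lv (-1) 0 = - w" by (simp_all add: lv_def prod_eq_iff)
  ultimately show "arc_between (half (-1) \<inter> half 1) (a - lv 1 0) (- w)"
    using arc_between_shift[OF right_arc, of "lv (-1) 0"] by (simp only:)
  show "(center \<union> ((half 1 \<inter> half 2) \<union> ((half 1 \<inter> half 3) \<union> cap))) \<inter> (half (-1) \<inter> half 1) \<subseteq> {- w, a - lv 1 0}"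
    using three_halves[of "-1"] half_far[of "-1" 2] half_far[of "-1" 3] cap_meets(4) left_joint
    by (auto simp: center_def)
  show "closed (half 0 \<union> other_blocks)" by (intro closed_Un closed_half closed_other_blocks)
  show "- (half 0 \<union> other_blocks) \<subseteq> T" using mem_S_or_other_blocks S_T by (auto simp: half_0)
  show "half 0 \<union> other_blocks \<noteq> UNIV" by (rule interior_point)
qed

end

section \<open>The sides of the lattice tile for A = 1\<close>

text \<open>Under \<open>g\<close> the right side \<open>side 1 0\<close> is an alternating chain of translates of the top side \<open>side 0 1\<close> and the
  upper side \<open>side 1 1\<close>, both of which are contracted copies of the right side.\<close>

locale lattice_tile_A1 = six_neighbour_tile N lam c0 c1 1 B S for N lam c0 c1 B S
begin

lemma next_row_neighbours: "inS x k q \<Longrightarrow> inS x j (q + 1) \<Longrightarrow> j = k \<or> j = k + 1"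
  using neighbours[of x k q j "q + 1"] by auto

lemma mem_side_top: "x \<in> side 0 1 \<longleftrightarrow> g x + lv 1 1 \<in> side 1 1"
proof
  assume "x \<in> side 0 1"
  then have x: "inS x 0 0" "inS x 0 1" by (auto simp: side_def)
  obtain k where k: "k \<in> {0..B-1}" "inS (g x) k 0" using inS_rec[of x 0 0] x(1) by auto
  obtain n where n: "n \<in> {0..B-1}" "inS (g x) (n - B) (-1)" using inS_rec[of x 0 1] x(2) by auto
  have "k = 0" "n - B = -1" using neighbours[OF n(2) k(2)] k(1) n(1) by auto
  then show "g x + lv 1 1 \<in> side 1 1" using k n by (simp add: side_def inS_plus del: inS_00)
next
  assume "g x + lv 1 1 \<in> side 1 1"
  then have gx: "inS (g x) 0 0" "inS (g x) (-1) (-1)" by (simp_all add: side_def inS_plus del: inS_00)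
  have "inS (g x) (0 - B * 0) (0 - 1 * 0)" "0 \<in> {0..B-1}" using gx B_ge_2 by auto
  then have "inS x 0 0" using inS_rec[of x 0 0] by blast
  moreover have "inS (g x) (B - 1 - B * 1) (0 - 1 * 1)" "B - 1 \<in> {0..B-1}" using gx B_ge_2 by auto
  then have "inS x 0 1" using inS_rec[of x 0 1] by blast
  ultimately show "x \<in> side 0 1" by (simp add: side_def)
qed

definition to_upper :: "real \<times> real \<Rightarrow> real \<times> real" where "to_upper x = gi (- x)"

definition to_top :: "real \<times> real \<Rightarrow> real \<times> real" where "to_top x = gi (gi (x - lv 1 0) - lv 1 1)"

lemma to_upper_image: "to_upper ` side 1 0 = side 1 1"
proof (rule set_eqI)
  fix x
  have "x \<in> to_upper ` side 1 0 \<longleftrightarrow> - g x \<in> side 1 0" by (rule mem_image_inverse) (simp_all add: to_upper_def)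
  then show "x \<in> to_upper ` side 1 0 \<longleftrightarrow> x \<in> side 1 1" using mem_side_upper_minus by simp
qed

lemma to_top_image: "to_top ` side 1 0 = side 0 1"
proof (rule set_eqI)
  fix x
  have "x \<in> to_top ` side 1 0 \<longleftrightarrow> g (g x + lv 1 1) + lv 1 0 \<in> side 1 0"
    by (rule mem_image_inverse) (simp_all add: to_top_def)
  also have "\<dots> \<longleftrightarrow> x \<in> side 0 1" unfolding mem_side_top mem_side_upper_shift ..
  finally show "x \<in> to_top ` side 1 0 \<longleftrightarrow> x \<in> side 0 1" .
qed

lemma to_upper_ends: "to_upper vertex1 = vertex2" "to_upper (lv 1 0 - vertex1) = vertex1"
  using gi_vertex by (simp_all add: to_upper_def)

lemma to_top_ends: "to_top vertex1 = vertex1 - lv 1 0" "to_top (lv 1 0 - vertex1) = vertex2"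
proof -
  show "to_top vertex1 = vertex1 - lv 1 0" by (simp add: to_top_def gi_vertex)
  have "lv 1 0 - vertex1 - lv 1 0 = - vertex1" "vertex2 - lv 1 1 = - vertex1" by (simp_all add: vertex2_def)
  then show "to_top (lv 1 0 - vertex1) = vertex2" by (simp only: to_top_def gi_vertex)
qed

lemma contraction_to_upper: "contraction to_upper"
proof -
  have "N (- p - - q) = N (p - q)" for p q using N_minus[of "p - q"] by simp
  then show ?thesis unfolding to_upper_def[abs_def] by (intro contraction_comp[OF contraction_ginv]) simp
qed

lemma contraction_to_top: "contraction to_top"
proof -
  have "contraction (\<lambda>x. gi (x - lv 1 0))" by (rule contraction_comp[OF contraction_ginv]) simp
  from contraction_nonexpansive[OF this] show ?thesis
    unfolding to_top_def[abs_def] by (intro contraction_comp[OF contraction_ginv]) simp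
qed

lemma inj_to_upper: "inj to_upper" and inj_to_top: "inj to_top"
  by (rule injI; auto simp: to_upper_def to_top_def dest!: injD[OF inj_gi])+

definition n_parts :: nat where "n_parts = nat (2 * B - 1)"

lemma n_parts: "3 \<le> n_parts" "odd n_parts" "int n_parts = 2 * B - 1"
  using B_ge_2 by (auto simp: n_parts_def even_nat_iff)

definition side_part :: "nat \<Rightarrow> (real \<times> real) set" where
  "side_part i = {x. inS (g x) (int (i div 2)) 0 \<and> inS (g x) (int ((i + 1) div 2)) 1}"

definition side_point :: "nat \<Rightarrow> real \<times> real" where
  "side_point i = gi (if even i then vertex1 + lv (int (i div 2) - 1) 0 else vertex2 + lv (int (i div 2)) 0)"

definition side_copy :: "nat \<Rightarrow> real \<times> real \<Rightarrow> real \<times> real" where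
  "side_copy i x = gi ((if even i then to_top x else to_upper x) + lv (int (i div 2)) 0)"

lemma mem_side_part: "x \<in> side_part i \<longleftrightarrow> g x - lv (int (i div 2)) 0 \<in> (if even i then side 0 1 else side 1 1)"
proof -
  have "int ((i + 1) div 2) = (if even i then int (i div 2) else int (i div 2) + 1)" by auto
  then show ?thesis by (auto simp: side_part_def side_def inS_shift add.commute simp del: inS_00)
qed

lemma mem_side_right: "x \<in> side 1 0 \<longleftrightarrow> (\<exists>k\<in>{0..B-1}. inS (g x) k 0) \<and> (\<exists>j\<in>{0..B-1}. inS (g x) j 1)"
  unfolding side_def mem_Collect_eq using inS_rec[of x 0 0] inS_rec[of x 1 0] by simp

lemma side_part_if_digits:
  assumes "0 \<le> k" "inS (g x) k 0" "inS (g x) j 1"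
  obtains i where "int (i div 2) = k" "int ((i + 1) div 2) = j" "x \<in> side_part i"
proof -
  have "j = k \<or> j = k + 1" using next_row_neighbours[of "g x" k 0 j] assms(2,3) by simp
  then have "int (nat (k + j) div 2) = k" "int ((nat (k + j) + 1) div 2) = j" using assms(1) by auto
  then show thesis using that[of "nat (k + j)"] assms by (simp add: side_part_def)
qed

lemma side_parts_eq:
  assumes "K \<subseteq> {0..}" "\<And>i. i \<in> I \<longleftrightarrow> int (i div 2) \<in> K \<and> int ((i + 1) div 2) \<in> J"
  shows "{x. (\<exists>k\<in>K. inS (g x) k 0) \<and> (\<exists>j\<in>J. inS (g x) j 1)} = (\<Union>i\<in>I. side_part i)"
proof (intro equalityI subsetI)
  fix x assume "x \<in> {x. (\<exists>k\<in>K. inS (g x) k 0) \<and> (\<exists>j\<in>J. inS (g x) j 1)}"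
  then obtain k j where kj: "k \<in> K" "inS (g x) k 0" "j \<in> J" "inS (g x) j 1" by blast
  then obtain i where "int (i div 2) = k" "int ((i + 1) div 2) = j" "x \<in> side_part i"
    using side_part_if_digits assms(1) by (metis atLeast_iff subsetD)
  then show "x \<in> (\<Union>i\<in>I. side_part i)" using kj assms(2) by blast
next
  fix x assume "x \<in> (\<Union>i\<in>I. side_part i)"
  then obtain i where "i \<in> I" "x \<in> side_part i" by blast
  then show "x \<in> {x. (\<exists>k\<in>K. inS (g x) k 0) \<and> (\<exists>j\<in>J. inS (g x) j 1)}" using assms(2) by (auto simp: side_part_def)
qed

lemma right_eq_side_parts: "side 1 0 = (\<Union>i<n_parts. side_part i)"
proof -
  have "side 1 0 = {x. (\<exists>k\<in>{0..B-1}. inS (g x) k 0) \<and> (\<exists>j\<in>{0..B-1}. inS (g x) j 1)}" using mem_side_right by blast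
  also have "\<dots> = (\<Union>i<n_parts. side_part i)" by (rule side_parts_eq) (use n_parts in auto)
  finally show ?thesis .
qed

lemma side_parts_disjoint: assumes "Suc i < j" shows "side_part i \<inter> side_part j = {}"
proof (rule ccontr)
  assume "side_part i \<inter> side_part j \<noteq> {}"
  then obtain x where x: "inS (g x) (int (i div 2)) 0" "inS (g x) (int ((i + 1) div 2)) 1"
    "inS (g x) (int (j div 2)) 0" "inS (g x) (int ((j + 1) div 2)) 1" unfolding side_part_def by blast
  have "int ((j + 1) div 2) \<le> int (i div 2) + 1" "int (j div 2) \<le> int ((i + 1) div 2)"
    using next_row_neighbours[of "g x" _ 0] x by fastforce+
  moreover have "int i = int (i div 2) + int ((i + 1) div 2)" "int j = int (j div 2) + int ((j + 1) div 2)"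
    by presburger+
  ultimately show False using assms by linarith
qed

lemma side_parts_adjacent: "side_part i \<inter> side_part (Suc i) \<subseteq> {side_point (Suc i)}"
proof
  fix x assume "x \<in> side_part i \<inter> side_part (Suc i)"
  then have x: "inS (g x) (int (i div 2)) 0" "inS (g x) (int ((i + 1) div 2)) 1"
    "inS (g x) (int ((i + 1) div 2)) 0" "inS (g x) (int ((i + 2) div 2)) 1" by (auto simp: side_part_def)
  define k where "k = int (i div 2)"
  show "x \<in> {side_point (Suc i)}"
  proof (cases "even i")
    case True
    then have "int ((i + 1) div 2) = k" "int ((i + 2) div 2) = k + 1" by (auto simp: k_def)
    then have "g x - lv k 0 = vertex2"
      using x by (intro vertex2_unique) (simp_all add: inS_shift k_def add.commute del: inS_00)
    then have "g x = vertex2 + lv k 0" by (simp add: algebra_simps)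
    then have "x = gi (vertex2 + lv k 0)" by (metis gi_g)
    then show ?thesis using True by (simp add: side_point_def k_def)
  next
    case False
    then have "int ((i + 1) div 2) = k + 1" "int ((i + 2) div 2) = k + 1" by (auto simp: k_def)
    then have "g x - lv k 0 = vertex1"
      using x by (intro vertex1_unique) (simp_all add: inS_shift k_def add.commute del: inS_00)
    then have "g x = vertex1 + lv k 0" by (simp add: algebra_simps)
    then have "x = gi (vertex1 + lv k 0)" by (metis gi_g)
    then show ?thesis using False by (simp add: side_point_def k_def)
  qed
qed

lemma g_reflect_right: "g (lv 1 0 - x) = lv (B-1) 1 - g x"
proof -
  have "g (lv 1 0 - x) = g (- (x - lv 1 0))" by simp
  also have "\<dots> = lv (B-1) 1 - g x" unfolding gmap_minus gmap_diff_lv by (simp add: lv_def prod_eq_iff)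
  finally show ?thesis .
qed

lemma inS_reflect_right: "inS (g (lv 1 0 - x)) k q \<longleftrightarrow> inS (g x) (B - 1 - k) (1 - q)"
  unfolding g_reflect_right by (rule inS_reflect)

lemma side_point_reflect: assumes "i \<le> n_parts" shows "lv 1 0 - side_point i = side_point (n_parts - i)"
proof -
  define k where "k = int (i div 2)"
  have "g (side_point (n_parts - i)) = lv (B-1) 1 - g (side_point i)"
  proof (cases "even i")
    case True
    then have "odd (n_parts - i)" "int ((n_parts - i) div 2) = B - 1 - k"
      using n_parts assms by (auto simp: k_def of_nat_diff elim!: evenE)
    then show ?thesis using True by (simp add: side_point_def vertex2_def lv_def prod_eq_iff k_def)
  next
    case False
    then have "even (n_parts - i)" "int ((n_parts - i) div 2) = B - 1 - k"
      using n_parts assms by (auto simp: k_def of_nat_diff elim!: oddE)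
    then show ?thesis using False by (simp add: side_point_def vertex2_def lv_def prod_eq_iff k_def)
  qed
  then show ?thesis unfolding g_reflect_right[symmetric] by (metis g_inj)
qed

lemma side_point_ends: "side_point 0 = vertex1" "side_point n_parts = lv 1 0 - vertex1"
proof -
  have "vertex1 + lv (-1) 0 = vertex1 - lv 1 0" by (simp add: lv_def prod_eq_iff)
  then show "side_point 0 = vertex1" by (simp add: side_point_def gi_vertex)
  then show "side_point n_parts = lv 1 0 - vertex1" using side_point_reflect[of 0] by simp
qed

lemma side_copy_image: "side_part i = side_copy i ` side 1 0"
proof -
  have "(if even i then side 0 1 else side 1 1) = (\<lambda>x. if even i then to_top x else to_upper x) ` side 1 0"
    by (simp add: to_upper_image to_top_image)
  then have "x \<in> side_part i \<longleftrightarrow>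
      (\<exists>y\<in>side 1 0. g x = (if even i then to_top y else to_upper y) + lv (int (i div 2)) 0)" for x
    unfolding mem_side_part by (force simp: diff_eq_eq)
  then show ?thesis by (auto simp: side_copy_def image_iff eq_gi_iff)
qed

lemma side_copy_ends:
  "side_copy i (side_point 0) = side_point i" "side_copy i (side_point n_parts) = side_point (Suc i)"
proof -
  have shift: "vertex1 - lv 1 0 + lv k 0 = vertex1 + lv (k - 1) 0" for k by (simp add: lv_def prod_eq_iff)
  show "side_copy i (side_point 0) = side_point i" "side_copy i (side_point n_parts) = side_point (Suc i)"
    unfolding side_point_ends by (simp_all add: side_copy_def to_top_ends to_upper_ends side_point_def shift)
qed

lemma contraction_side_copy: "contraction (side_copy i)"
proof -
  define f where "f = (if even i then to_top else to_upper)"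
  have "contraction f" by (simp add: f_def contraction_to_top contraction_to_upper)
  then have "contraction (\<lambda>x. gi (f x + lv (int (i div 2)) 0))"
    by (intro contraction_comp[OF contraction_ginv]) (simp add: contraction_nonexpansive)
  moreover have "side_copy i = (\<lambda>x. gi (f x + lv (int (i div 2)) 0))" by (auto simp: side_copy_def f_def)
  ultimately show ?thesis by simp
qed

lemma inj_side_copy: "inj (side_copy i)"
  by (rule injI)
    (auto simp: side_copy_def dest!: injD[OF inj_gi] injD[OF inj_to_top] injD[OF inj_to_upper] split: if_splits)

sublocale right: arc_chain N lam c0 c1 "side 1 0" side_part side_point side_copy UNIV n_parts
proof
  show "3 \<le> n_parts" by (rule n_parts)
  show "compact (side 1 0)" by (rule compact_side)
  have "vertex1 \<in> side 1 0" using vertex1_mem by (simp add: side_def)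
  then show "side 1 0 \<noteq> {}" by blast
  show "side 1 0 = (\<Union>i<n_parts. side_part i)" by (rule right_eq_side_parts)
  show "side_part i = side_copy i ` side 1 0 \<and> side_copy i (side_point 0) = side_point i \<and>
      side_copy i (side_point n_parts) = side_point (Suc i) \<and> inj (side_copy i) \<and> contraction (side_copy i)" for i
    by (intro conjI side_copy_image side_copy_ends inj_side_copy contraction_side_copy)
  show "side_part i \<inter> side_part j = {}" if "Suc i < j" for i j by (rule side_parts_disjoint[OF that])
  show "side_part i \<inter> side_part (Suc i) \<subseteq> {side_point (Suc i)}" for i by (rule side_parts_adjacent)
qed simp

lemma upper_arc: "arc_between (side 1 1 \<union> side 0 1) vertex1 (vertex1 - lv 1 0)"
proof -
  have right: "arc_between (side 1 0) (lv 1 0 - vertex1) vertex1"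
    using arc_between_reverse[OF right.chain_arc] unfolding side_point_ends .
  have copy: "arc_between (f ` side 1 0) (f (lv 1 0 - vertex1)) (f vertex1)" if "contraction f" "inj f" for f
    using that by (intro arc_between_image[OF right] contraction_continuous) (auto intro: inj_on_subset)
  have "arc_between (side 1 1) vertex1 vertex2"
    using copy[OF contraction_to_upper inj_to_upper] unfolding to_upper_image to_upper_ends .
  moreover have "arc_between (side 0 1) vertex2 (vertex1 - lv 1 0)"
    using copy[OF contraction_to_top inj_to_top] unfolding to_top_image to_top_ends .
  moreover have "side 1 1 \<inter> side 0 1 \<subseteq> {vertex2}" using vertex2_unique by (auto simp: side_def)
  ultimately show ?thesis by (rule arc_between_join)
qed

lemma upper_corners:
  assumes "x \<in> side 1 1 \<union> side 0 1"
  shows "inS x 1 0 \<Longrightarrow> x = vertex1" "inS x (-1) 0 \<Longrightarrow> x = vertex1 - lv 1 0"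
proof -
  have x: "inS x 0 0" "inS x 1 1 \<or> inS x 0 1" using assms by (auto simp: side_def)
  show "x = vertex1" if "inS x 1 0"
  proof -
    have "inS x 1 1" using next_row_neighbours[OF that, of 0] x(2) by auto
    then show ?thesis using vertex1_unique x(1) that by blast
  qed
  show "x = vertex1 - lv 1 0" if "inS x (-1) 0"
  proof -
    have "inS x 0 1" using next_row_neighbours[OF that, of 1] x(2) by auto
    then have "x + lv 1 0 = vertex1" using x(1) that by (intro vertex1_unique) (simp_all add: inS_plus del: inS_00)
    then show ?thesis by (simp add: algebra_simps)
  qed
qed

end

section \<open>The tiles for A = 1 and A = -1\<close>

text \<open>After a reflection the tile for \<open>A = -1\<close> is a half of a lattice tile for \<open>A = 1\<close> as well, but the inner digits
  then lead from \<open>- T\<close> to \<open>T\<close> instead of from \<open>T\<close> to \<open>T\<close>. The flag \<open>straight\<close> separates the two cases.\<close>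

locale oriented_half_tile = half_tile N lam c0 c1 1 B S T for N lam c0 c1 B S T +
  fixes straight :: bool
  assumes straight_or_B_ge_3: "straight \<or> 3 \<le> B"
    and oriented_rec: "\<And>x. (if straight then x else - x) \<in> T \<longleftrightarrow>
      gmap 1 B x \<in> S \<or> (\<exists>k\<in>{1..B-2}. gmap 1 B x - lv k 0 \<in> T)"
begin

sublocale lattice_tile_A1 N lam c0 c1 B S
  by unfold_locales (use B_ge_2 in auto)

definition in_low :: "real \<times> real \<Rightarrow> int \<Rightarrow> int \<Rightarrow> bool" where
  "in_low x p q \<longleftrightarrow> (if straight then inT x p q else inU x p q)"

definition in_high :: "real \<times> real \<Rightarrow> int \<Rightarrow> int \<Rightarrow> bool" where
  "in_high x p q \<longleftrightarrow> (if straight then inU x p q else inT x p q)"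

lemma inS_iff_low_high: "inS x p q \<longleftrightarrow> in_low x p q \<or> in_high x p q"
  by (auto simp: inS_iff in_low_def in_high_def)

lemma in_low_minus: "in_low (- x) p q \<longleftrightarrow> in_high x (- p) (- q)"
  and in_high_minus: "in_high (- x) p q \<longleftrightarrow> in_low x (- p) (- q)"
  by (simp_all add: in_low_def in_high_def inT_minus inU_minus)

lemma in_high_shift: "in_high (x - lv a b) p q \<longleftrightarrow> in_high x (p + a) (q + b)"
  by (simp add: in_high_def inT_shift inU_shift)

lemma in_low_rec: "in_low x p 0 \<longleftrightarrow> inS (g x) 0 p \<or> (\<exists>k\<in>{1..B-2}. inT (g x) k p)"
proof -
  have digit: "g (x - lv p 0) = g x - lv 0 p" "g x - lv 0 p - lv k 0 = g x - lv k p" for k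
    unfolding gmap_diff_lv by (simp_all add: lv_def prod_eq_iff)
  have "in_low x p 0 \<longleftrightarrow> (if straight then x - lv p 0 else - (x - lv p 0)) \<in> T"
    by (simp add: in_low_def inT_def inU_def)
  also have "\<dots> \<longleftrightarrow> inS (g x) 0 p \<or> (\<exists>k\<in>{1..B-2}. inT (g x) k p)"
    unfolding oriented_rec digit inT_def inS_def ..
  finally show ?thesis .
qed

lemma in_high_rec: "in_high x p 0 \<longleftrightarrow> inS (g x) (B-1) p \<or> (\<exists>k\<in>{1..B-2}. inU (g x) k p)"
proof -
  have "in_high x p 0 \<longleftrightarrow> in_low (- x) (- p) 0" by (simp add: in_low_minus)
  also have "\<dots> \<longleftrightarrow> inS (g x) (B-1) p \<or> (\<exists>k\<in>{1..B-2}. inU (g x) (B-1-k) p)"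
    unfolding in_low_rec gmap_minus inS_reflect inT_reflect by simp
  also have "(\<exists>k\<in>{1..B-2}. inU (g x) (B-1-k) p) \<longleftrightarrow> (\<exists>k\<in>{1..B-2}. inU (g x) k p)"
    by (rule ex_reflect_atLeastAtMost) simp
  finally show ?thesis .
qed

lemma in_high_no_upper: assumes "in_high x p q" shows "\<not> inS x (p + 1) (q + 1)" "\<not> inS x p (q + 1)"
proof -
  define y where "y = x - lv p q"
  have "in_high y 0 0" unfolding y_def in_high_shift using assms by simp
  then obtain k where k: "1 \<le> k" "inS (g y) k 0" using high_digit in_high_rec by metis
  have "\<not> inS y 1 1"
  proof
    assume "inS y 1 1"
    then obtain n where n: "n \<in> {0..B-1}" "inS (g y) (n - B) 0" using inS_rec[of y 1 1] by auto
    then show False using row_neighbours[OF n(2) k(2)] k(1) by auto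
  qed
  then show "\<not> inS x (p + 1) (q + 1)" unfolding y_def inS_shift by (simp add: add.commute)
  have "\<not> inS y 0 1"
  proof
    assume "inS y 0 1"
    then obtain n where n: "n \<in> {0..B-1}" "inS (g y) (n - B) (-1)" using inS_rec[of y 0 1] by auto
    then show False using neighbours[OF n(2) k(2)] k(1) by auto
  qed
  then show "\<not> inS x p (q + 1)" unfolding y_def inS_shift by (simp add: add.commute)
qed

lemma in_low_no_lower: assumes "in_low x p q" shows "\<not> inS x (p - 1) (q - 1)" "\<not> inS x p (q - 1)"
  using in_high_no_upper[of "- x" "- p" "- q"] assms unfolding in_high_minus inS_minus by simp_all

definition first_digit :: int where "first_digit = (if straight then 0 else B - 1)"

abbreviation low_digits :: "int set" where "low_digits \<equiv> insert first_digit {1..B-2}"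

abbreviation high_digits :: "int set" where "high_digits \<equiv> insert (B-1-first_digit) {1..B-2}"

lemma inT_rec: "inT x p 0 \<longleftrightarrow> inS (g x) first_digit p \<or> (\<exists>k\<in>{1..B-2}. in_low (g x) k p)"
  using in_low_rec[of x p] in_high_rec[of x p]
  unfolding in_low_def in_high_def first_digit_def by (cases straight) simp_all

lemma inT_right:
  assumes "x \<in> side 1 0" shows "inT x 0 0 \<longleftrightarrow> (\<exists>k\<in>low_digits. inS (g x) k 0)"
proof -
  obtain j where j: "inS (g x) j 1" using assms mem_side_right by blast
  have "in_low (g x) k 0" if k: "inS (g x) k 0" for k
    using next_row_neighbours[OF k, of j] j in_high_no_upper[of "g x" k 0] k inS_iff_low_high by auto
  then show ?thesis unfolding inT_rec using inS_iff_low_high by blast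
qed

lemma inT_right_1:
  assumes "x \<in> side 1 0" shows "inT x 1 0 \<longleftrightarrow> inS (g x) first_digit 1"
proof -
  obtain k where k: "inS (g x) k 0" using assms mem_side_right by blast
  have "\<not> in_low (g x) j 1" for j
  proof
    assume j: "in_low (g x) j 1"
    then have "inS (g x) j (0 + 1)" by (simp add: inS_iff_low_high)
    then show False using next_row_neighbours[OF k] in_low_no_lower[OF j] k by fastforce
  qed
  then show ?thesis unfolding inT_rec by blast
qed

lemma inU_right:
  assumes "x \<in> side 1 0" shows "inU x 0 0 \<longleftrightarrow> inS (g x) (B-1-first_digit) 0"
proof -
  have "inU x 0 0 \<longleftrightarrow> inT (lv 1 0 - x) 1 0" by (simp add: inT_reflect del: inU_00)
  then show ?thesis using inT_right_1[of "lv 1 0 - x"] assms by (simp add: side_reflect inS_reflect_right)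
qed

lemma inU_right_1:
  assumes "x \<in> side 1 0" shows "inU x 1 0 \<longleftrightarrow> (\<exists>j\<in>high_digits. inS (g x) j 1)"
proof -
  have "inU x 1 0 \<longleftrightarrow> inT (lv 1 0 - x) 0 0" by (simp add: inT_reflect del: inT_00)
  also have "\<dots> \<longleftrightarrow> inS (g x) (B-1-first_digit) 1 \<or> (\<exists>k\<in>{1..B-2}. inS (g x) (B-1-k) 1)"
    using inT_right[of "lv 1 0 - x"] assms by (simp add: side_reflect inS_reflect_right)
  also have "(\<exists>k\<in>{1..B-2}. inS (g x) (B-1-k) 1) \<longleftrightarrow> (\<exists>k\<in>{1..B-2}. inS (g x) k 1)"
    by (rule ex_reflect_atLeastAtMost) simp
  finally show ?thesis by simp
qed

lemma side_right_if_halves: "x \<in> half 0 \<union> half 1 \<Longrightarrow> x \<in> half 2 \<union> half 3 \<Longrightarrow> x \<in> side 1 0"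
  using half_block[of x 0] half_block[of x 1] half_block[of x 2] half_block[of x 3] unfolding side_def by auto

lemma right_halves:
  "half 1 \<inter> half 3 = {x. (\<exists>k\<in>low_digits. inS (g x) k 0) \<and> (\<exists>j\<in>{first_digit}. inS (g x) j 1)}"
  "half 1 \<inter> half 2 = {x. (\<exists>k\<in>low_digits. inS (g x) k 0) \<and> (\<exists>j\<in>high_digits. inS (g x) j 1)}"
proof -
  have halves: "half 1 = {x. inT x 0 0}" "half 2 = {x. inU x 1 0}" "half 3 = {x. inT x 1 0}"
    using half_odd[of 0] half_even[of 1] half_odd[of 1] by simp_all
  have digits: "low_digits \<subseteq> {0..B-1}" "{first_digit} \<subseteq> {0..B-1}" "high_digits \<subseteq> {0..B-1}"
    using B_ge_2 by (auto simp: first_digit_def)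
  have digit_sides: "x \<in> side 1 0"
    if "\<exists>k\<in>K. inS (g x) k 0" "\<exists>j\<in>J. inS (g x) j 1" "K \<subseteq> {0..B-1}" "J \<subseteq> {0..B-1}" for x K J
    using that mem_side_right by blast
  show "half 1 \<inter> half 3 = {x. (\<exists>k\<in>low_digits. inS (g x) k 0) \<and> (\<exists>j\<in>{first_digit}. inS (g x) j 1)}"
    using side_right_if_halves inT_right inT_right_1 digit_sides[OF _ _ digits(1,2)] unfolding halves by blast
  show "half 1 \<inter> half 2 = {x. (\<exists>k\<in>low_digits. inS (g x) k 0) \<and> (\<exists>j\<in>high_digits. inS (g x) j 1)}"
    using side_right_if_halves inT_right inU_right_1 digit_sides[OF _ _ digits(1,3)] unfolding halves by blast
qed

lemma halves_disjoint: "\<not> (inU x 0 0 \<and> inT x 1 0)"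
proof
  assume x: "inU x 0 0 \<and> inT x 1 0"
  then have "x \<in> side 1 0" using inU_inS[of x 0 0] inT_inS[of x 1 0] by (simp add: side_def)
  then have "inS (g x) (B-1-first_digit) 0" "inS (g x) first_digit (0 + 1)"
    using x inU_right inT_right_1 by simp_all
  then have "first_digit = B-1-first_digit \<or> first_digit = B-1-first_digit+1" by (rule next_row_neighbours)
  then show False using straight_or_B_ge_3 B_ge_2 by (auto simp: first_digit_def split: if_splits)
qed

lemma center_rec: "x \<in> T \<and> - x \<in> T \<longleftrightarrow>
    (inS (g x) 0 0 \<or> (\<exists>k\<in>{1..B-2}. inT (g x) k 0)) \<and> (inS (g x) (B-1) 0 \<or> (\<exists>k\<in>{1..B-2}. inU (g x) k 0))"
  using in_low_rec[of x 0] in_high_rec[of x 0]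
  by (auto simp: in_low_def in_high_def split: if_splits simp del: inS_00)

definition orient :: "real \<times> real \<Rightarrow> real \<times> real" where "orient x = (if straight then x else - x)"

lemma mem_cap: "x \<in> T \<and> (\<exists>p q. q \<noteq> 0 \<and> inS x p q) \<longleftrightarrow> orient x \<in> side 1 1 \<union> side 0 1"
proof -
  define y where "y = orient x"
  have T: "x \<in> T \<longleftrightarrow> in_low y 0 0" by (simp add: y_def orient_def in_low_def)
  have "(\<exists>p q. q \<noteq> 0 \<and> inS (- x) p q) \<longleftrightarrow> (\<exists>p q. q \<noteq> 0 \<and> inS x p q)"
    unfolding inS_minus by (subst ex_reflect[of _ 0], subst (2) ex_reflect[of _ 0]) simp
  then have "(\<exists>p q. q \<noteq> 0 \<and> inS x p q) \<longleftrightarrow> (\<exists>p q. q \<noteq> 0 \<and> inS y p q)" by (simp add: y_def orient_def)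
  moreover have "in_low y 0 0 \<and> (\<exists>p q. q \<noteq> 0 \<and> inS y p q) \<longleftrightarrow> inS y 0 0 \<and> (inS y 1 1 \<or> inS y 0 1)"
  proof
    assume y: "in_low y 0 0 \<and> (\<exists>p q. q \<noteq> 0 \<and> inS y p q)"
    then obtain p q where pq: "q \<noteq> 0" "inS y p q" by blast
    have y0: "inS y 0 0" using y by (simp add: inS_iff_low_high)
    then have "q = 1 \<and> (p = 1 \<or> p = 0)" using neighbours[OF y0 pq(2)] in_low_no_lower[of y 0 0] y pq by auto
    then show "inS y 0 0 \<and> (inS y 1 1 \<or> inS y 0 1)" using y0 pq(2) by auto
  next
    assume y: "inS y 0 0 \<and> (inS y 1 1 \<or> inS y 0 1)"
    then have "in_low y 0 0" using in_high_no_upper[of y 0 0] inS_iff_low_high by auto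
    then show "in_low y 0 0 \<and> (\<exists>p q. q \<noteq> 0 \<and> inS y p q)" using y zero_neq_one by metis
  qed
  ultimately show ?thesis unfolding T y_def[symmetric] by (auto simp: side_def)
qed

lemma center_other_rows: assumes "x \<in> T" "q \<noteq> 0" "inS x p q" shows "- x \<notin> T"
proof
  assume "- x \<in> T"
  define y where "y = orient x"
  have "inS y 1 1 \<or> inS y 0 1" using mem_cap[of x] assms unfolding y_def by (auto simp: side_def)
  moreover have "in_high y 0 0" using \<open>- x \<in> T\<close> by (simp add: y_def orient_def in_high_def)
  ultimately show False using in_high_no_upper[of y 0 0] by simp
qed

sublocale row_tile N lam c0 c1 1 B S T
proof
  show "\<bar>p' - p\<bar> \<le> 1" if "inS x p 0" "inS x p' 0" for x p p' by (rule row_neighbours[OF that])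
  show "p = 0 \<and> q = 0" if "inS 0 p q" for p q by (rule zero_only[OF that])
qed (rule halves_disjoint center_rec | erule (2) center_other_rows)+

definition corner :: "real \<times> real" where "corner = (if straight then vertex1 else lv 1 0 - vertex1)"

definition cut :: nat where "cut = (if straight then 1 else n_parts - 2)"

lemma if_straight: assumes straight shows "corner = vertex1" "cut = 1" "first_digit = 0" "orient x = x"
  using assms unfolding corner_def cut_def first_digit_def orient_def by simp_all

lemma if_not_straight:
  assumes "\<not> straight" shows "corner = lv 1 0 - vertex1" "cut = n_parts - 2" "first_digit = B - 1" "orient x = - x"
  using assms unfolding corner_def cut_def first_digit_def orient_def by simp_all

lemma cut: "cut \<le> n_parts" "n_parts - (n_parts - cut) = cut"
  using n_parts(1) by (auto simp: cut_def)

lemma side_point_cut: "lv 1 0 - side_point (n_parts - cut) = side_point cut"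
  using side_point_reflect[of "n_parts - cut"] cut by simp

lemma right_eq_parts: "half 1 \<inter> half 3 = (\<Union>i\<in>(if straight then {0..<cut} else {cut..<n_parts}). side_part i)"
  unfolding right_halves
proof (rule side_parts_eq)
  show "i \<in> (if straight then {0..<cut} else {cut..<n_parts}) \<longleftrightarrow>
      int (i div 2) \<in> low_digits \<and> int ((i + 1) div 2) \<in> {first_digit}" for i
  proof (cases straight)
    case True then show ?thesis unfolding if_straight[OF True] by auto
  next
    case False
    have "i \<in> {n_parts - 2..<n_parts} \<longleftrightarrow> int ((i + 1) div 2) = B - 1" using n_parts by auto
    then show ?thesis unfolding if_not_straight[OF False] using False straight_or_B_ge_3 by auto
  qed
qed (use B_ge_2 in \<open>auto simp: first_digit_def\<close>)

lemma middle_eq_parts: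
  "half 1 \<inter> half 2 = (\<Union>i\<in>(if straight then {cut..<n_parts - cut} else {n_parts - cut..<cut}). side_part i)"
  unfolding right_halves
proof (rule side_parts_eq)
  show "i \<in> (if straight then {cut..<n_parts - cut} else {n_parts - cut..<cut}) \<longleftrightarrow>
      int (i div 2) \<in> low_digits \<and> int ((i + 1) div 2) \<in> high_digits" for i
  proof (cases straight)
    case True
    have "i \<in> {1..<n_parts - 1} \<longleftrightarrow> int (i div 2) \<le> B - 2 \<and> 1 \<le> int ((i + 1) div 2)" using n_parts by auto
    then show ?thesis unfolding if_straight[OF True] using True B_ge_2 by auto
  next
    case False
    have "i \<in> {n_parts - (n_parts - 2)..<n_parts - 2} \<longleftrightarrow> 1 \<le> int (i div 2) \<and> int ((i + 1) div 2) \<le> B - 2"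
      using n_parts by auto
    then show ?thesis unfolding if_not_straight[OF False] using False B_ge_2 by auto
  qed
qed (use B_ge_2 in \<open>auto simp: first_digit_def\<close>)

lemma right_arc: "arc_between (half 1 \<inter> half 3) corner (side_point cut)"
proof (cases straight)
  case True
  have "0 < cut" unfolding if_straight[OF True] by simp
  from right.subchain_arc[OF this cut(1)] show ?thesis
    unfolding right_eq_parts side_point_ends if_straight[OF True] using True by simp
next
  case False
  have "cut < n_parts" unfolding if_not_straight[OF False] using n_parts(1) by simp
  from arc_between_reverse[OF right.subchain_arc[OF this order_refl]] show ?thesis
    unfolding right_eq_parts side_point_ends if_not_straight[OF False] using False by simp
qed

lemma middle_arc: "arc_between (half 1 \<inter> half 2) (side_point cut) (side_point (n_parts - cut))"
proof (cases straight)
  case True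
  have "cut < n_parts - cut" unfolding if_straight[OF True] using n_parts(1) by simp
  from right.subchain_arc[OF this diff_le_self] show ?thesis
    unfolding middle_eq_parts if_straight[OF True] using True by simp
next
  case False
  have "n_parts - cut < cut" unfolding if_not_straight[OF False] using n_parts straight_or_B_ge_3 False by auto
  from arc_between_reverse[OF right.subchain_arc[OF this cut(1)]] show ?thesis
    unfolding middle_eq_parts if_not_straight[OF False] using False by simp
qed

lemma joint_unique: "half 1 \<inter> half 2 \<inter> half 3 \<subseteq> {side_point cut}"
proof
  fix x assume "x \<in> half 1 \<inter> half 2 \<inter> half 3"
  then have "x \<in> half 1 \<inter> half 3" "x \<in> half 1 \<inter> half 2" by auto
  then obtain i j where ij: "x \<in> side_part i" "x \<in> side_part j" "i < cut" "cut \<le> j"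
    unfolding right_eq_parts middle_eq_parts by (auto split: if_splits)
  then have "\<not> Suc i < j" using side_parts_disjoint[of i j] by auto
  then have eq: "j = Suc i" "cut = Suc i" using ij by auto
  show "x \<in> {side_point cut}" unfolding eq(2) using side_parts_adjacent[of i] ij(1,2) eq(1) by blast
qed

lemma cap_arc: "arc_between {x \<in> T. \<exists>p q. q \<noteq> 0 \<and> inS x p q} corner (corner - lv 1 0)"
proof (cases straight)
  case True
  show ?thesis unfolding mem_cap if_straight[OF True] Collect_mem_eq by (rule upper_arc)
next
  case False
  show ?thesis unfolding mem_cap if_not_straight[OF False]
    using arc_between_reverse[OF arc_between_reflect[OF upper_arc, of 0]] by simp
qed

lemma cap_corners:
  assumes "x \<in> T" "q \<noteq> 0" "inS x p q"
  shows "inS x 1 0 \<Longrightarrow> x = corner" "inS x (-1) 0 \<Longrightarrow> x = corner - lv 1 0"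
proof -
  have x: "orient x \<in> side 1 1 \<union> side 0 1" using mem_cap assms by blast
  show "x = corner" if "inS x 1 0"
  proof (cases straight)
    case True then show ?thesis using upper_corners(1)[OF x] that unfolding if_straight[OF True] by simp
  next
    case False
    have "- x = vertex1 - lv 1 0"
      using upper_corners(2)[OF x] that unfolding if_not_straight[OF False] by (simp add: inS_minus)
    then show ?thesis unfolding if_not_straight[OF False] by (metis minus_diff_eq minus_minus)
  qed
  show "x = corner - lv 1 0" if "inS x (-1) 0"
  proof (cases straight)
    case True then show ?thesis using upper_corners(2)[OF x] that unfolding if_straight[OF True] by simp
  next
    case False
    have "- x = vertex1" using upper_corners(1)[OF x] that
      unfolding if_not_straight[OF False] by (simp add: inS_minus)
    then have "x = - vertex1" by (metis minus_minus)
    then show ?thesis unfolding if_not_straight[OF False] by simp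
  qed
qed

lemma center_end:
  "g (side_point (n_parts - cut)) = lv 1 0 - corner \<or> g (- side_point (n_parts - cut)) = lv 1 0 - corner"
proof (cases straight)
  case True
  have "even (n_parts - 1)" "int ((n_parts - 1) div 2) = B - 1" using n_parts by auto
  then show ?thesis unfolding if_straight[OF True] gmap_minus by (simp add: side_point_def lv_def prod_eq_iff)
next
  case False
  have "n_parts - (n_parts - 2) = 2" using n_parts(1) by simp
  then show ?thesis unfolding if_not_straight[OF False] by (simp add: side_point_def lv_def flip: zero_prod_def)
qed

sublocale boundary_arcs N lam c0 c1 1 B S T corner "side_point (n_parts - cut)"
  by unfold_locales
    (unfold side_point_cut, (rule right_arc middle_arc cap_arc joint_unique center_end | erule (3) cap_corners)+)

end

lemma disk_like_tile_1: assumes "2 \<le> B" shows "disk_like (tile 1 B)"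
proof -
  obtain N lam c0 c1 where "crystile N lam c0 c1 1 B (sym_tile 1 B) (tile 1 B)"
    using crystile_exists[of B 1] assms by auto
  then interpret crystile N lam c0 c1 1 B "sym_tile 1 B" "tile 1 B" .
  interpret oriented_half_tile N lam c0 c1 B "sym_tile 1 B" "tile 1 B" True
  proof
    show "(if True then x else - x) \<in> tile 1 B \<longleftrightarrow>
        g x \<in> sym_tile 1 B \<or> (\<exists>k\<in>{1..B-2}. g x - lv k 0 \<in> tile 1 B)" for x
      using T_rec[of x] by simp
  qed simp
  show ?thesis by (rule disk_like_T)
qed

definition flip :: "real \<times> real \<Rightarrow> real \<times> real" where "flip x = (fst x, - snd x)"

lemma flip_flip [simp]: "flip (flip x) = x" and flip_minus: "flip (- x) = - flip x"
  and flip_diff: "flip (x - y) = flip x - flip y" and flip_lv: "flip (lv k 0) = lv k 0"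
  by (simp_all add: flip_def lv_def prod_eq_iff)

lemma gmap_flip: "gmap (- A) B (- flip x) = flip (gmap A B x)"
  by (simp add: gmap_def flip_def)

lemma disk_like_tile_minus1: assumes "2 \<le> B" shows "disk_like (tile (-1) B)"
proof -
  obtain M l d0 d1 where "crystile M l d0 d1 (-1) B (sym_tile (-1) B) (tile (-1) B)"
    using crystile_exists[of B "-1"] assms by auto
  then interpret C: crystile M l d0 d1 "-1" B "sym_tile (-1) B" "tile (-1) B" .
  obtain N lam c0 c1 where "tile_gauge N lam c0 c1 1 B" using tile_gauge_exists[of B 1] assms by auto
  then interpret tile_gauge N lam c0 c1 1 B .
  define f where "f x = (if 3 \<le> B then flip x else - flip x)" for x
  have f_f: "f (f x) = x" for x by (simp add: f_def flip_minus)
  have mem: "x \<in> f ` X \<longleftrightarrow> f x \<in> X" for x X by (rule mem_image_inverse) (rule f_f)+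
  have cont: "continuous_on X f" for X
    unfolding f_def[abs_def] flip_def[abs_def] by (cases "3 \<le> B") (auto intro!: continuous_intros)
  have sym: "- x \<in> sym_tile (-1) B \<longleftrightarrow> x \<in> sym_tile (-1) B" for x by (auto simp: mem_sym_tile)
  have memS: "x \<in> f ` sym_tile (-1) B \<longleftrightarrow> flip x \<in> sym_tile (-1) B" for x
    unfolding mem f_def using sym[of "flip x"] by simp
  interpret oriented_half_tile N lam c0 c1 B "f ` sym_tile (-1) B" "f ` tile (-1) B" "\<not> 3 \<le> B"
  proof
    show "compact (f ` sym_tile (-1) B)" "compact (f ` tile (-1) B)"
      using C.S_compact C.T_compact cont by (auto intro: compact_continuous_image)
    show "f ` sym_tile (-1) B \<noteq> {}" using C.S_ne by simp
    show "- x \<in> f ` sym_tile (-1) B" if "x \<in> f ` sym_tile (-1) B" for x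
      using that sym unfolding memS flip_minus by simp
    show "x \<in> f ` sym_tile (-1) B \<longleftrightarrow> x \<in> f ` tile (-1) B \<or> - x \<in> f ` tile (-1) B" for x
      unfolding mem using C.S_T[of "f x"] by (simp add: f_def flip_minus)
    show "x \<in> f ` sym_tile (-1) B \<longleftrightarrow> (\<exists>k\<in>{0..B-1}. g x - lv k 0 \<in> f ` sym_tile (-1) B)" for x
      using C.S_rec[of "- flip x"] gmap_flip[of 1 B x] unfolding memS sym flip_diff flip_lv by simp
    show "\<not> 3 \<le> B \<or> 3 \<le> B" by blast
    show "(if \<not> 3 \<le> B then x else - x) \<in> f ` tile (-1) B \<longleftrightarrow>
        g x \<in> f ` sym_tile (-1) B \<or> (\<exists>k\<in>{1..B-2}. g x - lv k 0 \<in> f ` tile (-1) B)" for x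
      using C.T_rec[of "- flip x"] gmap_flip[of 1 B x] unfolding memS unfolding mem f_def
      by (auto simp: flip_minus flip_diff flip_lv)
  qed
  have "homeomorphism (tile (-1) B) (f ` tile (-1) B) f f" by (intro homeomorphismI cont) (auto simp: f_f)
  then show ?thesis using disk_like_homeomorphic disk_like_T unfolding homeomorphic_def by blast
qed

section \<open>The tiles for A = 0\<close>

lemma nearest_digit:
  fixes t :: real
  assumes "0 \<le> n" shows "(\<exists>k\<in>{0..n}. \<bar>t - of_int k\<bar> \<le> 1/2) \<longleftrightarrow> -1/2 \<le> t \<and> t \<le> of_int n + 1/2"
proof
  assume "\<exists>k\<in>{0..n}. \<bar>t - of_int k\<bar> \<le> 1/2"
  then obtain k where "0 \<le> k" "k \<le> n" "\<bar>t - of_int k\<bar> \<le> 1/2" by auto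
  then have "0 \<le> real_of_int k" "real_of_int k \<le> of_int n" "\<bar>t - of_int k\<bar> \<le> 1/2" by simp_all
  then show "-1/2 \<le> t \<and> t \<le> of_int n + 1/2" by linarith
next
  assume t: "-1/2 \<le> t \<and> t \<le> of_int n + 1/2"
  show "\<exists>k\<in>{0..n}. \<bar>t - of_int k\<bar> \<le> 1/2"
  proof (cases "of_int n \<le> t")
    case True then show ?thesis using t assms by (intro bexI[of _ n]) auto
  next
    case False
    then have "\<lfloor>t + 1/2\<rfloor> \<le> n" "0 \<le> \<lfloor>t + 1/2\<rfloor>" "\<bar>t - of_int \<lfloor>t + 1/2\<rfloor>\<bar> \<le> 1/2" using t by linarith+
    then show ?thesis by (intro bexI[of _ "\<lfloor>t + 1/2\<rfloor>"]) auto
  qed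
qed

locale tile_A0 = crystile N lam c0 c1 0 B S T for N lam c0 c1 B S T
begin

lemma g_eq: "g x = (- (of_int B * snd x) + (of_int B - 1) / 2, fst x)" by (simp add: gmap_def)

lemma S_square: "x \<in> S \<longleftrightarrow> \<bar>fst x\<bar> \<le> 1/2 \<and> \<bar>snd x\<bar> \<le> 1/2"
proof -
  define Q :: "(real \<times> real) set" where "Q = {-1/2..1/2} \<times> {-1/2..1/2}"
  have Q: "x \<in> Q \<longleftrightarrow> \<bar>fst x\<bar> \<le> 1/2 \<and> \<bar>snd x\<bar> \<le> 1/2" for x by (cases x) (auto simp: Q_def)
  have "Q = S"
  proof (rule S_unique)
    show "compact Q" unfolding Q_def by (intro compact_Times) auto
    show "Q \<noteq> {}" using Q[of 0] by auto
    fix x :: "real \<times> real"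
    have "0 < real_of_int B" using B_ge_2 by simp
    then have "\<bar>snd x\<bar> \<le> 1/2 \<longleftrightarrow> of_int B * \<bar>snd x\<bar> \<le> of_int B * (1/2)" by (simp only: mult_le_cancel_left_pos)
    also have "of_int B * \<bar>snd x\<bar> = \<bar>of_int B * snd x\<bar>" using B_ge_2 by (simp add: abs_mult)
    also have "\<bar>of_int B * snd x\<bar> \<le> of_int B * (1/2) \<longleftrightarrow> -1/2 \<le> fst (g x) \<and> fst (g x) \<le> of_int (B - 1) + 1/2"
      unfolding g_eq by (auto simp: abs_le_iff field_simps)
    also have "\<dots> \<longleftrightarrow> (\<exists>k\<in>{0..B-1}. \<bar>fst (g x) - of_int k\<bar> \<le> 1/2)" using B_ge_2 by (subst nearest_digit) auto
    finally show "x \<in> Q \<longleftrightarrow> (\<exists>k\<in>{0..B-1}. g x - lv k 0 \<in> Q)" unfolding Q by (auto simp: lv_def g_eq)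
  qed
  then show ?thesis using Q by blast
qed

end

locale tile_A0_wide = tile_A0 + assumes B_ge_3: "3 \<le> B"
begin

definition edge_height :: real where "edge_height = 1/2 - 1 / of_int B"

lemma B_mult_edge_height: "of_int B * edge_height = of_int B / 2 - 1"
  using B_ge_3 by (simp add: edge_height_def field_simps)

lemma edge_height: "0 < edge_height" "edge_height < 1/2" using B_ge_3 by (auto simp: edge_height_def field_simps)

lemma inS_square: "inS x p q \<longleftrightarrow> \<bar>fst x - of_int p\<bar> \<le> 1/2 \<and> \<bar>snd x - of_int q\<bar> \<le> 1/2"
  unfolding inS_def S_square by simp

lemma T_square: "x \<in> T \<Longrightarrow> \<bar>fst x\<bar> \<le> 1/2 \<and> \<bar>snd x\<bar> \<le> 1/2" using S_T[of x] S_square[of x] by blast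

lemma fst_g_bounds:
  "snd x \<le> 1/2 \<longleftrightarrow> -1/2 \<le> fst (g x)" "edge_height \<le> snd x \<longleftrightarrow> fst (g x) \<le> 1/2"
  "- edge_height \<le> snd x \<longleftrightarrow> fst (g x) \<le> of_int (B - 2) + 1/2"
proof -
  have scale: "y \<le> z \<longleftrightarrow> of_int B * y \<le> of_int B * z" for y z :: real using B_ge_2 by simp
  show "snd x \<le> 1/2 \<longleftrightarrow> -1/2 \<le> fst (g x)" "edge_height \<le> snd x \<longleftrightarrow> fst (g x) \<le> 1/2"
    "- edge_height \<le> snd x \<longleftrightarrow> fst (g x) \<le> of_int (B - 2) + 1/2"
    unfolding scale[of "snd x"] scale[of _ "snd x"] mult_minus_right B_mult_edge_height g_eq
    by (auto simp: field_simps)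
qed

lemma top_edge: assumes "\<bar>fst x\<bar> \<le> 1/2" "snd x = 1/2" shows "x \<in> T"
  using T_rec[of x] assms unfolding g_eq S_square by (simp add: field_simps)

lemma bottom_edge: assumes "snd x = -1/2" shows "x \<notin> T"
proof -
  have t: "fst (g x) = of_int B - 1/2" using assms by (simp add: g_eq field_simps)
  have outside: "g x - lv k 0 \<notin> S" if "k \<le> B - 2" for k
  proof -
    have "real_of_int k \<le> real_of_int B - 2" using that by linarith
    then have "\<not> \<bar>fst (g x) - of_int k\<bar> \<le> 1/2" unfolding t by linarith
    then show ?thesis by (simp add: S_square)
  qed
  then have "g x - lv k 0 \<notin> T" if "k \<le> B - 2" for k using that S_T by blast
  moreover have "g x \<notin> S" using outside[of 0] B_ge_3 by simp
  ultimately show ?thesis using T_rec[of x] by auto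
qed

lemma right_edge: assumes "fst x = 1/2" shows "x \<in> T \<longleftrightarrow> - edge_height \<le> snd x \<and> snd x \<le> 1/2"
proof -
  have snd_g: "snd (g x) = 1/2" by (simp add: g_eq assms)
  have "g x - lv k 0 \<in> T \<longleftrightarrow> \<bar>fst (g x) - of_int k\<bar> \<le> 1/2" for k
    using T_square[of "g x - lv k 0"] top_edge[of "g x - lv k 0"] by (auto simp: snd_g)
  moreover have "g x \<in> S \<longleftrightarrow> \<bar>fst (g x) - of_int 0\<bar> \<le> 1/2" by (simp add: S_square snd_g)
  moreover have "{0..B-2} = insert 0 {1..B-2}" using B_ge_2 by auto
  ultimately have "x \<in> T \<longleftrightarrow> (\<exists>k\<in>{0..B-2}. \<bar>fst (g x) - of_int k\<bar> \<le> 1/2)" using T_rec[of x] by simp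
  also have "\<dots> \<longleftrightarrow> - edge_height \<le> snd x \<and> snd x \<le> 1/2"
    unfolding fst_g_bounds using B_ge_2 by (subst nearest_digit) auto
  finally show ?thesis .
qed

lemma left_edge: assumes "fst x = -1/2" shows "x \<in> T \<longleftrightarrow> edge_height \<le> snd x \<and> snd x \<le> 1/2"
proof -
  have snd_g: "snd (g x) = -1/2" by (simp add: g_eq assms)
  then have "g x - lv k 0 \<notin> T" for k by (intro bottom_edge) simp
  then have "x \<in> T \<longleftrightarrow> g x \<in> S" using T_rec[of x] by blast
  also have "\<dots> \<longleftrightarrow> edge_height \<le> snd x \<and> snd x \<le> 1/2" unfolding S_square fst_g_bounds by (auto simp: snd_g)
  finally show ?thesis .
qed

lemma abs_diff_int_le_half:
  fixes y :: real
  assumes "\<bar>y\<bar> \<le> 1/2" "\<bar>y - of_int p\<bar> \<le> 1/2" "p \<noteq> 0" shows "p = 1 \<and> y = 1/2 \<or> p = -1 \<and> y = -1/2"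
proof -
  have "\<bar>real_of_int p\<bar> \<le> 1" using assms(1,2) by linarith
  then have "\<bar>p\<bar> \<le> 1" by linarith
  then have "p = 1 \<or> p = -1" using assms(3) by auto
  then show ?thesis using assms(1,2) by auto
qed

lemma right_neighbour: assumes "inS x 0 0" "inS x 1 0" shows "fst x = 1/2"
  using abs_diff_int_le_half[of "fst x" 1] assms unfolding inS_square by auto

lemma cap_on_top: assumes "x \<in> T" "q \<noteq> 0" "inS x p q" shows "snd x = 1/2"
  using abs_diff_int_le_half[of "snd x" q] T_square[OF assms(1)] assms bottom_edge[of x]
  unfolding inS_square by auto

sublocale row_tile N lam c0 c1 0 B S T
proof
  show "\<bar>p' - p\<bar> \<le> 1" if "inS x p 0" "inS x p' 0" for x p p'
  proof -
    have "\<bar>real_of_int p' - real_of_int p\<bar> \<le> 1" using that unfolding inS_square by linarith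
    then show ?thesis by linarith
  qed
  show "p = 0 \<and> q = 0" if "inS 0 p q" for p q
  proof -
    have "\<bar>real_of_int p\<bar> \<le> 1/2" "\<bar>real_of_int q\<bar> \<le> 1/2" using that unfolding inS_square by simp_all
    then show ?thesis by linarith
  qed
  show "\<not> (inU x 0 0 \<and> inT x 1 0)" for x
  proof
    assume x: "inU x 0 0 \<and> inT x 1 0"
    then have "fst x = 1/2" using right_neighbour[of x] inU_inS[of x 0 0] inT_inS[of x 1 0] by blast
    then show False using left_edge[of "x - lv 1 0"] left_edge[of "- x"] x edge_height by (simp add: inT_def)
  qed
  show "x \<in> T \<and> - x \<in> T \<longleftrightarrow> (inS (g x) 0 0 \<or> (\<exists>k\<in>{1..B-2}. inT (g x) k 0)) \<and>
      (inS (g x) (B-1) 0 \<or> (\<exists>k\<in>{1..B-2}. inU (g x) k 0))" for x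
    using inT_rec[of x 0 0] inU_rec[of x 0 0] by simp
  show "- x \<notin> T" if "x \<in> T" "q \<noteq> 0" "inS x p q" for x p q using bottom_edge[of "- x"] cap_on_top[OF that] by simp
qed

lemma vertical_segment:
  "closed_segment (c, s) (c, t) = {x. fst x = c \<and> min s t \<le> snd x \<and> snd x \<le> max s t}" for c s t :: real
proof -
  have "closed_segment (c, s) (c, t) = {c} \<times> closed_segment s t"
    using closed_segment_same_fst[of "(c, s)" "(c, t)"] by simp
  also have "closed_segment s t = {min s t..max s t}" by (simp add: closed_segment_eq_real_ivl)
  finally show ?thesis by (simp add: set_eq_iff mem_Times_iff)
qed

lemma horizontal_segment:
  "closed_segment (s, c) (t, c) = {x. snd x = c \<and> min s t \<le> fst x \<and> fst x \<le> max s t}" for c s t :: real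
proof -
  have "closed_segment (s, c) (t, c) = closed_segment s t \<times> {c}"
    using closed_segment_same_snd[of "(s, c)" "(t, c)"] by simp
  also have "closed_segment s t = {min s t..max s t}" by (simp add: closed_segment_eq_real_ivl)
  finally show ?thesis by (simp add: set_eq_iff mem_Times_iff conj_commute)
qed

lemma half_1_3: "half 1 \<inter> half 3 = {x. fst x = 1/2 \<and> edge_height \<le> snd x \<and> snd x \<le> 1/2}"
  and half_1_2: "half 1 \<inter> half 2 = {x. fst x = 1/2 \<and> - edge_height \<le> snd x \<and> snd x \<le> edge_height}"
proof -
  have halves: "half 1 = {x. inT x 0 0}" "half 2 = {x. inU x 1 0}" "half 3 = {x. inT x 1 0}"
    using half_odd[of 0] half_even[of 1] half_odd[of 1] by simp_all
  have right: "fst x = 1/2" if "inT x 0 0" "inT x 1 0 \<or> inU x 1 0" for x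
    using right_neighbour[of x] inT_inS[of x] inU_inS[of x] that by blast
  have edge: "inT x 0 0 \<longleftrightarrow> - edge_height \<le> snd x \<and> snd x \<le> 1/2" "inT x 1 0 \<longleftrightarrow> edge_height \<le> snd x \<and> snd x \<le> 1/2"
    "inU x 1 0 \<longleftrightarrow> - 1/2 \<le> snd x \<and> snd x \<le> edge_height" if "fst x = 1/2" for x
    using right_edge[of x] left_edge[of "x - lv 1 0"] right_edge[of "lv 1 0 - x"] that
    by (auto simp: inT_def inU_def)
  have "inT x 0 0 \<and> inT x 1 0 \<longleftrightarrow> fst x = 1/2 \<and> edge_height \<le> snd x \<and> snd x \<le> 1/2"
    "inT x 0 0 \<and> inU x 1 0 \<longleftrightarrow> fst x = 1/2 \<and> - edge_height \<le> snd x \<and> snd x \<le> edge_height" for x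
  proof (atomize (full), cases "fst x = 1/2")
    case True
    then show "(inT x 0 0 \<and> inT x 1 0 \<longleftrightarrow> fst x = 1/2 \<and> edge_height \<le> snd x \<and> snd x \<le> 1/2) \<and>
        (inT x 0 0 \<and> inU x 1 0 \<longleftrightarrow> fst x = 1/2 \<and> - edge_height \<le> snd x \<and> snd x \<le> edge_height)"
      unfolding edge[OF True] using edge_height by auto
  qed (use right in blast)
  then show "half 1 \<inter> half 3 = {x. fst x = 1/2 \<and> edge_height \<le> snd x \<and> snd x \<le> 1/2}"
    "half 1 \<inter> half 2 = {x. fst x = 1/2 \<and> - edge_height \<le> snd x \<and> snd x \<le> edge_height}"
    unfolding halves by blast+
qed

lemma cap_eq: "{x \<in> T. \<exists>p q. q \<noteq> 0 \<and> inS x p q} = {x. snd x = 1/2 \<and> \<bar>fst x\<bar> \<le> 1/2}"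
proof (intro equalityI subsetI)
  fix x :: "real \<times> real" assume x: "x \<in> {x. snd x = 1/2 \<and> \<bar>fst x\<bar> \<le> 1/2}"
  then have "inS x 0 1" "x \<in> T" using top_edge[of x] by (simp_all add: inS_square)
  then show "x \<in> {x \<in> T. \<exists>p q. q \<noteq> 0 \<and> inS x p q}" by (intro CollectI conjI exI[of _ 0] exI[of _ 1]) simp_all
next
  fix x assume "x \<in> {x \<in> T. \<exists>p q. q \<noteq> 0 \<and> inS x p q}"
  then show "x \<in> {x. snd x = 1/2 \<and> \<bar>fst x\<bar> \<le> 1/2}" using cap_on_top T_square by blast
qed

sublocale boundary_arcs N lam c0 c1 0 B S T "(1/2, 1/2)" "(1/2, - edge_height)"
proof
  have reflect: "lv 1 0 - (1/2, - edge_height) = (1/2, edge_height)" by (simp add: lv_def)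
  have "half 1 \<inter> half 3 = closed_segment (1/2, 1/2) (1/2, edge_height)"
    unfolding half_1_3 vertical_segment using edge_height by auto
  then show "arc_between (half 1 \<inter> half 3) (1/2, 1/2) (lv 1 0 - (1/2, - edge_height))"
    unfolding reflect using arc_between_segment[of "(1/2, 1/2)" "(1/2, edge_height)"] edge_height by simp
  have "half 1 \<inter> half 2 = closed_segment (1/2, edge_height) (1/2, - edge_height)"
    unfolding half_1_2 vertical_segment using edge_height by auto
  then show "arc_between (half 1 \<inter> half 2) (lv 1 0 - (1/2, - edge_height)) (1/2, - edge_height)"
    unfolding reflect using arc_between_segment[of "(1/2, edge_height)" "(1/2, - edge_height)"] edge_height by simp
  have "{x. snd x = (1/2::real) \<and> \<bar>fst x\<bar> \<le> (1/2::real)} = closed_segment (1/2, 1/2) (-1/2, 1/2)"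
    unfolding horizontal_segment by auto
  then show "arc_between {x \<in> T. \<exists>p q. q \<noteq> 0 \<and> inS x p q} (1/2, 1/2) ((1/2, 1/2) - lv 1 0)"
    unfolding cap_eq using arc_between_segment[of "(1/2, 1/2::real)" "(-1/2::real, 1/2)"] by (simp add: lv_def)
  show "half 1 \<inter> half 2 \<inter> half 3 \<subseteq> {lv 1 0 - (1/2, - edge_height)}"
    unfolding reflect using half_1_2 half_1_3 by (force simp: prod_eq_iff)
  show "x = (1/2, 1/2)" if "x \<in> T" "q \<noteq> 0" "inS x p q" "inS x 1 0" for x p q
    using right_neighbour[of x] that cap_on_top[OF that(1-3)] S_T[of x] by (simp add: prod_eq_iff)
  show "x = (1/2, 1/2) - lv 1 0" if "x \<in> T" "q \<noteq> 0" "inS x p q" "inS x (-1) 0" for x p q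
    using abs_diff_int_le_half[of "fst x" "-1"] T_square[OF that(1)] that cap_on_top[OF that(1-3)]
    by (simp add: inS_square prod_eq_iff)
  have "g (- (1/2, - edge_height)) = lv 1 0 - (1/2, 1/2)"
    unfolding g_eq using B_mult_edge_height by (simp add: lv_def field_simps)
  then show "g (1/2, - edge_height) = lv 1 0 - (1/2, 1/2) \<or> g (- (1/2, - edge_height)) = lv 1 0 - (1/2, 1/2)"
    by blast
qed

end

context crystile
begin

lemma disk_like_T_if_disk_like_S: assumes "B = 2" "disk_like S" shows "disk_like T"
proof -
  have T: "x \<in> T \<longleftrightarrow> g x \<in> S" for x using T_rec[of x] assms(1) by simp
  have "homeomorphism T S g gi"
    by (intro homeomorphismI continuous_on_gmap continuous_on_gi) (auto simp: T simp del: split_paired_All)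
  then show ?thesis using assms(2) disk_like_homeomorphic unfolding homeomorphic_def by blast
qed

end

lemma (in tile_A0) disk_like_S: "disk_like S"
proof -
  have S: "S = cbox (-1/2, -1/2) (1/2, 1/2)" using S_square by (auto simp: cbox_Pair_eq abs_le_iff)
  have "(0, 0) \<in> box (-1/2, -1/2) (1/2::real, 1/2::real)" by (simp add: box_def Basis_prod_def)
  then have "interior S \<noteq> {}" unfolding S interior_cbox by blast
  then show ?thesis
    unfolding disk_like_def S by (intro homeomorphic_convex_compact_cball) (auto simp: convex_box compact_cbox)
qed

lemma disk_like_tile_0: assumes "2 \<le> B" shows "disk_like (tile 0 B)"
proof -
  obtain N lam c0 c1 where "crystile N lam c0 c1 0 B (sym_tile 0 B) (tile 0 B)"
    using crystile_exists[of B 0] assms by auto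
  then interpret crystile N lam c0 c1 0 B "sym_tile 0 B" "tile 0 B" .
  interpret tile_A0 N lam c0 c1 B "sym_tile 0 B" "tile 0 B" by unfold_locales
  show ?thesis
  proof (cases "B = 2")
    case True then show ?thesis using disk_like_T_if_disk_like_S disk_like_S by blast
  next
    case False
    then interpret tile_A0_wide N lam c0 c1 B "sym_tile 0 B" "tile 0 B" by unfold_locales (use assms in simp)
    show ?thesis by (rule disk_like_T)
  qed
qed

section \<open>The tile for A = B = 2\<close>

text \<open>Here \<open>g\<close> maps the right side \<open>side 1 0\<close> onto \<open>side 1 1\<close>, which is a chain of two contracted copies of
  \<open>side 2 1\<close> around a reflected copy of itself; \<open>side 2 1\<close> is a contracted copy of \<open>side 1 1\<close>.\<close>

locale lattice_tile_A2_B2 = six_neighbour_tile N lam c0 c1 2 2 S for N lam c0 c1 S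
begin

lemma inS_two_digits: "inS x p q \<longleftrightarrow> inS (g x) (- 2 * q) (p - 2 * q) \<or> inS (g x) (1 - 2 * q) (p - 2 * q)"
proof -
  have "{0..2-1::int} = {0, 1}" by auto
  then show ?thesis unfolding inS_rec[of x p q] by simp
qed

lemma mem_side_right: "x \<in> side 1 0 \<longleftrightarrow> g x \<in> side 1 1"
proof -
  have "x \<in> side 1 0 \<longleftrightarrow> (inS (g x) 0 0 \<or> inS (g x) 1 0) \<and> (inS (g x) 0 1 \<or> inS (g x) 1 1)"
    unfolding side_def mem_Collect_eq inS_two_digits[of x 0 0] inS_two_digits[of x 1 0] by simp
  also have "\<dots> \<longleftrightarrow> inS (g x) 0 0 \<and> inS (g x) 1 1"
    using neighbours[of "g x" 0 0 0 1] neighbours[of "g x" 1 0 0 1] neighbours[of "g x" 1 0 1 1] by auto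
  finally show ?thesis unfolding side_def mem_Collect_eq .
qed

definition to_upper :: "real \<times> real \<Rightarrow> real \<times> real" where "to_upper x = gi (gi x - lv 1 0)"

lemma to_right_image: "gi ` side 1 1 = side 1 0"
  by (rule set_eqI) (simp add: mem_gi_image mem_side_right)

lemma to_upper_image: "to_upper ` side 1 1 = side 2 1"
proof (rule set_eqI)
  fix x
  have "x \<in> to_upper ` side 1 1 \<longleftrightarrow> g (g x + lv 1 0) \<in> side 1 1"
    by (rule mem_image_inverse) (simp_all add: to_upper_def)
  then show "x \<in> to_upper ` side 1 1 \<longleftrightarrow> x \<in> side 2 1" unfolding mem_side_upper_shift mem_side_right .
qed

lemma gi_vertex2: "gi vertex2 = lv 1 0 - vertex1"
proof -
  have "g (lv 1 0 - vertex1) = lv 1 0 - g (vertex1 - lv 1 0)" using gmap_minus[of 2 2 "vertex1 - lv 1 0"] by simp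
  also have "\<dots> = vertex2" unfolding g_vertex1_left vertex2_def by (simp add: lv_def prod_eq_iff)
  finally show ?thesis by (metis gi_g)
qed

lemma to_upper_ends: "to_upper vertex2 = vertex2" "to_upper (vertex1 - lv 1 0) = vertex1"
  unfolding to_upper_def gi_vertex2 gi_vertex by (simp_all add: gi_vertex)

lemma contraction_to_upper: "contraction to_upper"
  unfolding to_upper_def[abs_def] using contraction_nonexpansive[OF contraction_ginv]
  by (intro contraction_comp[OF contraction_ginv]) simp

lemma inj_to_upper: "inj to_upper"
  by (rule injI) (auto simp: to_upper_def dest!: injD[OF inj_gi])

definition middle_part :: "nat \<Rightarrow> (real \<times> real) set" where
  "middle_part i = {x. inS (g x) (if i = 2 then 1 else 0) 0 \<and> inS (g x) (if i = 0 then -2 else -1) (-1)}"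

definition middle_point :: "nat \<Rightarrow> real \<times> real" where
  "middle_point i = gi (if i = 0 then - vertex1 else if i = 1 then vertex1 - lv 2 1
    else if i = 2 then vertex2 - lv 1 1 else vertex1 - lv 1 1)"

definition middle_copy :: "nat \<Rightarrow> real \<times> real \<Rightarrow> real \<times> real" where
  "middle_copy i x = gi (if i = 1 then - x else to_upper x - (if i = 0 then lv 2 1 else lv 1 1))"

lemma middle_eq_parts: "side 1 1 = (\<Union>i<3. middle_part i)"
proof (rule set_eqI)
  fix x
  have "x \<in> side 1 1 \<longleftrightarrow> (inS (g x) 0 0 \<or> inS (g x) 1 0) \<and> (inS (g x) (-2) (-1) \<or> inS (g x) (-1) (-1))"
    unfolding side_def mem_Collect_eq inS_two_digits[of x 0 0] inS_two_digits[of x 1 1] by simp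
  also have "\<dots> \<longleftrightarrow> (inS (g x) 0 0 \<and> inS (g x) (-2) (-1)) \<or> (inS (g x) 0 0 \<and> inS (g x) (-1) (-1)) \<or>
      (inS (g x) 1 0 \<and> inS (g x) (-1) (-1))"
    using neighbours[of "g x" "-2" "-1" 1 0] by auto
  also have "\<dots> \<longleftrightarrow> x \<in> middle_part 0 \<union> middle_part 1 \<union> middle_part 2" unfolding Un_iff middle_part_def by simp
  also have "middle_part 0 \<union> middle_part 1 \<union> middle_part 2 = (\<Union>i<3. middle_part i)"
    by (simp add: eval_nat_numeral lessThan_Suc Un_ac)
  finally show "x \<in> side 1 1 \<longleftrightarrow> x \<in> (\<Union>i<3. middle_part i)" .
qed

lemma middle_copy_image:
  assumes "i < 3" shows "middle_part i = middle_copy i ` side 1 1"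
proof (rule set_eqI)
  fix x
  have outer: "x \<in> (\<lambda>y. gi (to_upper y - v)) ` side 1 1 \<longleftrightarrow> g x + v \<in> side 2 1" for v
  proof -
    have "(\<lambda>y. gi (to_upper y - v)) ` side 1 1 = (\<lambda>y. gi (y - v)) ` side 2 1"
      by (simp add: image_image flip: to_upper_image)
    then show ?thesis using mem_image_inverse[of "\<lambda>x. g x + v" "\<lambda>y. gi (y - v)" x "side 2 1"] by simp
  qed
  from assms consider "i = 0" | "i = 1" | "i = 2" by linarith
  then show "x \<in> middle_part i \<longleftrightarrow> x \<in> middle_copy i ` side 1 1"
  proof cases
    case 1
    then show ?thesis using outer[of "lv 2 1"]
      by (simp add: middle_copy_def[abs_def] middle_part_def side_def inS_plus conj_commute del: inS_00)
  next
    case 2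
    have "x \<in> (\<lambda>y. gi (- y)) ` side 1 1 \<longleftrightarrow> - g x \<in> side 1 1" by (rule mem_image_inverse) simp_all
    then show ?thesis using 2
      by (simp add: middle_copy_def[abs_def] middle_part_def side_def inS_minus del: inS_00)
  next
    case 3
    then show ?thesis using outer[of "lv 1 1"]
      by (simp add: middle_copy_def[abs_def] middle_part_def side_def inS_plus conj_commute del: inS_00)
  qed
qed

lemma middle_point_ends: "middle_point 0 = vertex2" "middle_point 3 = vertex1 - lv 1 0"
  by (simp_all add: middle_point_def gi_vertex)

lemma middle_copy_ends:
  assumes "i < 3"
  shows "middle_copy i (middle_point 0) = middle_point i" "middle_copy i (middle_point 3) = middle_point (Suc i)"
proof -
  have "- vertex2 = vertex1 - lv 2 1" "- (vertex1 - lv 1 0) = vertex2 - lv 1 1" "vertex2 - lv 2 1 = - vertex1"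
    by (simp_all add: vertex2_def lv_def prod_eq_iff)
  then show "middle_copy i (middle_point 0) = middle_point i" "middle_copy i (middle_point 3) = middle_point (Suc i)"
    using assms unfolding middle_point_ends
    unfolding middle_copy_def to_upper_ends middle_point_def by (auto simp: eval_nat_numeral less_Suc_eq)
qed

lemma contraction_middle_copy: "contraction (middle_copy i)"
proof -
  have "N (- p - - q) = N (p - q)" for p q using N_minus[of "p - q"] by simp
  then show ?thesis unfolding middle_copy_def[abs_def]
    by (intro contraction_comp[OF contraction_ginv]) (simp add: contraction_nonexpansive[OF contraction_to_upper])
qed

lemma inj_middle_copy: "inj (middle_copy i)"
  by (rule injI) (auto simp: middle_copy_def dest!: injD[OF inj_gi] injD[OF inj_to_upper] split: if_splits)

lemma middle_parts_adjacent:
  assumes "Suc i < 3" shows "middle_part i \<inter> middle_part (Suc i) \<subseteq> {middle_point (Suc i)}"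
proof
  fix x assume x: "x \<in> middle_part i \<inter> middle_part (Suc i)"
  from assms consider "i = 0" | "i = 1" by linarith
  then show "x \<in> {middle_point (Suc i)}"
  proof cases
    case 1
    have "g x + lv 2 1 = vertex1"
      by (rule vertex1_unique) (use x 1 in \<open>unfold inS_plus, auto simp: middle_part_def\<close>)
    then have "g x = vertex1 - lv 2 1" by (simp add: algebra_simps)
    then show ?thesis using 1 by (simp add: middle_point_def eq_gi_iff)
  next
    case 2
    have "g x + lv 1 1 = vertex2"
      by (rule vertex2_unique) (use x 2 in \<open>unfold inS_plus, auto simp: middle_part_def\<close>)
    then have "g x = vertex2 - lv 1 1" by (simp add: algebra_simps)
    then show ?thesis using 2 by (simp add: middle_point_def eq_gi_iff)
  qed
qed

sublocale middle: arc_chain N lam c0 c1 "side 1 1" middle_part middle_point middle_copy UNIV 3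
proof
  show "compact (side 1 1)" by (rule compact_side)
  have "vertex2 \<in> side 1 1" using vertex2_mem by (simp add: side_def)
  then show "side 1 1 \<noteq> {}" by blast
  show "side 1 1 = (\<Union>i<3. middle_part i)" by (rule middle_eq_parts)
  show "middle_part i = middle_copy i ` side 1 1 \<and> middle_copy i (middle_point 0) = middle_point i \<and>
      middle_copy i (middle_point 3) = middle_point (Suc i) \<and> inj (middle_copy i) \<and> contraction (middle_copy i)"
    if "i < 3" for i
    using that by (intro conjI middle_copy_image middle_copy_ends inj_middle_copy contraction_middle_copy)
  show "middle_part i \<inter> middle_part j = {}" if "i < 3" "j < 3" "Suc i < j" for i j
  proof -
    have "i = 0" "j = 2" using that by auto
    then have "inS (g x) (-2) (-1) \<and> inS (g x) 1 0" if "x \<in> middle_part i \<inter> middle_part j" for x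
      using that unfolding middle_part_def by auto
    then show ?thesis using neighbours[of _ "-2" "-1" 1 0] by fastforce
  qed
  show "middle_part i \<inter> middle_part (Suc i) \<subseteq> {middle_point (Suc i)}" if "Suc i < 3" for i
    by (rule middle_parts_adjacent[OF that])
qed auto

definition half_boundary :: "(real \<times> real) set" where
  "half_boundary = side 1 0 \<union> (side 2 1 \<union> side 1 1)"

lemma half_boundary_arc: "arc_between half_boundary (lv 1 0 - vertex1) (vertex1 - lv 1 0)"
proof -
  have middle: "arc_between (side 1 1) vertex2 (vertex1 - lv 1 0)"
    using middle.chain_arc unfolding middle_point_ends .
  have copy: "arc_between (f ` side 1 1) (f vertex2) (f (vertex1 - lv 1 0))" if "contraction f" "inj f" for f
    using that by (intro arc_between_image[OF middle] contraction_continuous) (auto intro: inj_on_subset)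
  have right: "arc_between (side 1 0) (lv 1 0 - vertex1) vertex1"
    using copy[OF contraction_ginv inj_gi] unfolding to_right_image gi_vertex2 gi_vertex .
  have "arc_between (side 2 1) vertex1 vertex2"
    using arc_between_reverse[OF copy[OF contraction_to_upper inj_to_upper]]
    unfolding to_upper_image to_upper_ends .
  moreover have "side 2 1 \<inter> side 1 1 \<subseteq> {vertex2}" using vertex2_unique by (auto simp: side_def)
  ultimately have "arc_between (side 2 1 \<union> side 1 1) vertex1 (vertex1 - lv 1 0)"
    by (rule arc_between_join[OF _ middle])
  moreover have "side 1 0 \<inter> side 1 1 = {}" using neighbours[of _ 1 0 1 1] by (auto simp: side_def)
  then have "side 1 0 \<inter> (side 2 1 \<union> side 1 1) \<subseteq> {vertex1}" using vertex1_unique by (auto simp: side_def)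
  ultimately show ?thesis unfolding half_boundary_def by (rule arc_between_join[OF right])
qed

lemma mem_half_boundary: "x \<in> half_boundary \<longleftrightarrow> inS x 0 0 \<and> (inS x 1 0 \<or> inS x 2 1 \<or> inS x 1 1)"
  and mem_opposite_boundary: "- x \<in> half_boundary \<longleftrightarrow> inS x 0 0 \<and> (inS x (-1) 0 \<or> inS x (-2) (-1) \<or> inS x (-1) (-1))"
  unfolding half_boundary_def Un_iff side_minus by (auto simp: side_def)

lemma opposite_boundaries_meet:
  assumes "x \<in> half_boundary" "- x \<in> half_boundary" shows "x = lv 1 0 - vertex1 \<or> x = vertex1 - lv 1 0"
proof -
  have x0: "inS x 0 0" using assms(1) mem_half_boundary by blast
  consider "inS x 1 0" "inS x (-1) (-1)" | "inS x 1 1" "inS x (-1) 0"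
    using assms neighbours[of x 1 0 "-1" 0] neighbours[of x 1 0 "-2" "-1"] neighbours[of x 2 1 "-1" 0]
      neighbours[of x 2 1 "-2" "-1"] neighbours[of x 2 1 "-1" "-1"] neighbours[of x 1 1 "-2" "-1"]
      neighbours[of x 1 1 "-1" "-1"]
    unfolding mem_opposite_boundary unfolding mem_half_boundary by auto
  then show ?thesis
  proof cases
    case 1
    then have "x + lv 1 1 = vertex2" using x0 by (intro vertex2_unique) (simp_all add: inS_plus del: inS_00)
    then have "x = vertex2 - lv 1 1" by (simp add: algebra_simps)
    then show ?thesis by (simp add: vertex2_def lv_def prod_eq_iff)
  next
    case 2
    then have "x + lv 1 0 = vertex1" using x0 by (intro vertex1_unique) (simp_all add: inS_plus del: inS_00)
    then show ?thesis by (simp add: algebra_simps)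
  qed
qed

lemma S_Int_other_blocks: "S \<inter> other_blocks = half_boundary \<union> {x. - x \<in> half_boundary}"
proof (rule set_eqI)
  fix x
  have "x \<in> S \<inter> other_blocks \<longleftrightarrow> inS x 0 0 \<and> (\<exists>p q. (p \<noteq> 0 \<or> q \<noteq> 0) \<and> inS x p q)" by (simp add: mem_other_blocks)
  also have "\<dots> \<longleftrightarrow> inS x 0 0 \<and> (inS x 1 0 \<or> inS x 2 1 \<or> inS x 1 1 \<or> inS x (-1) 0 \<or> inS x (-2) (-1) \<or> inS x (-1) (-1))"
  proof (intro conj_cong refl iffI)
    assume "inS x 0 0" "\<exists>p q. (p \<noteq> 0 \<or> q \<noteq> 0) \<and> inS x p q"
    then obtain p q where pq: "inS x 0 0" "p \<noteq> 0 \<or> q \<noteq> 0" "inS x p q" by blast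
    then have "q = 0 \<and> (p = 1 \<or> p = -1) \<or> q = 1 \<and> (p = 2 \<or> p = 1) \<or> q = -1 \<and> (p = -2 \<or> p = -1)"
      using neighbours[OF pq(1,3)] by (cases "q = 0") auto
    then show "inS x 1 0 \<or> inS x 2 1 \<or> inS x 1 1 \<or> inS x (-1) 0 \<or> inS x (-2) (-1) \<or> inS x (-1) (-1)"
      using pq(3) by auto
  qed (metis neg_equal_0_iff_equal zero_neq_numeral zero_neq_one)
  finally show "x \<in> S \<inter> other_blocks \<longleftrightarrow> x \<in> half_boundary \<union> {x. - x \<in> half_boundary}"
    using mem_half_boundary mem_opposite_boundary by blast
qed

theorem disk_like_S: "disk_like S"
proof (rule disk_like_if_bounded_by_arcs[OF S_compact half_boundary_arc _ _ closed_other_blocks S_Int_other_blocks])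
  show "arc_between {x. - x \<in> half_boundary} (vertex1 - lv 1 0) (lv 1 0 - vertex1)"
    using arc_between_reflect[OF half_boundary_arc, of 0] by simp
  show "half_boundary \<inter> {x. - x \<in> half_boundary} \<subseteq> {lv 1 0 - vertex1, vertex1 - lv 1 0}"
    using opposite_boundaries_meet by blast
  show "- other_blocks \<subseteq> S" using mem_S_or_other_blocks by blast
  have "0 \<notin> other_blocks" using zero_only mem_other_blocks by blast
  then show "other_blocks \<noteq> UNIV" by blast
qed

end

lemma disk_like_tile_2_2: "disk_like (tile 2 2)"
proof -
  obtain N lam c0 c1 where "crystile N lam c0 c1 2 2 (sym_tile 2 2) (tile 2 2)"
    using crystile_exists[of 2 2] by auto
  then interpret crystile N lam c0 c1 2 2 "sym_tile 2 2" "tile 2 2" .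
  interpret lattice_tile_A2_B2 N lam c0 c1 "sym_tile 2 2" by unfold_locales simp_all
  show ?thesis using disk_like_T_if_disk_like_S disk_like_S by blast
qed

section \<open>The classification\<close>

lemma not_disk_like_tile:
  assumes "2 \<le> A" "3 \<le> B" "2 * A < B + 3" shows "\<not> disk_like (tile A B)"
proof -
  have "\<bar>A\<bar> \<le> B - 2 \<or> A * A < 4 * B"
  proof (cases "A \<le> B - 2")
    case True then show ?thesis using assms by simp
  next
    case False
    then have "A \<le> 3" using assms by linarith
    then have "A * A \<le> 3 * 3" using assms by (intro mult_mono) auto
    then show ?thesis using assms by linarith
  qed
  then obtain N lam c0 c1 where "crystile N lam c0 c1 A B (sym_tile A B) (tile A B)"
    using crystile_exists[of B A] assms by auto
  then interpret crystile N lam c0 c1 A B "sym_tile A B" "tile A B" .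
  interpret nondisk_tile N lam c0 c1 A B "sym_tile A B" "tile A B" by unfold_locales fact+
  show ?thesis by (rule not_disk_like)
qed

theorem theorem5p3:
  fixes A B :: int
  assumes "-1 \<le> A" and "A \<le> B" and "B \<ge> 2" and "2 * A < B + 3"
  shows "((A \<in> {-1, 0, 1} \<and> B \<ge> 2) \<or> (A = 2 \<and> B = 2) \<longrightarrow> disk_like (tile A B))
       \<and> (A \<ge> 2 \<and> B \<ge> 3 \<longrightarrow> \<not> disk_like (tile A B))"
proof (intro conjI impI)
  assume "(A \<in> {-1, 0, 1} \<and> B \<ge> 2) \<or> (A = 2 \<and> B = 2)"
  then consider "A = -1" | "A = 0" | "A = 1" | "A = 2" "B = 2" by blast
  then show "disk_like (tile A B)"
    by cases (use assms(3) disk_like_tile_minus1 disk_like_tile_0 disk_like_tile_1 disk_like_tile_2_2 in simp_all)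
next
  assume "A \<ge> 2 \<and> B \<ge> 3"
  then show "\<not> disk_like (tile A B)" using not_disk_like_tile assms(4) by blast
qed

end
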